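(* Let $d\in\mathbb{N}$ and let $w\in L_1^{d\times d}(\mathbb{T})$ be such that $w(e^{i\theta})$ is a positive Hermitian matrix for $\sigma$-a.e. $\theta$. Let $\gamma(k)=\int_{-\pi}^{\pi}e^{-ik\theta}w(e^{i\theta})\frac{d\theta}{2\pi}$, $k\in\mathbb{Z}$, and assume that $\sum_{k=-\infty}^\infty\|\gamma(k)\|<\infty$ and $\min_{z\in\mathbb{T}}\det w(z)>0$. Let $\{y_k\}_{k=1}^\infty$ be a sequence in $\mathbb{C}^{d\times d}$ with $\sum_{k=1}^\infty\|y_k\|<\infty$. For $n\in\mathbb{N}$ let $Z_n=(z_{n,1}^\top,\dots,z_{n,n}^\top)^\top\in\mathbb{C}^{dn\times d}$, with $z_{n,k}\in\mathbb{C}^{d\times d}$, be the solution of the block Toeplitz system $$T_n(w)Z_n=Y_n,\qquad Y_n=(y_1^\top,\dots,y_n^\top)^\top,$$ and let $Z_\infty=(z_1^\top,z_2^\top,\dots)^\top$, with $z_k\in\mathbb{C}^{d\times d}$, be the solution of the infinite block Toeplitz system $$T_\infty(w)Z_\infty=Y_\infty,\qquad Y_\infty=(y_1^\top,y_2^\top,\dots)^\top .$$ Then $$\lim_{n\to\infty}\sum_{k=1}^n\|z_{n,k}-z_k\|=0.$$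
   Context: $\mathbb{T}=\{z\in\mathbb{C}:|z|=1\}$, $\mathbb{D}=\{|z|<1\}$, $\sigma=d\theta/(2\pi)$ on $[-\pi,\pi)$; $L_1^{d\times d}(\mathbb{T})$ is the space of $\mathbb{C}^{d\times d}$-valued functions with entries in $L_1(\mathbb{T},\sigma)$. $\|\cdot\|$ is the operator norm on $\mathbb{C}^{d\times d}$. Since $\sum_k\|\gamma(k)\|<\infty$, $w$ is (taken to be) continuous on $\mathbb{T}$, so the condition on $\min_{z\in\mathbb{T}}\det w(z)$ makes sense. $T_n(w)\in\mathbb{C}^{dn\times dn}$ is the block matrix with $(s,t)$ block $\gamma(s-t)$, $1\le s,t\le n$ (it is invertible), and $T_\infty(w)$ is the infinite block matrix with $(s,t)$ block $\gamma(s-t)$, $s,t\in\mathbb{N}$. The solution $Z_\infty$ of the infinite system is the one given by $$z_s=\sum_{t=1}^\infty\sum_{\ell=1}^{\min(s,t)}\tilde a_{s-\ell}^*\tilde a_{t-\ell}\,y_t,\qquad s\in\mathbb{N}$$ (absolutely convergent), where $\{\tilde a_k\}_{k\ge 0}$ is defined as follows. Let $h_\sharp$ be an outer function in the matrix Hardy space $H_2^{d\times d}(\mathbb{T})$ (i.e. entries in $H_2$ and $\det h_\sharp$ a scalar outer function) with $w=h_\sharp^*h_\sharp$ $\sigma$-a.e. on $\mathbb{T}$; it exists and is unique up to a constant unitary left factor. Put $\tilde h(z)=\{h_\sharp(\overline z)\}^*$ and $-\tilde h(z)^{-1}=\sum_{k=0}^\infty z^k\tilde a_k$ for $z\in\mathbb{D}$;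 then $\sum_k\|\tilde a_k\|<\infty$. *)

theory Defs
  imports "HOL-Analysis.Analysis"
begin

text \<open>Matrices in \<open>\<complex>\<^sup>d\<^sup>\<times>\<^sup>d\<close> are elements of \<^typ>\<open>complex^'d^'d\<close> with \<open>d = CARD('d)\<close>.\<close>

definition hconj :: "complex^'n^'m \<Rightarrow> complex^'m^'n" where
  "hconj A = (\<chi> i j. cnj (A $ j $ i))"

text \<open>The library norm on \<^typ>\<open>complex^'d^'d\<close> is the Frobenius norm, not the operator norm.\<close>

definition opnorm :: "complex^'n^'m \<Rightarrow> real" where
  "opnorm A = onorm (\<lambda>x. A *v x)"

definition pos_hermitian :: "complex^'d^'d \<Rightarrow> bool" where
  "pos_hermitian A \<longleftrightarrow>
     hconj A = A \<and> (\<forall>x. x \<noteq> 0 \<longrightarrow> 0 < Re (\<Sum>i\<in>UNIV. cnj (x $ i) * (A *v x) $ i))"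

text \<open>The measure \<open>d\<theta> / (2\<pi>)\<close> on \<open>[-\<pi>, \<pi>)\<close>. Functions on the unit circle are
  integrated through \<open>\<theta> \<mapsto> cis \<theta>\<close>; Lebesgue (not only Borel) measurable functions are allowed.\<close>

definition circle_measure :: "real measure" where
  "circle_measure = uniform_measure lebesgue {-pi..<pi}"

definition L1_mat :: "(complex \<Rightarrow> complex^'d^'d) \<Rightarrow> bool" where
  "L1_mat w \<longleftrightarrow> (\<forall>i j. integrable circle_measure (\<lambda>\<theta>. w (cis \<theta>) $ i $ j))"

definition fourier_coeff :: "(complex \<Rightarrow> complex^'d^'d) \<Rightarrow> int \<Rightarrow> complex^'d^'d" where
  "fourier_coeff w k =
     (\<chi> i j. LINT \<theta>|circle_measure. cis (- (real_of_int k * \<theta>)) * w (cis \<theta>) $ i $ j)"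

text \<open>The \<open>(s, t)\<close> block of \<open>T\<^sub>n(w)\<close> and of \<open>T\<^sub>\<infinity>(w)\<close>. Block rows and columns are numbered from 1.\<close>

definition toeplitz_block :: "(complex \<Rightarrow> complex^'d^'d) \<Rightarrow> nat \<Rightarrow> nat \<Rightarrow> complex^'d^'d" where
  "toeplitz_block w s t = fourier_coeff w (int s - int t)"

definition toeplitz_solution ::
    "(complex \<Rightarrow> complex^'d^'d) \<Rightarrow> (nat \<Rightarrow> complex^'d^'d) \<Rightarrow> nat \<Rightarrow> (nat \<Rightarrow> complex^'d^'d) \<Rightarrow> bool" where
  "toeplitz_solution w y n z \<longleftrightarrow>
     (\<forall>s\<in>{1..n}. (\<Sum>t=1..n. toeplitz_block w s t ** z t) = y s)"

definition toeplitz_solution_inf ::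
    "(complex \<Rightarrow> complex^'d^'d) \<Rightarrow> (nat \<Rightarrow> complex^'d^'d) \<Rightarrow> (nat \<Rightarrow> complex^'d^'d) \<Rightarrow> bool" where
  "toeplitz_solution_inf w y z \<longleftrightarrow>
     (\<forall>s\<ge>1. ((\<lambda>t. toeplitz_block w s t ** z t) has_sum y s) {1..})"

text \<open>A Hardy class function is identified with its boundary function: it is one function on the
  closed disc, whose value at almost every point of the unit circle is the radial limit.
  Values on a null set of the circle are irrelevant.\<close>

definition radial_boundary :: "(complex \<Rightarrow> complex) \<Rightarrow> bool" where
  "radial_boundary f \<longleftrightarrow>
     (AE \<theta> in circle_measure. ((\<lambda>r. f (of_real r * cis \<theta>)) \<longlongrightarrow> f (cis \<theta>)) (at_left (1::real)))"

definition hardy_H2 :: "(complex \<Rightarrow> complex) \<Rightarrow> bool" where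
  "hardy_H2 f \<longleftrightarrow>
     f holomorphic_on ball 0 1 \<and>
     bdd_above ((\<lambda>r. LINT \<theta>|circle_measure. (cmod (f (of_real r * cis \<theta>)))\<^sup>2) ` {0..<1}) \<and>
     radial_boundary f"

text \<open>The nonvanishing condition is needed because \<^prop>\<open>ln (0::real) = 0\<close>.\<close>

definition outer_function :: "(complex \<Rightarrow> complex) \<Rightarrow> bool" where
  "outer_function f \<longleftrightarrow>
     f holomorphic_on ball 0 1 \<and> radial_boundary f \<and>
     (AE \<theta> in circle_measure. f (cis \<theta>) \<noteq> 0) \<and>
     integrable circle_measure (\<lambda>\<theta>. ln (cmod (f (cis \<theta>)))) \<and>
     (\<exists>c. cmod c = 1 \<and>
        (\<forall>z\<in>ball 0 1. f z = c * exp (LINT \<theta>|circle_measure.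
            (cis \<theta> + z) / (cis \<theta> - z) * of_real (ln (cmod (f (cis \<theta>)))))))"

definition outer_H2_mat :: "(complex \<Rightarrow> complex^'d^'d) \<Rightarrow> bool" where
  "outer_H2_mat h \<longleftrightarrow>
     (\<forall>i j. hardy_H2 (\<lambda>z. h z $ i $ j)) \<and> outer_function (\<lambda>z. det (h z))"

definition htilde :: "(complex \<Rightarrow> complex^'d^'d) \<Rightarrow> complex \<Rightarrow> complex^'d^'d" where
  "htilde h z = hconj (h (cnj z))"

text \<open>\<open>a\<close> is the sequence of Taylor coefficients of \<open>- matrix_inv (htilde h z)\<close> on the open unit disc;
  the power series is written entry by entry.\<close>

definition atilde_coeffs :: "(complex \<Rightarrow> complex^'d^'d) \<Rightarrow> (nat \<Rightarrow> complex^'d^'d) \<Rightarrow> bool" where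
  "atilde_coeffs h a \<longleftrightarrow>
     (\<forall>z\<in>ball 0 1. \<forall>i j.
        (\<lambda>k. z ^ k * a k $ i $ j) sums ((- matrix_inv (htilde h z)) $ i $ j))"

definition Z_inf :: "(nat \<Rightarrow> complex^'d^'d) \<Rightarrow> (nat \<Rightarrow> complex^'d^'d) \<Rightarrow> nat \<Rightarrow> complex^'d^'d" where
  "Z_inf a y s =
     (\<Sum>\<^sub>\<infinity>t\<in>{1..}. \<Sum>l=1..min s t. hconj (a (s - l)) ** a (t - l) ** y t)"

end

theory Submission
  imports Defs "HOL-Complex_Analysis.Cauchy_Integral_Formula" "HOL-Library.Function_Algebras"
begin

text \<open>
The convergence of the finite sections is a stability statement. Suppose that the inverses of all
sections \<open>T\<^sub>n(w)\<close> are bounded by a single constant \<open>C\<close> in the sum norm \<open>\<Sum>s. norm (u s)\<close>, and that \<open>z\<close>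
is an absolutely summable solution of the infinite system. If \<open>P\<^sub>n\<close> cuts a sequence off after \<open>n\<close> entries, then
\<open>T\<^sub>n(w) (Z\<^sub>n - P\<^sub>n z) = P\<^sub>n T\<^sub>\<infinity>(w) (1 - P\<^sub>n) z\<close>, so the error is at most \<open>C\<close> times the sum of the norms of
the Fourier coefficients of \<open>w\<close> times the tail of \<open>z\<close> (lemma \<open>section_error\<close>). It remains to find \<open>C\<close> and
to show that the given formula defines such a \<open>z\<close>.

Uniform stability (lemma \<open>toeplitz_l1_stability\<close>). In the mean square norm it is immediate: \<open>w\<close> is bounded
below by some \<open>\<kappa> > 0\<close>, and the form of a Toeplitz matrix is the average of the form of its symbol. To
pass to the sum norm, a sequence is localized by weights \<open>exp (- e \<bar>t - x\<bar>)\<close> around every integer \<open>x\<close>.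
Since the Fourier coefficients of \<open>w\<close> are absolutely summable, a Toeplitz matrix nearly commutes with these weights
when \<open>e\<close> is small. The mean square bound therefore applies to each localized piece, and summing over \<open>x\<close> gives the
bound in the sum norm (lemma \<open>l1_stability\<close>). All constants are independent of \<open>n\<close>.

The infinite system. From \<open>w = hconj h ** h\<close> the inverse of \<open>T\<^sub>\<infinity>(w)\<close> should be the product of the lower
triangular Toeplitz matrix of \<open>- matrix_inv h\<close> and its adjoint, and the blocks of this product are the sums in the
definition of \<open>Z_inf\<close>. To justify this, \<open>h\<close> is shown to be bounded in the disc, as a Hardy function with bounded boundary
values, and \<open>det h\<close> to be bounded away from zero, as an outer function; so \<open>- matrix_inv h\<close> is bounded and
its Taylor coefficients are square summable. The identity \<open>w ** (- matrix_inv h) = - hconj h\<close> on the circle says that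
\<open>T\<^sub>\<infinity>(w)\<close> maps these coefficients to a sequence with one nonzero entry (lemma \<open>toeplitz_neg_inv\<close>). They are
thus the mean square limit of solutions of finite systems with a fixed right-hand side, which are bounded in the
sum norm by stability; this makes the coefficients absolutely summable (lemma \<open>neg_inv_coeff_summable\<close>).
After that all double series converge absolutely, and the two identities between \<open>w\<close>, \<open>h\<close> and the inverse of \<open>h\<close> verify the
infinite system (lemma \<open>toeplitz_sol\<close>).
\<close>

section \<open>From stability in mean square to stability in the sum norm\<close>

lemma L2_set_sum_le:
  assumes "finite K" "\<And>k s. k \<in> K \<Longrightarrow> s \<in> I \<Longrightarrow> 0 \<le> f k s"
  shows "L2_set (\<lambda>s. \<Sum>k\<in>K. f k s) I \<le> (\<Sum>k\<in>K. L2_set (f k) I)"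
  using assms
proof (induction K rule: finite_induct)
  case empty
  then show ?case by (simp add: L2_set_def)
next
  case (insert k K)
  have "L2_set (\<lambda>s. \<Sum>j\<in>insert k K. f j s) I = L2_set (\<lambda>s. f k s + (\<Sum>j\<in>K. f j s)) I"
    using insert by simp
  also have "\<dots> \<le> L2_set (f k) I + L2_set (\<lambda>s. \<Sum>j\<in>K. f j s) I"
    by (rule L2_set_triangle_ineq)
  also have "\<dots> \<le> L2_set (f k) I + (\<Sum>j\<in>K. L2_set (f j) I)"
    using insert by auto
  finally show ?case using insert by simp
qed

text \<open>Some shifted indices may leave the support \<open>J\<close> of \<open>V\<close>, so the shift need not preserve the norm.\<close>
lemma L2_set_shift_le:
  fixes V :: "int \<Rightarrow> real"
  assumes "finite I" "finite J" "\<And>j. j \<notin> J \<Longrightarrow> V j = 0"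
  shows "L2_set (\<lambda>s. V (s - k)) I \<le> L2_set V J"
proof -
  have "(\<Sum>s\<in>I. (V (s - k))\<^sup>2) = (\<Sum>j\<in>(\<lambda>s. s - k) ` I. (V j)\<^sup>2)"
    by (subst sum.reindex) (auto simp: inj_on_def)
  also have "\<dots> = (\<Sum>j\<in>((\<lambda>s. s - k) ` I) \<inter> J. (V j)\<^sup>2)"
    using assms by (intro sum.mono_neutral_right) auto
  also have "\<dots> \<le> (\<Sum>j\<in>J. (V j)\<^sup>2)"
    using assms by (intro sum_mono2) auto
  finally show ?thesis by (simp add: L2_set_def)
qed

text \<open>Rewriting a sum over the second index as one over the difference of the two indices decomposes a
matrix into its diagonals. The set of differences does not depend on \<open>s\<close>, so that Minkowski's
inequality applies to the sum over diagonals.\<close>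
lemma sum_by_differences:
  fixes I J :: "int set" and f :: "int \<Rightarrow> int \<Rightarrow> real"
  assumes "finite I" "finite J" "s \<in> I" "\<And>k t. t \<notin> J \<Longrightarrow> f k t = 0"
  shows "(\<Sum>t\<in>J. f (s - t) t) = (\<Sum>k\<in>(\<lambda>(s, t). s - t) ` (I \<times> J). f k (s - k))"
proof -
  have "(\<Sum>t\<in>J. f (s - t) t) = (\<Sum>k\<in>(\<lambda>t. s - t) ` J. f k (s - k))"
    by (subst sum.reindex) (auto simp: inj_on_def)
  also have "\<dots> = (\<Sum>k\<in>(\<lambda>(s, t). s - t) ` (I \<times> J). f k (s - k))"
  proof (rule sum.mono_neutral_left)
    show "\<forall>k\<in>(\<lambda>(s, t). s - t) ` (I \<times> J) - (\<lambda>t. s - t) ` J. f k (s - k) = 0"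
    proof
      fix k assume "k \<in> (\<lambda>(s, t). s - t) ` (I \<times> J) - (\<lambda>t. s - t) ` J"
      then have "s - k \<notin> J" by (metis DiffE add_diff_cancel_left' diff_add_cancel imageI uminus_add_conv_diff minus_diff_eq)
      then show "f k (s - k) = 0" by (rule assms)
    qed
  qed (use assms in auto)
  finally show ?thesis .
qed

text \<open>Young's inequality: each diagonal acts as a shift, which does not increase the mean square norm, and
Minkowski's inequality adds up the diagonals.\<close>
lemma L2_set_convolution_le:
  fixes \<beta> v :: "int \<Rightarrow> real"
  assumes "finite I" "finite J" "\<And>k. 0 \<le> \<beta> k" "\<And>t. 0 \<le> v t" "\<beta> summable_on UNIV"
  shows "L2_set (\<lambda>s. \<Sum>t\<in>J. \<beta> (s - t) * v t) I \<le> infsum \<beta> UNIV * L2_set v J"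
proof -
  define V where "V t = (if t \<in> J then v t else 0)" for t
  define K where "K = (\<lambda>(s, t). s - t) ` (I \<times> J)"
  have finK: "finite K" using assms by (simp add: K_def)
  have V0: "0 \<le> V t" for t using assms by (simp add: V_def)
  have "L2_set (\<lambda>s. \<Sum>t\<in>J. \<beta> (s - t) * v t) I = L2_set (\<lambda>s. \<Sum>k\<in>K. \<beta> k * V (s - k)) I"
  proof (rule L2_set_cong)
    fix s assume s: "s \<in> I"
    have "(\<Sum>t\<in>J. \<beta> (s - t) * v t) = (\<Sum>t\<in>J. \<beta> (s - t) * V t)"
      by (rule sum.cong) (auto simp: V_def)
    also have "\<dots> = (\<Sum>k\<in>K. \<beta> k * V (s - k))" unfolding K_def
      by (rule sum_by_differences[where f = "\<lambda>k t. \<beta> k * V t"]) (use assms s in \<open>auto simp: V_def\<close>)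
    finally show "(\<Sum>t\<in>J. \<beta> (s - t) * v t) = (\<Sum>k\<in>K. \<beta> k * V (s - k))" .
  qed simp
  also have "\<dots> \<le> (\<Sum>k\<in>K. L2_set (\<lambda>s. \<beta> k * V (s - k)) I)"
    using finK assms V0 by (intro L2_set_sum_le) auto
  also have "\<dots> \<le> (\<Sum>k\<in>K. \<beta> k * L2_set v J)"
  proof (rule sum_mono)
    fix k assume "k \<in> K"
    have "L2_set (\<lambda>s. \<beta> k * V (s - k)) I = \<beta> k * L2_set (\<lambda>s. V (s - k)) I"
      using assms by (simp add: L2_set_right_distrib)
    also have "L2_set (\<lambda>s. V (s - k)) I \<le> L2_set V J"
      using assms by (intro L2_set_shift_le) (auto simp: V_def)
    also have "L2_set V J = L2_set v J" by (rule L2_set_cong) (auto simp: V_def)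
    finally show "L2_set (\<lambda>s. \<beta> k * V (s - k)) I \<le> \<beta> k * L2_set v J"
      using assms by (simp add: mult_left_mono)
  qed
  also have "\<dots> = sum \<beta> K * L2_set v J" by (simp add: sum_distrib_right)
  also have "\<dots> \<le> infsum \<beta> UNIV * L2_set v J"
    using assms finK by (intro mult_right_mono finite_sum_le_infsum) auto
  finally show ?thesis .
qed

lemma
  fixes f :: "'a \<Rightarrow> 'b \<Rightarrow> 'c::real_normed_vector"
  assumes "finite K" "\<And>k. k \<in> K \<Longrightarrow> f k summable_on A"
  shows summable_on_finite_sum: "(\<lambda>x. \<Sum>k\<in>K. f k x) summable_on A"
    and infsum_finite_sum: "infsum (\<lambda>x. \<Sum>k\<in>K. f k x) A = (\<Sum>k\<in>K. infsum (f k) A)"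
proof -
  have "(\<lambda>x. \<Sum>k\<in>K. f k x) summable_on A \<and> infsum (\<lambda>x. \<Sum>k\<in>K. f k x) A = (\<Sum>k\<in>K. infsum (f k) A)"
    using assms by (induction K rule: finite_induct) (auto simp: summable_on_add infsum_add)
  then show "(\<lambda>x. \<Sum>k\<in>K. f k x) summable_on A"
    "infsum (\<lambda>x. \<Sum>k\<in>K. f k x) A = (\<Sum>k\<in>K. infsum (f k) A)" by auto
qed

lemma summable_exp_minus_abs_int:
  assumes "0 < (e::real)"
  shows "(\<lambda>x::int. exp (- e * \<bar>real_of_int x\<bar>)) summable_on UNIV"
proof -
  have s: "(\<lambda>n::nat. exp (- (e * real n))) summable_on UNIV"
  proof (rule summable_nonneg_imp_summable_on)
    have "summable (\<lambda>n. exp (- e) ^ n)" using assms by (intro summable_geometric) auto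
    then show "summable (\<lambda>n::nat. exp (- (e * real n)))" by (simp add: exp_of_nat2_mult[symmetric])
  qed auto
  have "(\<lambda>x::int. exp (- e * \<bar>real_of_int x\<bar>)) summable_on range int"
    by (subst summable_on_reindex) (auto simp: o_def intro!: s)
  moreover have "(\<lambda>x::int. exp (- e * \<bar>real_of_int x\<bar>)) summable_on range (\<lambda>n. - int n)"
    by (subst summable_on_reindex) (auto simp: o_def inj_on_def intro!: s)
  ultimately have "(\<lambda>x::int. exp (- e * \<bar>real_of_int x\<bar>)) summable_on (range int \<union> range (\<lambda>n. - int n))"
    by (rule summable_on_union)
  moreover have "range int \<union> range (\<lambda>n. - int n) = UNIV"
  proof -
    have "x \<in> range int \<or> x \<in> range (\<lambda>n. - int n)" for x :: int
      by (cases x rule: int_cases2) auto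
    then show ?thesis by blast
  qed
  ultimately show ?thesis by simp
qed

text \<open>A bump of width about \<open>1 / e\<close> around \<open>x\<close>. Exponential tails make it comparable with its own
translates.\<close>
definition exp_weight :: "real \<Rightarrow> int \<Rightarrow> int \<Rightarrow> real" where
  "exp_weight e x t = exp (- e * \<bar>real_of_int (t - x)\<bar>)"

lemma exp_weight_shift: "exp_weight e x s = exp_weight e (x - k) (s - k)"
  by (simp add: exp_weight_def)

lemma exp_weight_pos: "0 < exp_weight e x t" by (simp add: exp_weight_def)

text \<open>The ratio of the two weights lies between \<open>exp (- e \<bar>s - t\<bar>)\<close> and its inverse, by the triangle
inequality. The bound has both weights on the right, because either of them can be the larger one.\<close>
lemma exp_weight_diff_le:
  assumes "0 \<le> e"
  shows "\<bar>exp_weight e x t - exp_weight e x s\<bar> \<le>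
    (1 - exp (- e * \<bar>real_of_int (s - t)\<bar>)) * (exp_weight e x t + exp_weight e x s)"
proof -
  let ?E = "exp (- e * \<bar>real_of_int (s - t)\<bar>)"
  have *: "?E * exp_weight e x t \<le> exp_weight e x s" "?E * exp_weight e x s \<le> exp_weight e x t"
  proof -
    have "e * \<bar>real_of_int (s - x)\<bar> \<le> e * (\<bar>real_of_int (s - t)\<bar> + \<bar>real_of_int (t - x)\<bar>)"
         "e * \<bar>real_of_int (t - x)\<bar> \<le> e * (\<bar>real_of_int (s - t)\<bar> + \<bar>real_of_int (s - x)\<bar>)"
      using assms by (intro mult_left_mono; linarith)+
    then show "?E * exp_weight e x t \<le> exp_weight e x s" "?E * exp_weight e x s \<le> exp_weight e x t"
      by (auto simp: exp_weight_def exp_add[symmetric] algebra_simps)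
  qed
  have "?E \<le> 1" using assms by simp
  then have "0 \<le> (1 - ?E) * exp_weight e x t" "0 \<le> (1 - ?E) * exp_weight e x s"
    using exp_weight_pos[of e x t] exp_weight_pos[of e x s] by auto
  with * show ?thesis by (simp add: abs_le_iff algebra_simps)
qed

lemma exp_weight_sum:
  assumes "0 < e"
  shows "(\<lambda>x. exp_weight e x t) summable_on UNIV" "(\<Sum>\<^sub>\<infinity>x. exp_weight e x t) = (\<Sum>\<^sub>\<infinity>x. exp_weight e x 0)"
proof -
  have b: "bij_betw (\<lambda>x::int. x - t) UNIV UNIV"
    by (rule bij_betwI[where g = "\<lambda>x. x + t"]) auto
  have eq: "exp_weight e x t = exp_weight e (x - t) 0" for x by (simp add: exp_weight_def)
  have "(\<lambda>x. exp_weight e x 0) summable_on UNIV"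
    using summable_exp_minus_abs_int[OF assms] by (simp add: exp_weight_def)
  then show "(\<lambda>x. exp_weight e x t) summable_on UNIV"
    unfolding eq using summable_on_reindex_bij_betw[OF b, of "\<lambda>x. exp_weight e x 0"] by simp
  show "(\<Sum>\<^sub>\<infinity>x. exp_weight e x t) = (\<Sum>\<^sub>\<infinity>x. exp_weight e x 0)"
    unfolding eq using infsum_reindex_bij_betw[OF b, of "\<lambda>x. exp_weight e x 0"] by simp
qed

text \<open>Dominated convergence as \<open>e\<close> tends to 0: outside a finite set \<open>J\<close> the sum of \<open>\<beta>\<close> is small, and
on \<open>J\<close> the factor is at most \<open>e \<bar>k\<bar>\<close>.\<close>
lemma damped_tail_small:
  fixes \<beta> :: "int \<Rightarrow> real"
  assumes "\<And>k. 0 \<le> \<beta> k" "\<beta> summable_on UNIV" "0 < \<delta>"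
  obtains e where "0 < e" "(\<lambda>k. \<beta> k * (1 - exp (- e * \<bar>real_of_int k\<bar>))) summable_on UNIV"
    "(\<Sum>\<^sub>\<infinity>k. \<beta> k * (1 - exp (- e * \<bar>real_of_int k\<bar>))) \<le> \<delta>"
proof -
  obtain J where J: "finite J" "dist (sum \<beta> J) (infsum \<beta> UNIV) \<le> \<delta> / 2"
    using infsum_finite_approximation[OF assms(2), of "\<delta> / 2"] assms(3) by auto
  have split: "infsum \<beta> UNIV = sum \<beta> J + infsum \<beta> (- J)"
    using infsum_Un_disjoint[of \<beta> J "- J"] J(1) assms(2) summable_on_subset_banach by (fastforce simp: Un_commute)
  have sJ: "\<beta> summable_on (- J)" using assms(2) summable_on_subset_banach by blast
  have tail: "infsum \<beta> (- J) \<le> \<delta> / 2" using J(2) split by (auto simp: dist_real_def)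
  define M where "M = (\<Sum>k\<in>J. \<beta> k * \<bar>real_of_int k\<bar>)"
  have M0: "0 \<le> M" unfolding M_def using assms(1) by (auto intro!: sum_nonneg)
  \<comment> \<open>The sum over \<open>J\<close> is at most \<open>e * M\<close>; adding 1 to \<open>M\<close> avoids a division by zero.\<close>
  define e where "e = \<delta> / (2 * (M + 1))"
  have e: "0 < e" using assms(3) M0 by (simp add: e_def)
  let ?\<eta> = "\<lambda>k. \<beta> k * (1 - exp (- e * \<bar>real_of_int k\<bar>))"
  have r: "0 \<le> 1 - exp (- e * \<bar>real_of_int k\<bar>)" "1 - exp (- e * \<bar>real_of_int k\<bar>) \<le> 1"
    "1 - exp (- e * \<bar>real_of_int k\<bar>) \<le> e * \<bar>real_of_int k\<bar>" for k
    using e exp_ge_add_one_self[of "- e * \<bar>real_of_int k\<bar>"] by auto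
  have eb: "0 \<le> ?\<eta> k" "?\<eta> k \<le> \<beta> k" for k
    using assms(1)[of k] r[of k] by (auto simp: mult_left_le intro!: mult_nonneg_nonneg)
  have s: "?\<eta> summable_on UNIV"
    by (rule summable_on_comparison_test[OF assms(2)]) (use eb in auto)
  have s2: "?\<eta> summable_on (- J)"  using s summable_on_subset_banach by blast
  have "infsum ?\<eta> UNIV = sum ?\<eta> J + infsum ?\<eta> (- J)"
    using infsum_Un_disjoint[of ?\<eta> J "- J"] J(1) s2 by (simp add: Un_commute)
  moreover have "sum ?\<eta> J \<le> \<delta> / 2"
  proof -
    have "sum ?\<eta> J \<le> (\<Sum>k\<in>J. \<beta> k * (e * \<bar>real_of_int k\<bar>))"
      using r(3) assms(1) by (intro sum_mono mult_left_mono) auto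
    also have "\<dots> = e * M" by (simp add: M_def sum_distrib_left mult_ac)
    also have "\<dots> \<le> \<delta> / 2" using M0 assms(3) by (simp add: e_def field_simps)
    finally show ?thesis .
  qed
  moreover have "infsum ?\<eta> (- J) \<le> infsum \<beta> (- J)"
    by (rule infsum_mono) (use s2 sJ eb in auto)
  ultimately have "infsum ?\<eta> UNIV \<le> \<delta>" using tail by linarith
  with e s show ?thesis using that by blast
qed

text \<open>The mean square bound is applied to the localized sequence \<open>t \<mapsto> exp_weight e x t *\<^sub>R u t\<close>. Moving the
weight past \<open>A\<close> costs a commutator with entries \<open>(exp_weight e x t - exp_weight e x s) *\<^sub>R A s t\<close>, whose
diagonals are controlled by the damped coefficients \<open>\<eta>\<close>. On the \<open>k\<close>-th diagonal one of the two weights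
in the bound belongs to the row index; seen from the column index it is centred at \<open>x - k\<close>.\<close>
lemma localized_commutator_bound:
  fixes A :: "int \<Rightarrow> int \<Rightarrow> 'v::real_normed_vector \<Rightarrow> 'v" and u :: "int \<Rightarrow> 'v" and \<beta> :: "int \<Rightarrow> real"
  assumes I: "finite I" and e: "0 < e" and \<beta>0: "\<And>k. 0 \<le> \<beta> k"
    and lin: "\<And>s t. linear (A s t)"
    and bd: "\<And>s t x. norm (A s t x) \<le> \<beta> (s - t) * norm x"
    and low: "\<And>v. c * L2_set (\<lambda>s. norm (v s)) I \<le> L2_set (\<lambda>s. norm (\<Sum>t\<in>I. A s t (v t))) I"
  defines "\<eta> \<equiv> \<lambda>k. \<beta> k * (1 - exp (- e * \<bar>real_of_int k\<bar>))"
  defines "N \<equiv> \<lambda>f x. L2_set (\<lambda>s. exp_weight e x s * f s) I"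
  shows "c * N (\<lambda>s. norm (u s)) x \<le> N (\<lambda>s. norm (\<Sum>t\<in>I. A s t (u t))) x +
     (\<Sum>k\<in>(\<lambda>(s, t). s - t) ` (I \<times> I). \<eta> k * (N (\<lambda>s. norm (u s)) x + N (\<lambda>s. norm (u s)) (x - k)))"
proof -
  define K where "K = (\<lambda>(s, t). s - t) ` (I \<times> I)"
  have finK: "finite K" using I by (simp add: K_def)
  define U where "U t = (if t \<in> I then norm (u t) else 0)" for t
  have U0: "0 \<le> U t" for t by (simp add: U_def)
  have NU: "N (\<lambda>s. norm (u s)) z = L2_set (\<lambda>s. exp_weight e z s * U s) I" for z
    unfolding N_def by (rule L2_set_cong) (auto simp: U_def)
  have shiftle: "L2_set (\<lambda>s. exp_weight e z (s - k) * U (s - k)) I \<le> L2_set (\<lambda>s. exp_weight e z s * U s) I" for z k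
    by (rule L2_set_shift_le[OF I I, where V = "\<lambda>s. exp_weight e z s * U s"]) (simp add: U_def)
  define v where "v t = exp_weight e x t *\<^sub>R u t" for t
  have \<eta>0: "0 \<le> \<eta> k" for k using \<beta>0[of k] e by (auto simp: \<eta>_def intro!: mult_nonneg_nonneg)
  have pt: "norm (\<Sum>t\<in>I. A s t (v t)) \<le> exp_weight e x s * norm (\<Sum>t\<in>I. A s t (u t)) +
      (\<Sum>k\<in>K. \<eta> k * (exp_weight e x (s - k) * U (s - k) + exp_weight e (x - k) (s - k) * U (s - k)))"
    if s: "s \<in> I" for s
  proof -
    have "(\<Sum>t\<in>I. A s t (v t)) = (\<Sum>t\<in>I. exp_weight e x t *\<^sub>R A s t (u t))"
      by (simp add: v_def linear_scale[OF lin])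
    also have "\<dots> = exp_weight e x s *\<^sub>R (\<Sum>t\<in>I. A s t (u t)) + (\<Sum>t\<in>I. (exp_weight e x t - exp_weight e x s) *\<^sub>R A s t (u t))"
      by (simp add: scaleR_sum_right sum.distrib[symmetric] algebra_simps)
    finally have "norm (\<Sum>t\<in>I. A s t (v t)) \<le> norm (exp_weight e x s *\<^sub>R (\<Sum>t\<in>I. A s t (u t))) +
       norm (\<Sum>t\<in>I. (exp_weight e x t - exp_weight e x s) *\<^sub>R A s t (u t))" by (metis norm_triangle_ineq)
    also have "norm (exp_weight e x s *\<^sub>R (\<Sum>t\<in>I. A s t (u t))) = exp_weight e x s * norm (\<Sum>t\<in>I. A s t (u t))"
      using exp_weight_pos[of e x s] by simp
    also have "norm (\<Sum>t\<in>I. (exp_weight e x t - exp_weight e x s) *\<^sub>R A s t (u t)) \<le>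
        (\<Sum>t\<in>I. \<eta> (s - t) * (exp_weight e x t + exp_weight e (x - (s - t)) t) * U t)"
    proof (rule sum_norm_le)
      fix t assume t: "t \<in> I"
      have "norm ((exp_weight e x t - exp_weight e x s) *\<^sub>R A s t (u t)) \<le>
          ((1 - exp (- e * \<bar>real_of_int (s - t)\<bar>)) * (exp_weight e x t + exp_weight e x s)) * (\<beta> (s - t) * norm (u t))"
        using exp_weight_diff_le[of e x t s] e bd[of s t "u t"] by (auto intro!: mult_mono simp: add_nonneg_nonneg exp_weight_pos less_imp_le)
      also have "\<dots> = \<eta> (s - t) * (exp_weight e x t + exp_weight e (x - (s - t)) t) * U t"
        using t exp_weight_shift[of e x s "s - t"] by (simp add: \<eta>_def U_def)
      finally show "norm ((exp_weight e x t - exp_weight e x s) *\<^sub>R A s t (u t)) \<le> \<dots>" .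
    qed
    also have "(\<Sum>t\<in>I. \<eta> (s - t) * (exp_weight e x t + exp_weight e (x - (s - t)) t) * U t) =
      (\<Sum>k\<in>K. \<eta> k * (exp_weight e x (s - k) + exp_weight e (x - k) (s - k)) * U (s - k))"
      unfolding K_def
      by (rule sum_by_differences[where f = "\<lambda>k t. \<eta> k * (exp_weight e x t + exp_weight e (x - k) t) * U t"])
        (use I s in \<open>auto simp: U_def\<close>)
    finally show ?thesis by (simp add: algebra_simps)
  qed
  have "c * N (\<lambda>s. norm (u s)) x = c * L2_set (\<lambda>s. norm (v s)) I"
    unfolding N_def v_def using exp_weight_pos[of e x] by (simp add: less_imp_le abs_of_pos)
  also have "\<dots> \<le> L2_set (\<lambda>s. norm (\<Sum>t\<in>I. A s t (v t))) I" by (rule low)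
  also have "\<dots> \<le> L2_set (\<lambda>s. exp_weight e x s * norm (\<Sum>t\<in>I. A s t (u t)) +
      (\<Sum>k\<in>K. \<eta> k * (exp_weight e x (s - k) * U (s - k) + exp_weight e (x - k) (s - k) * U (s - k)))) I"
    by (intro L2_set_mono pt) auto
  also have "\<dots> \<le> N (\<lambda>s. norm (\<Sum>t\<in>I. A s t (u t))) x +
     L2_set (\<lambda>s. (\<Sum>k\<in>K. \<eta> k * (exp_weight e x (s - k) * U (s - k) + exp_weight e (x - k) (s - k) * U (s - k)))) I"
    unfolding N_def by (rule L2_set_triangle_ineq)
  also have "L2_set (\<lambda>s. (\<Sum>k\<in>K. \<eta> k * (exp_weight e x (s - k) * U (s - k) + exp_weight e (x - k) (s - k) * U (s - k)))) I
     \<le> (\<Sum>k\<in>K. L2_set (\<lambda>s. \<eta> k * (exp_weight e x (s - k) * U (s - k) + exp_weight e (x - k) (s - k) * U (s - k))) I)"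
    using finK \<eta>0 U0 exp_weight_pos less_imp_le
    by (intro L2_set_sum_le) (auto intro!: mult_nonneg_nonneg add_nonneg_nonneg simp: less_imp_le)
  also have "\<dots> \<le> (\<Sum>k\<in>K. \<eta> k * (N (\<lambda>s. norm (u s)) x + N (\<lambda>s. norm (u s)) (x - k)))"
  proof (rule sum_mono)
    fix k assume "k \<in> K"
    have "L2_set (\<lambda>s. \<eta> k * (exp_weight e x (s - k) * U (s - k) + exp_weight e (x - k) (s - k) * U (s - k))) I =
      \<eta> k * L2_set (\<lambda>s. exp_weight e x (s - k) * U (s - k) + exp_weight e (x - k) (s - k) * U (s - k)) I"
      using \<eta>0 by (simp add: L2_set_right_distrib)
    moreover have "L2_set (\<lambda>s. exp_weight e x (s - k) * U (s - k) + exp_weight e (x - k) (s - k) * U (s - k)) I \<le>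
      N (\<lambda>s. norm (u s)) x + N (\<lambda>s. norm (u s)) (x - k)"
      unfolding NU by (rule order_trans[OF L2_set_triangle_ineq add_mono[OF shiftle shiftle]])
    ultimately show "L2_set (\<lambda>s. \<eta> k * (exp_weight e x (s - k) * U (s - k) + exp_weight e (x - k) (s - k) * U (s - k))) I \<le>
       \<eta> k * (N (\<lambda>s. norm (u s)) x + N (\<lambda>s. norm (u s)) (x - k))"
      using \<eta>0 by (simp add: mult_left_mono)
  qed
  finally show ?thesis by (simp add: K_def)
qed

text \<open>Summing the localized bounds over all integer centres \<open>x\<close> turns mean square norms into the sum norm:
the sum over \<open>x\<close> of the localized norms of \<open>u\<close> dominates \<open>\<Sum>s\<in>I. norm (u s)\<close> (keep the weight at \<open>x = s\<close>)
and is dominated by a multiple of it (the weights have a finite total \<open>S\<close>). The sum is invariant under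
\<open>x \<mapsto> x - k\<close>, so the commutators contribute at most \<open>c / 2\<close> times the same quantity once \<open>e\<close> is small,
and this is absorbed on the left. The constant depends on \<open>c\<close> and \<open>\<beta>\<close> only, and not on \<open>I\<close>: this
uniformity is what makes the finite sections converge.\<close>
lemma l1_stability:
  fixes \<beta> :: "int \<Rightarrow> real"
  assumes \<beta>0: "\<And>k. 0 \<le> \<beta> k" and \<beta>s: "\<beta> summable_on UNIV" and c: "0 < c"
  obtains C where "0 \<le> C"
    "\<And>(A :: int \<Rightarrow> int \<Rightarrow> 'v::real_normed_vector \<Rightarrow> 'v) I u.
      \<lbrakk>finite I; \<And>s t. linear (A s t); \<And>s t x. norm (A s t x) \<le> \<beta> (s - t) * norm x;
       \<And>v. c * L2_set (\<lambda>s. norm (v s)) I \<le> L2_set (\<lambda>s. norm (\<Sum>t\<in>I. A s t (v t))) I\<rbrakk>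
      \<Longrightarrow> (\<Sum>s\<in>I. norm (u s)) \<le> C * (\<Sum>s\<in>I. norm (\<Sum>t\<in>I. A s t (u t)))"
proof -
  obtain e where e: "0 < e" and \<eta>s: "(\<lambda>k. \<beta> k * (1 - exp (- e * \<bar>real_of_int k\<bar>))) summable_on UNIV"
    and \<eta>le: "(\<Sum>\<^sub>\<infinity>k. \<beta> k * (1 - exp (- e * \<bar>real_of_int k\<bar>))) \<le> c / 4"
    using damped_tail_small[OF \<beta>0 \<beta>s, of "c / 4"] c by auto
  define \<eta> where "\<eta> k = \<beta> k * (1 - exp (- e * \<bar>real_of_int k\<bar>))" for k
  have \<eta>0: "0 \<le> \<eta> k" for k using \<beta>0[of k] e by (auto simp: \<eta>_def intro!: mult_nonneg_nonneg)
  define S where "S = (\<Sum>\<^sub>\<infinity>x. exp_weight e x 0)"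
  have S0: "0 \<le> S" unfolding S_def by (intro infsum_nonneg) (simp add: exp_weight_def)
  show ?thesis
  proof (rule that[of "2 * S / c"])
    show "0 \<le> 2 * S / c" using S0 c by simp
    fix A :: "int \<Rightarrow> int \<Rightarrow> 'v::real_normed_vector \<Rightarrow> 'v" and I :: "int set" and u
    assume I: "finite I" and lin: "\<And>s t. linear (A s t)"
      and bd: "\<And>s t x. norm (A s t x) \<le> \<beta> (s - t) * norm x"
      and low: "\<And>v. c * L2_set (\<lambda>s. norm (v s)) I \<le> L2_set (\<lambda>s. norm (\<Sum>t\<in>I. A s t (v t))) I"
    define N where "N f x = L2_set (\<lambda>s. exp_weight e x s * f s) I" for f x
    define K where "K = (\<lambda>(s, t). s - t) ` (I \<times> I)"
    have finK: "finite K" using I by (simp add: K_def)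
    let ?U = "\<lambda>s. norm (u s)" and ?F = "\<lambda>s. norm (\<Sum>t\<in>I. A s t (u t))"
    have N0: "0 \<le> N f x" for f x by (simp add: N_def)
    have Nle: "N f x \<le> (\<Sum>s\<in>I. exp_weight e x s * f s)" if "\<And>s. 0 \<le> f s" for f x
      unfolding N_def using that exp_weight_pos[of e x] by (intro L2_set_le_sum) (auto simp: less_imp_le)
    have sums: "(\<lambda>x. \<Sum>s\<in>I. exp_weight e x s * f s) summable_on UNIV" for f
      using I exp_weight_sum(1)[OF e] by (intro summable_on_finite_sum summable_on_cmult_left)
    have Ns: "(\<lambda>x. N f x) summable_on UNIV" if "\<And>s. 0 \<le> f s" for f
      by (rule summable_on_comparison_test[OF sums[of f]]) (use N0 Nle that in auto)
    have upper: "(\<Sum>\<^sub>\<infinity>x. N f x) \<le> S * (\<Sum>s\<in>I. f s)" if f: "\<And>s. 0 \<le> f s" for f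
    proof -
      have "(\<Sum>\<^sub>\<infinity>x. N f x) \<le> (\<Sum>\<^sub>\<infinity>x. \<Sum>s\<in>I. exp_weight e x s * f s)"
        by (rule infsum_mono[OF Ns[OF f] sums Nle[OF f]])
      also have "\<dots> = (\<Sum>s\<in>I. \<Sum>\<^sub>\<infinity>x. exp_weight e x s * f s)"
        using exp_weight_sum(1)[OF e] I by (intro infsum_finite_sum summable_on_cmult_left)
      also have "\<dots> = (\<Sum>s\<in>I. S * f s)"
        by (intro sum.cong refl, subst infsum_cmult_left) (use exp_weight_sum[OF e] in \<open>auto simp: S_def\<close>)
      finally show ?thesis by (simp add: sum_distrib_left)
    qed
    have lower: "(\<Sum>s\<in>I. ?U s) \<le> (\<Sum>\<^sub>\<infinity>x. N ?U x)"
    proof -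
      have "(\<Sum>s\<in>I. ?U s) \<le> (\<Sum>s\<in>I. N ?U s)"
      proof (rule sum_mono)
        fix s assume "s \<in> I"
        then have "exp_weight e s s * ?U s \<le> N ?U s" unfolding N_def using I by (intro member_le_L2_set)
        then show "?U s \<le> N ?U s" by (simp add: exp_weight_def)
      qed
      also have "\<dots> \<le> (\<Sum>\<^sub>\<infinity>x. N ?U x)"
        using I N0 by (intro finite_sum_le_infsum Ns) auto
      finally show ?thesis .
    qed
    have shift: "(\<lambda>x. N ?U (x - k)) summable_on UNIV" "(\<Sum>\<^sub>\<infinity>x. N ?U (x - k)) = (\<Sum>\<^sub>\<infinity>x. N ?U x)" for k
    proof -
      have b: "bij_betw (\<lambda>x::int. x - k) UNIV UNIV"
        by (rule bij_betwI[where g = "\<lambda>x. x + k"]) auto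
      show "(\<lambda>x. N ?U (x - k)) summable_on UNIV"
        using summable_on_reindex_bij_betw[OF b, of "N ?U"] Ns[of ?U] by simp
      show "(\<Sum>\<^sub>\<infinity>x. N ?U (x - k)) = (\<Sum>\<^sub>\<infinity>x. N ?U x)"
        using infsum_reindex_bij_betw[OF b, of "N ?U"] by simp
    qed
    have NUs: "(\<lambda>x. N ?U x) summable_on UNIV" "(\<lambda>x. N ?F x) summable_on UNIV" by (rule Ns; simp)+
    have "c * (\<Sum>\<^sub>\<infinity>x. N ?U x) = (\<Sum>\<^sub>\<infinity>x. c * N ?U x)"
      by (rule infsum_cmult_right[symmetric]) (use NUs in auto)
    also have "\<dots> \<le> (\<Sum>\<^sub>\<infinity>x. N ?F x + (\<Sum>k\<in>K. \<eta> k * (N ?U x + N ?U (x - k))))"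
    proof (rule infsum_mono)
      show "(\<lambda>x. c * N ?U x) summable_on UNIV" using NUs by (intro summable_on_cmult_right)
      show "(\<lambda>x. N ?F x + (\<Sum>k\<in>K. \<eta> k * (N ?U x + N ?U (x - k)))) summable_on UNIV"
        using NUs shift finK by (intro summable_on_add summable_on_finite_sum summable_on_cmult_right)
      show "c * N ?U x \<le> N ?F x + (\<Sum>k\<in>K. \<eta> k * (N ?U x + N ?U (x - k)))" for x
        using localized_commutator_bound[OF I e \<beta>0 lin bd low, where u = u and x = x]
        unfolding N_def K_def \<eta>_def by simp
    qed
    also have "\<dots> = (\<Sum>\<^sub>\<infinity>x. N ?F x) + (\<Sum>k\<in>K. \<eta> k * (2 * (\<Sum>\<^sub>\<infinity>x. N ?U x)))"
    proof (subst infsum_add)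
      show "(\<lambda>x. \<Sum>k\<in>K. \<eta> k * (N ?U x + N ?U (x - k))) summable_on UNIV"
        using NUs shift finK by (intro summable_on_add summable_on_finite_sum summable_on_cmult_right)
      have "(\<Sum>\<^sub>\<infinity>x. \<Sum>k\<in>K. \<eta> k * (N ?U x + N ?U (x - k))) =
         (\<Sum>k\<in>K. \<Sum>\<^sub>\<infinity>x. \<eta> k * (N ?U x + N ?U (x - k)))"
        using NUs shift finK by (intro infsum_finite_sum summable_on_cmult_right summable_on_add)
      also have "\<dots> = (\<Sum>k\<in>K. \<eta> k * (2 * (\<Sum>\<^sub>\<infinity>x. N ?U x)))"
        using NUs shift by (intro sum.cong refl, subst infsum_cmult_right)
          (auto intro!: summable_on_add simp: infsum_add)
      finally show "(\<Sum>\<^sub>\<infinity>x. N ?F x) + (\<Sum>\<^sub>\<infinity>x. \<Sum>k\<in>K. \<eta> k * (N ?U x + N ?U (x - k))) =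
         (\<Sum>\<^sub>\<infinity>x. N ?F x) + (\<Sum>k\<in>K. \<eta> k * (2 * (\<Sum>\<^sub>\<infinity>x. N ?U x)))" by simp
    qed (use NUs in auto)
    also have "(\<Sum>k\<in>K. \<eta> k * (2 * (\<Sum>\<^sub>\<infinity>x. N ?U x))) \<le> c / 4 * (2 * (\<Sum>\<^sub>\<infinity>x. N ?U x))"
    proof -
      have "sum \<eta> K \<le> infsum \<eta> UNIV"
        by (rule finite_sum_le_infsum) (use finK \<eta>0 \<eta>s in \<open>simp_all add: \<eta>_def[abs_def]\<close>)
      also have "\<dots> \<le> c / 4" using \<eta>le by (simp add: \<eta>_def[abs_def])
      finally show ?thesis unfolding sum_distrib_right[symmetric]
        using N0 by (intro mult_right_mono) (auto intro!: infsum_nonneg)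
    qed
    finally have "c * (\<Sum>\<^sub>\<infinity>x. N ?U x) \<le> 2 * (\<Sum>\<^sub>\<infinity>x. N ?F x)" by simp
    with lower upper[of ?F] c have "c * (\<Sum>s\<in>I. ?U s) \<le> 2 * (S * (\<Sum>s\<in>I. ?F s))"
      by (smt (verit) mult_left_mono norm_ge_zero)
    then show "(\<Sum>s\<in>I. ?U s) \<le> 2 * S / c * (\<Sum>s\<in>I. ?F s)" using c by (simp add: field_simps)
  qed
qed

section \<open>Integration over the unit circle\<close>

text \<open>A mean square bound gives uniform integrability. With \<open>d = cmod (X n x - Y x)\<close> one has
\<open>d \<le> min d K + d\<^sup>2 / K\<close>; the first term is handled by dominated convergence and the integral of
the second is at most \<open>4 * B / K\<close>, where Fatou's lemma bounds the limit \<open>Y\<close>.\<close>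
lemma bounded_L2_tendsto_integral:
  fixes X :: "nat \<Rightarrow> 'a \<Rightarrow> complex"
  assumes M: "finite_measure M"
    and X[measurable]: "\<And>n. X n \<in> borel_measurable M" and Y[measurable]: "Y \<in> borel_measurable M"
    and conv: "AE x in M. (\<lambda>n. X n x) \<longlonglongrightarrow> Y x"
    and int: "\<And>n. integrable M (\<lambda>x. (cmod (X n x))\<^sup>2)"
    and bd: "\<And>n. (LINT x|M. (cmod (X n x))\<^sup>2) \<le> B"
  shows "(\<lambda>n. LINT x|M. X n x) \<longlonglongrightarrow> (LINT x|M. Y x)"
proof -
  interpret finite_measure M by (rule M)
  have B0: "0 \<le> B" by (rule order_trans[OF Bochner_Integration.integral_nonneg bd[of 0]]) simp
  have fatou: "(\<integral>\<^sup>+ x. ennreal ((cmod (Y x))\<^sup>2) \<partial>M) \<le> ennreal B"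
  proof -
    have "(\<integral>\<^sup>+ x. ennreal ((cmod (Y x))\<^sup>2) \<partial>M) = (\<integral>\<^sup>+ x. liminf (\<lambda>n. ennreal ((cmod (X n x))\<^sup>2)) \<partial>M)"
    proof (rule nn_integral_cong_AE)
      show "AE x in M. ennreal ((cmod (Y x))\<^sup>2) = liminf (\<lambda>n. ennreal ((cmod (X n x))\<^sup>2))"
        using conv
      proof eventually_elim
        case (elim x)
        then have "(\<lambda>n. ennreal ((cmod (X n x))\<^sup>2)) \<longlonglongrightarrow> ennreal ((cmod (Y x))\<^sup>2)"
          by (intro tendsto_intros) auto
        then show ?case by (intro lim_imp_Liminf[symmetric]) auto
      qed
    qed
    also have "\<dots> \<le> liminf (\<lambda>n. \<integral>\<^sup>+ x. ennreal ((cmod (X n x))\<^sup>2) \<partial>M)"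
      by (rule nn_integral_liminf) measurable
    also have "\<dots> \<le> liminf (\<lambda>n. ennreal B)"
    proof (rule Liminf_mono, rule always_eventually, rule allI)
      fix n
      show "(\<integral>\<^sup>+ x. ennreal ((cmod (X n x))\<^sup>2) \<partial>M) \<le> ennreal B"
        by (subst nn_integral_eq_integral[OF int]) (use bd[of n] in \<open>auto intro: ennreal_leI\<close>)
    qed
    finally show ?thesis by (simp add: Liminf_const)
  qed
  have Y2: "integrable M (\<lambda>x. (cmod (Y x))\<^sup>2)"
    by (rule integrableI_bounded) (use le_less_trans[OF fatou ennreal_less_top] in auto)
  have Y2b: "(LINT x|M. (cmod (Y x))\<^sup>2) \<le> B"
    using fatou B0 by (subst (asm) nn_integral_eq_integral[OF Y2]) auto
  have dom: "integrable M f" if [measurable]: "f \<in> borel_measurable M" and "integrable M (\<lambda>x. (cmod (f x))\<^sup>2)" for f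
  proof (rule Bochner_Integration.integrable_bound)
    show "integrable M (\<lambda>x. 1 + (cmod (f x))\<^sup>2)" using that by auto
    show "AE x in M. norm (f x) \<le> norm (1 + (cmod (f x))\<^sup>2)"
    proof (rule AE_I2)
      fix x have "2 * cmod (f x) \<le> 1 + (cmod (f x))\<^sup>2" using sum_squares_bound[of 1 "cmod (f x)"] by simp
      then show "norm (f x) \<le> norm (1 + (cmod (f x))\<^sup>2)" by (simp add: abs_of_nonneg) (smt (verit) norm_ge_zero)
    qed
  qed simp
  define D where "D n x = cmod (X n x - Y x)" for n x
  have [measurable]: "D n \<in> borel_measurable M" for n unfolding D_def[abs_def] by measurable
  have D2le: "(D n x)\<^sup>2 \<le> 2 * (cmod (X n x))\<^sup>2 + 2 * (cmod (Y x))\<^sup>2" for n x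
  proof -
    have "(D n x)\<^sup>2 \<le> (cmod (X n x) + cmod (Y x))\<^sup>2"
      unfolding D_def by (intro power_mono norm_triangle_ineq4) auto
    also have "\<dots> \<le> 2 * (cmod (X n x))\<^sup>2 + 2 * (cmod (Y x))\<^sup>2"
      using sum_squares_bound[of "cmod (X n x)" "cmod (Y x)"] by (simp add: power2_sum)
    finally show ?thesis .
  qed
  have D2: "integrable M (\<lambda>x. (D n x)\<^sup>2)" for n
  proof (rule Bochner_Integration.integrable_bound)
    show "integrable M (\<lambda>x. 2 * (cmod (X n x))\<^sup>2 + 2 * (cmod (Y x))\<^sup>2)" using int[of n] Y2 by simp
    show "AE x in M. norm ((D n x)\<^sup>2) \<le> norm (2 * (cmod (X n x))\<^sup>2 + 2 * (cmod (Y x))\<^sup>2)"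
    proof (rule AE_I2)
      fix x
      have "norm ((D n x)\<^sup>2) = (D n x)\<^sup>2" by simp
      also note D2le[of n x]
      also have "2 * (cmod (X n x))\<^sup>2 + 2 * (cmod (Y x))\<^sup>2 \<le> norm (2 * (cmod (X n x))\<^sup>2 + 2 * (cmod (Y x))\<^sup>2)"
        unfolding real_norm_def by (rule abs_ge_self)
      finally show "norm ((D n x)\<^sup>2) \<le> norm (2 * (cmod (X n x))\<^sup>2 + 2 * (cmod (Y x))\<^sup>2)" .
    qed
  qed simp
  have D2b: "(LINT x|M. (D n x)\<^sup>2) \<le> 4 * B" for n
  proof -
    have "(LINT x|M. (D n x)\<^sup>2) \<le> (LINT x|M. 2 * (cmod (X n x))\<^sup>2 + 2 * (cmod (Y x))\<^sup>2)"
      by (rule integral_mono[OF D2 _ D2le]) (use int[of n] Y2 in simp)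
    also have "\<dots> = 2 * (LINT x|M. (cmod (X n x))\<^sup>2) + 2 * (LINT x|M. (cmod (Y x))\<^sup>2)"
      using int[of n] Y2 by simp
    finally show ?thesis using bd[of n] Y2b by simp
  qed
  have Xi: "integrable M (X n)" for n by (rule dom[OF X int])
  have Yi: "integrable M Y" by (rule dom[OF Y Y2])
  have Di: "integrable M (D n)" for n unfolding D_def[abs_def] using Xi[of n] Yi by auto
  show ?thesis
  proof (rule LIMSEQ_I)
    fix e :: real assume e: "0 < e"
    define K where "K = 8 * B / e + 1"
    have K: "0 < K" using e B0 by (simp add: K_def add_nonneg_pos)
    have Kb: "4 * B / K \<le> e / 2" using e B0 K by (simp add: K_def field_simps)
    have minint: "integrable M (\<lambda>x. min (D n x) K)" for n
      by (rule integrable_const_bound[where B = K]) (use K in \<open>auto simp: D_def\<close>)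
    have "(\<lambda>n. LINT x|M. min (D n x) K) \<longlonglongrightarrow> (LINT x|M. 0)"
    proof (rule integral_dominated_convergence[where w = "\<lambda>_. K"])
      show "AE x in M. (\<lambda>n. min (D n x) K) \<longlonglongrightarrow> 0" using conv
      proof eventually_elim
        case (elim x)
        then have "(\<lambda>n. D n x) \<longlonglongrightarrow> 0" unfolding D_def
          by (intro tendsto_norm_zero) (simp add: LIM_zero)
        then have "(\<lambda>n. min (D n x) K) \<longlonglongrightarrow> min 0 K" by (intro tendsto_intros)
        then show ?case using K by simp
      qed
    qed (use K in \<open>auto simp: D_def\<close>)
    then have "eventually (\<lambda>n. (LINT x|M. min (D n x) K) < e / 2) sequentially"
      using e by (intro order_tendstoD) auto
    then obtain n0 where n0: "\<And>n. n \<ge> n0 \<Longrightarrow> (LINT x|M. min (D n x) K) < e / 2"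
      by (auto simp: eventually_sequentially)
    have "norm ((LINT x|M. X n x) - (LINT x|M. Y x)) < e" if "n \<ge> n0" for n
    proof -
      have pt: "d \<le> min d K + d\<^sup>2 / K" if "0 \<le> d" for d
      proof (cases "d \<le> K")
        case False
        then have "d * K \<le> d * d" using that by (intro mult_left_mono) auto
        then have "d \<le> d\<^sup>2 / K" using K by (simp add: field_simps power2_eq_square)
        then show ?thesis using K that by simp
      qed (use K in auto)
      have "norm ((LINT x|M. X n x) - (LINT x|M. Y x)) = norm (LINT x|M. X n x - Y x)"
        using Xi Yi by simp
      also have "\<dots> \<le> (LINT x|M. D n x)" unfolding D_def by (rule integral_norm_bound)
      also have "\<dots> \<le> (LINT x|M. min (D n x) K + (D n x)\<^sup>2 / K)"
      proof (rule integral_mono[OF Di])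
        show "integrable M (\<lambda>x. min (D n x) K + (D n x)\<^sup>2 / K)" using minint[of n] D2[of n] by simp
        show "D n x \<le> min (D n x) K + (D n x)\<^sup>2 / K" for x by (rule pt) (simp add: D_def)
      qed
      also have "\<dots> = (LINT x|M. min (D n x) K) + (LINT x|M. (D n x)\<^sup>2) / K"
        using minint D2 by simp
      also have "(LINT x|M. (D n x)\<^sup>2) / K \<le> 4 * B / K" using D2b K by (intro divide_right_mono) auto
      finally show ?thesis using Kb n0[OF that] by linarith
    qed
    then show "\<exists>no. \<forall>n\<ge>no. norm ((LINT x|M. X n x) - (LINT x|M. Y x)) < e" by blast
  qed
qed

lemma emeasure_circle_interval: "emeasure lebesgue {-pi..<pi} = ennreal (2 * pi)"
  by simp

lemma finite_measure_circle: "finite_measure circle_measure"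
  and space_circle: "space circle_measure = UNIV"
  and measure_circle: "measure circle_measure UNIV = 1"
proof -
  have e: "emeasure circle_measure UNIV = 1"
    unfolding circle_measure_def
    by (subst emeasure_uniform_measure) (auto simp: divide_ennreal)
  show sp: "space circle_measure = UNIV" by (simp add: circle_measure_def)
  show "finite_measure circle_measure" by standard (simp add: sp e)
  show "measure circle_measure UNIV = 1" by (simp add: measure_def e)
qed

interpretation circle: finite_measure circle_measure by (rule finite_measure_circle)

lemma integral_circle_const [simp]: "(LINT \<theta>|circle_measure. c) = (c::'b::{banach,second_countable_topology})"
  using measure_circle by (simp add: space_circle)

lemma measurable_circle_continuous:
  fixes f :: "real \<Rightarrow> 'b::topological_space"
  assumes "continuous_on UNIV f" shows "f \<in> borel_measurable circle_measure"
proof -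
  have "f \<in> borel_measurable lebesgue"
    using borel_measurable_continuous_onI[OF assms] by (intro measurable_completion) simp
  then show ?thesis by (simp add: circle_measure_def uniform_measure_def cong: measurable_cong_sets)
qed

lemma integrable_circle_continuous:
  fixes f :: "real \<Rightarrow> 'b::{banach,second_countable_topology}"
  assumes "continuous_on UNIV f" "\<And>\<theta>. norm (f \<theta>) \<le> B" shows "integrable circle_measure f"
  by (rule circle.integrable_const_bound[where B = B])
    (use assms in \<open>auto intro: measurable_circle_continuous\<close>)

lemma integral_circle_continuous:
  fixes f :: "real \<Rightarrow> complex"
  assumes c: "continuous_on UNIV f"
  shows "(LINT \<theta>|circle_measure. f \<theta>) = (LINT \<theta>|lborel. indicator {-pi..pi} \<theta> *\<^sub>R f \<theta>) / (2 * pi)"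
proof -
  have fm: "f \<in> borel_measurable lborel" "f \<in> borel_measurable lebesgue"
    using borel_measurable_continuous_onI[OF c] by (auto intro: measurable_completion)
  have "indicator {-pi..<pi} x / emeasure lebesgue {-pi..<pi} = ennreal (indicator {-pi..<pi} x / (2 * pi))" for x :: real
    by (cases "x \<in> {-pi..<pi}") (auto simp: emeasure_circle_interval divide_ennreal ennreal_1[symmetric] simp del: ennreal_1)
  then have d: "circle_measure = density lebesgue (\<lambda>x. ennreal (indicator {-pi..<pi} x / (2 * pi)))"
    unfolding circle_measure_def uniform_measure_def by (simp del: emeasure_lborel_Ico)
  have "(LINT \<theta>|circle_measure. f \<theta>) = (LINT \<theta>|lebesgue. (indicator {-pi..<pi} \<theta> / (2 * pi)) *\<^sub>R f \<theta>)"
    unfolding d by (rule integral_density)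
      (use fm in \<open>auto intro!: borel_measurable_divide borel_measurable_indicator\<close>)
  also have "\<dots> = (LINT \<theta>|lborel. (indicator {-pi..<pi} \<theta> / (2 * pi)) *\<^sub>R f \<theta>)"
    by (rule integral_completion) (use fm in measurable)
  also have "\<dots> = (LINT \<theta>|lborel. (1 / (2 * pi)) *\<^sub>R (indicator {-pi..pi} \<theta> *\<^sub>R f \<theta>))"
  proof (rule integral_cong_AE)
    have "AE \<theta> in lborel. \<theta> \<noteq> pi" by (rule AE_lborel_singleton)
    then show "AE \<theta> in lborel. (indicator {-pi..<pi} \<theta> / (2 * pi)) *\<^sub>R f \<theta> = (1 / (2 * pi)) *\<^sub>R (indicator {-pi..pi} \<theta> *\<^sub>R f \<theta>)"
      by eventually_elim (auto simp: indicator_def)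
  qed (use fm in measurable)
  finally have "(LINT \<theta>|circle_measure. f \<theta>) = (1 / (2 * pi)) *\<^sub>R (LINT \<theta>|lborel. indicator {-pi..pi} \<theta> *\<^sub>R f \<theta>)"
    by (simp only: Bochner_Integration.integral_scaleR_right)
  moreover have "(1 / (2 * pi)) *\<^sub>R I = I / (2 * pi)" for I :: complex
    by (simp add: scaleR_conv_of_real)
  ultimately show ?thesis by simp
qed

lemma integral_circle_cis:
  "(LINT \<theta>|circle_measure. cis (real_of_int k * \<theta>)) = (if k = 0 then 1 else 0)"
proof (cases "k = 0")
  case True
  then show ?thesis using integral_circle_const[of "1::complex"] by simp
next
  case False
  let ?F = "\<lambda>\<theta>. cis (real_of_int k * \<theta>) / (\<i> * of_int k)"
  have "(LINT \<theta>|lborel. indicator {-pi..pi} \<theta> *\<^sub>R cis (real_of_int k * \<theta>)) = ?F pi - ?F (-pi)"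
  proof (rule integral_FTC_Icc)
    fix x :: real
    have "((\<lambda>\<theta>. exp (\<i> * of_real (real_of_int k * \<theta>)) / (\<i> * of_int k)) has_vector_derivative
       exp (\<i> * of_real (real_of_int k * x))) (at x within {-pi..pi})"
      using False by (auto intro!: derivative_eq_intros has_vector_derivative_real_field simp: has_real_derivative_iff_has_vector_derivative[symmetric] field_simps)
    then show "(?F has_vector_derivative cis (real_of_int k * x)) (at x within {-pi..pi})"
      by (simp add: cis_conv_exp)
  qed (auto intro!: continuous_intros)
  also have "cis (real_of_int k * pi) = cis (real_of_int k * - pi)"
    by (simp add: complex_eq_iff sin_times_pi_eq_0)
  finally show ?thesis using False by (subst integral_circle_continuous) (auto intro!: continuous_intros)
qed


lemma integrable_circle_bounded_mult:
  fixes \<phi> e :: "real \<Rightarrow> complex"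
  assumes \<phi>: "integrable circle_measure \<phi>" and e: "e \<in> borel_measurable circle_measure"
    and B: "AE \<theta> in circle_measure. cmod (e \<theta>) \<le> B"
  shows "integrable circle_measure (\<lambda>\<theta>. \<phi> \<theta> * e \<theta>)"
proof (rule Bochner_Integration.integrable_bound)
  show "integrable circle_measure (\<lambda>\<theta>. of_real B * \<phi> \<theta>)" using \<phi> by auto
  show "(\<lambda>\<theta>. \<phi> \<theta> * e \<theta>) \<in> borel_measurable circle_measure" using \<phi> e by auto
  show "AE \<theta> in circle_measure. cmod (\<phi> \<theta> * e \<theta>) \<le> cmod (of_real B * \<phi> \<theta>)"
    using B
  proof eventually_elim
    case (elim \<theta>)
    then have "cmod (e \<theta>) * cmod (\<phi> \<theta>) \<le> \<bar>B\<bar> * cmod (\<phi> \<theta>)" by (intro mult_right_mono) auto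
    then show ?case by (simp add: norm_mult mult.commute)
  qed
qed

text \<open>Termwise integration against \<open>\<phi>\<close>; it serves both power series (\<open>e m\<close> a positive frequency) and the
expansion of the Cauchy kernel (a negative one).\<close>
lemma circle_sums_integral:
  fixes \<phi> F :: "real \<Rightarrow> complex"
  assumes \<phi>: "integrable circle_measure \<phi>" and b: "summable (\<lambda>m. cmod (b m))"
    and ec: "\<And>m. continuous_on UNIV (e m)" and e1: "\<And>m \<theta>. cmod (e m \<theta>) \<le> 1"
    and F: "\<And>\<theta>. (\<lambda>m. b m * e m \<theta>) sums F \<theta>"
  shows "integrable circle_measure (\<lambda>\<theta>. \<phi> \<theta> * F \<theta>)"
    and "(\<lambda>m. b m * (LINT \<theta>|circle_measure. \<phi> \<theta> * e m \<theta>)) sums (LINT \<theta>|circle_measure. \<phi> \<theta> * F \<theta>)"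
proof -
  let ?f = "\<lambda>m \<theta>. b m * (\<phi> \<theta> * e m \<theta>)"
  have ie: "integrable circle_measure (\<lambda>\<theta>. \<phi> \<theta> * e m \<theta>)" for m
    by (rule integrable_circle_bounded_mult[OF \<phi> measurable_circle_continuous[OF ec], of _ 1]) (use e1 in auto)
  have int: "integrable circle_measure (?f m)" for m using ie by auto
  have le: "cmod (?f m \<theta>) \<le> cmod (b m) * cmod (\<phi> \<theta>)" for m \<theta>
    using e1[of m \<theta>] by (auto simp: norm_mult intro!: mult_left_mono mult_left_le)
  have s1: "AE \<theta> in circle_measure. summable (\<lambda>m. cmod (?f m \<theta>))"
  proof (rule AE_I2)
    fix \<theta> show "summable (\<lambda>m. cmod (?f m \<theta>))"
      by (rule summable_comparison_test'[OF summable_mult2[OF b, of "cmod (\<phi> \<theta>)"]]) (use le in auto)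
  qed
  have s2: "summable (\<lambda>m. LINT \<theta>|circle_measure. cmod (?f m \<theta>))"
  proof (rule summable_comparison_test'[OF summable_mult2[OF b, of "LINT \<theta>|circle_measure. cmod (\<phi> \<theta>)"]])
    fix m :: nat
    have "(LINT \<theta>|circle_measure. cmod (?f m \<theta>)) \<le> (LINT \<theta>|circle_measure. cmod (b m) * cmod (\<phi> \<theta>))"
      using int[of m] \<phi> le by (intro integral_mono integrable_norm) auto
    then show "norm (LINT \<theta>|circle_measure. cmod (?f m \<theta>)) \<le> cmod (b m) * (LINT \<theta>|circle_measure. cmod (\<phi> \<theta>))"
      using \<phi> by simp
  qed
  have eq: "(\<Sum>m. ?f m \<theta>) = \<phi> \<theta> * F \<theta>" for \<theta>
    using sums_mult[OF F[of \<theta>], of "\<phi> \<theta>"] by (simp add: sums_iff mult_ac)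
  show "integrable circle_measure (\<lambda>\<theta>. \<phi> \<theta> * F \<theta>)"
    using integrable_suminf[OF int s1 s2] by (simp add: eq)
  show "(\<lambda>m. b m * (LINT \<theta>|circle_measure. \<phi> \<theta> * e m \<theta>)) sums (LINT \<theta>|circle_measure. \<phi> \<theta> * F \<theta>)"
    using sums_integral[OF int s1 s2] ie by (simp add: eq)
qed

section \<open>Power series on the disc and the Poisson formula\<close>

definition disc_series :: "(nat \<Rightarrow> complex) \<Rightarrow> (complex \<Rightarrow> complex) \<Rightarrow> bool" where
  "disc_series c f \<longleftrightarrow> (\<forall>z\<in>ball 0 1. (\<lambda>n. c n * z ^ n) sums f z)"

lemma disc_seriesD: "disc_series c f \<Longrightarrow> cmod z < 1 \<Longrightarrow> (\<lambda>n. c n * z ^ n) sums f z"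
  by (simp add: disc_series_def)

lemma disc_series_exists:
  assumes "f holomorphic_on ball 0 1" obtains c where "disc_series c f"
proof
  show "disc_series (\<lambda>n. (deriv ^^ n) f 0 / fact n) f"
    using holomorphic_power_series[OF assms] by (simp add: disc_series_def)
qed

lemma disc_series_holomorphic:
  assumes "disc_series c f" shows "f holomorphic_on ball 0 1"
  using assms unfolding disc_series_def by (intro power_series_holomorphic[of 0 1 c]) auto

lemma norm_rcis_less: "0 \<le> r \<Longrightarrow> r < 1 \<Longrightarrow> of_real r * cis \<theta> \<in> ball (0::complex) 1"
  by (simp add: norm_mult)

lemma continuous_on_circle:
  assumes "f holomorphic_on ball 0 1" "0 \<le> r" "r < 1"
  shows "continuous_on UNIV (\<lambda>\<theta>. f (of_real r * cis \<theta>))"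
  by (rule continuous_on_compose2[OF holomorphic_on_imp_continuous_on[OF assms(1)]])
    (use norm_rcis_less[OF assms(2,3)] in \<open>auto intro!: continuous_intros\<close>)

lemma bounded_on_circle:
  assumes "f holomorphic_on ball 0 1" "0 \<le> r" "r < 1"
  obtains B where "\<And>\<theta>. cmod (f (of_real r * cis \<theta>)) \<le> B"
proof -
  have "compact (f ` cball 0 r)"
    using assms(3) by (intro compact_continuous_image continuous_on_subset[OF holomorphic_on_imp_continuous_on[OF assms(1)]]) auto
  then obtain B where "\<And>x. x \<in> cball 0 r \<Longrightarrow> cmod (f x) \<le> B"
    using compact_imp_bounded bounded_iff by (metis imageI)
  then show ?thesis using assms(2) that[of B] by (auto simp: norm_mult)
qed

lemma disc_series_radial:
  assumes c: "disc_series c f" and r: "0 \<le> r" "r < 1" and \<phi>: "integrable circle_measure \<phi>"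
  shows "integrable circle_measure (\<lambda>\<theta>. \<phi> \<theta> * f (of_real r * cis \<theta>))"
    and "(\<lambda>n. (c n * of_real r ^ n) * (LINT \<theta>|circle_measure. \<phi> \<theta> * cis (real n * \<theta>))) sums
          (LINT \<theta>|circle_measure. \<phi> \<theta> * f (of_real r * cis \<theta>))"
proof -
  obtain r' where r': "r < r'" "r' < 1" using dense r by blast
  have "summable (\<lambda>n. c n * of_real r' ^ n)"
    using c r r' by (auto simp: disc_series_def sums_iff)
  then have b: "summable (\<lambda>n. cmod (c n * of_real r ^ n))"
    by (rule powser_insidea) (use r r' in auto)
  have s: "(\<lambda>m. (c m * of_real r ^ m) * cis (real m * \<theta>)) sums f (of_real r * cis \<theta>)" for \<theta>
    using disc_seriesD[OF c, of "of_real r * cis \<theta>"] norm_rcis_less[OF r, of \<theta>]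
    by (simp only: power_mult_distrib Complex.DeMoivre mult.assoc mem_ball_0)
  show "integrable circle_measure (\<lambda>\<theta>. \<phi> \<theta> * f (of_real r * cis \<theta>))"
    by (rule circle_sums_integral(1)[OF \<phi> b _ _ s]) (auto intro!: continuous_intros)
  show "(\<lambda>n. (c n * of_real r ^ n) * (LINT \<theta>|circle_measure. \<phi> \<theta> * cis (real n * \<theta>))) sums
          (LINT \<theta>|circle_measure. \<phi> \<theta> * f (of_real r * cis \<theta>))"
    by (rule circle_sums_integral(2)[OF \<phi> b _ _ s]) (auto intro!: continuous_intros)
qed

lemma integrable_circle_cis: "integrable circle_measure (\<lambda>\<theta>. cis (a * \<theta>))"
  by (rule integrable_circle_continuous[where B = 1]) (auto intro!: continuous_intros)

lemma disc_series_fourier: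
  assumes c: "disc_series c f" and r: "0 \<le> r" "r < 1"
  shows "(LINT \<theta>|circle_measure. cis (- (real_of_int k * \<theta>)) * f (of_real r * cis \<theta>)) =
    (if 0 \<le> k then c (nat k) * of_real r ^ nat k else 0)"
proof -
  have i: "(LINT \<theta>|circle_measure. cis (- (real_of_int k * \<theta>)) * cis (real n * \<theta>)) = (if int n = k then 1 else 0)" for n
    using integral_circle_cis[of "int n - k"] by (simp add: cis_mult algebra_simps)
  have "(\<lambda>n. (c n * of_real r ^ n) * (if int n = k then 1 else 0)) sums
     (LINT \<theta>|circle_measure. cis (- (real_of_int k * \<theta>)) * f (of_real r * cis \<theta>))"
    using disc_series_radial(2)[OF c r integrable_circle_cis[of "- real_of_int k"]] by (simp add: i)
  moreover have "(\<lambda>n. (c n * of_real r ^ n) * (if int n = k then 1 else 0)) sums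
     (if 0 \<le> k then c (nat k) * of_real r ^ nat k else 0)"
  proof (cases "0 \<le> k")
    case True
    then have "(\<lambda>n. (c n * of_real r ^ n) * (if int n = k then 1 else 0)) =
       (\<lambda>n. if n = nat k then c n * of_real r ^ n else 0)" by (intro ext) auto
    with True sums_single[of "nat k" "\<lambda>n. c n * of_real r ^ n"] show ?thesis by simp
  next
    case False
    then have "(\<lambda>n. (c n * of_real r ^ n) * (if int n = k then 1 else 0)) = (\<lambda>n. 0)" by (intro ext) auto
    with False show ?thesis by simp
  qed
  ultimately show ?thesis by (rule sums_unique2)
qed

text \<open>On the circle the kernel is the geometric series in \<open>z * cis (- \<theta>)\<close>, so only its \<open>n\<close>-th term is not
orthogonal to \<open>cis (n * \<theta>)\<close>.\<close>
lemma integral_cauchy_kernel: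
  assumes z: "cmod z < 1"
  shows "integrable circle_measure (\<lambda>\<theta>. cis \<theta> / (cis \<theta> - z))"
    and "(LINT \<theta>|circle_measure. cis \<theta> / (cis \<theta> - z) * cis (real n * \<theta>)) = z ^ n"
proof -
  have s: "(\<lambda>m. z ^ m * cis (- (real m * \<theta>))) sums (cis \<theta> / (cis \<theta> - z))" for \<theta>
  proof -
    \<comment> \<open>Dividing by \<open>cis \<theta>\<close> exhibits the geometric series.\<close>
    have "(\<lambda>m. (z * cis (- \<theta>)) ^ m) sums (1 / (1 - z * cis (- \<theta>)))"
      by (rule geometric_sums) (use z in \<open>simp add: norm_mult\<close>)
    moreover have "1 / (1 - z * cis (- \<theta>)) = cis \<theta> / (cis \<theta> - z)"
    proof -
      have "cis \<theta> * (1 - z * cis (- \<theta>)) = cis \<theta> - z * (cis \<theta> * cis (- \<theta>))" by (simp only: right_diff_distrib mult_1_right mult.left_commute)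
      also have "\<dots> = cis \<theta> - z" by (simp add: cis_mult)
      finally have "cis \<theta> / (cis \<theta> - z) = cis \<theta> / (cis \<theta> * (1 - z * cis (- \<theta>)))" by simp
      then show ?thesis by simp
    qed
    moreover have "cis (- \<theta>) ^ m = cis (- (real m * \<theta>))" for m by (subst Complex.DeMoivre) simp
    ultimately show ?thesis by (simp only: power_mult_distrib)
  qed
  have b: "summable (\<lambda>m. cmod (z ^ m))" using z by (simp add: norm_power summable_geometric)
  have c1: "continuous_on UNIV (\<lambda>\<theta>. cis (- (real m * \<theta>)))" for m by (intro continuous_intros)
  have int1: "integrable circle_measure (\<lambda>\<theta>. 1::complex)"
    by (rule integrable_circle_continuous[where B = 1]) auto
  show "integrable circle_measure (\<lambda>\<theta>. cis \<theta> / (cis \<theta> - z))"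
    using circle_sums_integral(1)[OF int1 b c1 _ s] by simp
  have i: "(LINT \<theta>|circle_measure. cis (real n * \<theta>) * cis (- (real m * \<theta>))) = (if m = n then 1 else 0)" for m
    using integral_circle_cis[of "int n - int m"] by (simp add: cis_mult algebra_simps)
  have "(\<lambda>m. z ^ m * (if m = n then 1 else 0)) sums (LINT \<theta>|circle_measure. cis (real n * \<theta>) * (cis \<theta> / (cis \<theta> - z)))"
    using circle_sums_integral(2)[OF integrable_circle_cis[of "real n"] b c1 _ s] by (simp add: i)
  moreover have "(\<lambda>m. z ^ m * (if m = n then 1 else 0)) sums z ^ n"
    using sums_single[of n "\<lambda>m. z ^ m"] by (simp add: if_distrib cong: if_cong)
  ultimately show "(LINT \<theta>|circle_measure. cis \<theta> / (cis \<theta> - z) * cis (real n * \<theta>)) = z ^ n"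
    by (subst mult.commute) (rule sums_unique2)
qed

lemma cauchy_formula_circle:
  assumes f: "f holomorphic_on ball 0 1" and r: "0 \<le> r" "r < 1" and z: "cmod z < 1"
  shows "(LINT \<theta>|circle_measure. cis \<theta> / (cis \<theta> - z) * f (of_real r * cis \<theta>)) = f (of_real r * z)"
proof -
  obtain c where c: "disc_series c f" using disc_series_exists[OF f] .
  have "(\<lambda>n. (c n * of_real r ^ n) * z ^ n) sums (LINT \<theta>|circle_measure. cis \<theta> / (cis \<theta> - z) * f (of_real r * cis \<theta>))"
    using disc_series_radial(2)[OF c r integral_cauchy_kernel(1)[OF z]] by (simp only: integral_cauchy_kernel(2)[OF z])
  moreover have "cmod (of_real r * z) < 1"
    using r z mult_left_le_one_le[of "cmod z" r] by (simp add: norm_mult)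
  then have "(\<lambda>n. (c n * of_real r ^ n) * z ^ n) sums f (of_real r * z)"
    using disc_seriesD[OF c] by (fastforce simp: power_mult_distrib mult.assoc)
  ultimately show ?thesis by (rule sums_unique2)
qed

definition poisson_kernel :: "complex \<Rightarrow> real \<Rightarrow> real" where
  "poisson_kernel z \<theta> = (1 - (cmod z)\<^sup>2) / (cmod (cis \<theta> - z))\<^sup>2"

text \<open>Cauchy's formula for the auxiliary function \<open>f (r x) (1 - (cmod z)\<^sup>2) / (1 - cnj z * x)\<close>, which agrees with
\<open>f (r x)\<close> at \<open>x = z\<close>: on the circle \<open>cis \<theta> * cnj (cis \<theta>) = 1\<close> turns the product of the two
kernels into the Poisson kernel.\<close>
lemma poisson_formula:
  assumes f: "f holomorphic_on ball 0 1" and r: "0 < r" "r < 1" and z: "cmod z < 1"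
  shows "(LINT \<theta>|circle_measure. f (of_real r * cis \<theta>) * of_real (poisson_kernel z \<theta>)) = f (of_real r * z)"
proof -
  \<comment> \<open>The auxiliary function is rescaled by \<open>q\<close>, so that it is analytic in the unit disc and the formula
  is applied on the circle of radius \<open>q < 1\<close>.\<close>
  define q where "q = max r (cmod z)"
  have q: "0 < q" "q < 1" "r \<le> q" "cmod z \<le> q" using r z by (auto simp: q_def)
  define G where "G x = f (of_real (r / q) * x) * ((1 - (cmod z)\<^sup>2) / (1 - cnj z / of_real q * x))" for x
  have small: "cmod (a * x) < 1" if "cmod a \<le> 1" "cmod x < 1" for a x :: complex
    using that mult_left_le_one_le[of "cmod x" "cmod a"] by (simp add: norm_mult)
  have a1: "cmod (of_real (r / q)) \<le> 1" "cmod (cnj z / of_real q) \<le> 1"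
    using q r by (auto simp: norm_divide)
  have "G holomorphic_on ball 0 1"
    unfolding G_def
  proof (intro holomorphic_intros)
    show "(\<lambda>x. f (of_real (r / q) * x)) holomorphic_on ball 0 1"
      by (rule holomorphic_on_compose_gen[OF _ f, unfolded o_def])
        (use small[OF a1(1)] in \<open>auto intro!: holomorphic_intros\<close>)
    show "1 - cnj z / of_real q * x \<noteq> 0" if "x \<in> ball 0 1" for x
      using small[OF a1(2), of x] that by (metis eq_iff_diff_eq_0 less_irrefl mem_ball_0 norm_one)
  qed
  from cauchy_formula_circle[OF this _ q(2) z] q
  have "(LINT \<theta>|circle_measure. cis \<theta> / (cis \<theta> - z) * G (of_real q * cis \<theta>)) = G (of_real q * z)" by simp
  moreover have "G (of_real q * z) = f (of_real r * z)"
  proof -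
    have "1 - (cmod z)\<^sup>2 \<noteq> 0" using z abs_square_less_1[of "cmod z"] by simp
    then have "complex_of_real (1 - (cmod z)\<^sup>2) \<noteq> 0" by (simp only: of_real_eq_0_iff not_False_eq_True)
    moreover have "1 - cnj z * z = complex_of_real (1 - (cmod z)\<^sup>2)"
      by (simp only: of_real_diff of_real_1 complex_norm_square mult.commute)
    ultimately show ?thesis using q by (simp add: G_def)
  qed
  moreover have "cis \<theta> / (cis \<theta> - z) * G (of_real q * cis \<theta>) = f (of_real r * cis \<theta>) * of_real (poisson_kernel z \<theta>)" for \<theta>
  proof -
    have "cis \<theta> * cnj (cis \<theta>) = 1" by (simp add: cis_cnj cis_mult)
    then have "(cis \<theta> - z) * (1 - cnj z * cis \<theta>) = cis \<theta> * ((cis \<theta> - z) * cnj (cis \<theta> - z))"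
      by (simp add: algebra_simps)
    also have "\<dots> = cis \<theta> * of_real ((cmod (cis \<theta> - z))\<^sup>2)" by (simp only: complex_norm_square)
    finally have "cis \<theta> / ((cis \<theta> - z) * (1 - cnj z * cis \<theta>)) = 1 / of_real ((cmod (cis \<theta> - z))\<^sup>2)" by simp
    moreover have "cis \<theta> / (cis \<theta> - z) * (f (of_real r * cis \<theta>) * ((1 - (cmod z)\<^sup>2) / (1 - cnj z * cis \<theta>))) =
      f (of_real r * cis \<theta>) * (1 - (cmod z)\<^sup>2) * (cis \<theta> / ((cis \<theta> - z) * (1 - cnj z * cis \<theta>)))" by simp
    ultimately have "cis \<theta> / (cis \<theta> - z) * (f (of_real r * cis \<theta>) * ((1 - (cmod z)\<^sup>2) / (1 - cnj z * cis \<theta>))) =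
      f (of_real r * cis \<theta>) * (1 - (cmod z)\<^sup>2) * (1 / of_real ((cmod (cis \<theta> - z))\<^sup>2))" by (simp only:)
    then show ?thesis using q by (simp add: G_def poisson_kernel_def)
  qed
  ultimately show ?thesis by simp
qed


lemma poisson_kernel_nonneg: "cmod z < 1 \<Longrightarrow> 0 \<le> poisson_kernel z \<theta>"
  using abs_square_le_1[of "cmod z"] by (simp add: poisson_kernel_def)

lemma cis_minus_nonzero: "cmod z < 1 \<Longrightarrow> cis \<theta> - z \<noteq> 0"
  by (metis eq_iff_diff_eq_0 less_irrefl norm_cis)

lemma continuous_poisson_kernel:
  "cmod z < 1 \<Longrightarrow> continuous_on UNIV (\<lambda>\<theta>. poisson_kernel z \<theta>)"
  unfolding poisson_kernel_def using cis_minus_nonzero by (intro continuous_intros) auto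

lemma poisson_kernel_le:
  assumes "cmod z < 1" shows "poisson_kernel z \<theta> \<le> 1 / (1 - cmod z)\<^sup>2"
proof -
  have "1 - cmod z \<le> cmod (cis \<theta> - z)" using norm_triangle_ineq2[of "cis \<theta>" z] by simp
  then have "(1 - cmod z)\<^sup>2 \<le> (cmod (cis \<theta> - z))\<^sup>2" using assms by (intro power_mono) auto
  then show ?thesis unfolding poisson_kernel_def using assms by (intro frac_le) auto
qed

lemma integrable_poisson_kernel:
  assumes "cmod z < 1" shows "integrable circle_measure (poisson_kernel z)"
  by (rule integrable_circle_continuous[OF continuous_poisson_kernel[OF assms], of "1 / (1 - cmod z)\<^sup>2"])
    (use poisson_kernel_le[OF assms] poisson_kernel_nonneg[OF assms] in auto)

lemma integral_poisson_kernel: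
  assumes z: "cmod z < 1" shows "(LINT \<theta>|circle_measure. poisson_kernel z \<theta>) = 1"
proof -
  have "(LINT \<theta>|circle_measure. 1 * complex_of_real (poisson_kernel z \<theta>)) = 1"
    by (rule poisson_formula[where f = "\<lambda>_. 1" and r = "1/2"]) (use z in auto)
  then have "complex_of_real (LINT \<theta>|circle_measure. poisson_kernel z \<theta>) = 1"
    by (subst integral_complex_of_real[symmetric]) simp
  then show ?thesis by simp
qed

section \<open>Hardy functions, outer functions and their boundary values\<close>

text \<open>A fixed sequence of radii: the convergence theorems for integrals are about sequences.\<close>
definition rad :: "nat \<Rightarrow> real" where "rad n = 1 - 1 / (real n + 2)"

lemma rad: "0 < rad n" "rad n < 1" "0 \<le> rad n"
  by (auto simp: rad_def field_simps)

lemma rad_tendsto: "rad \<longlonglongrightarrow> 1"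
proof -
  have "(\<lambda>n. 1 - inverse (real (Suc (Suc n)))) \<longlonglongrightarrow> 1 - 0"
    by (intro tendsto_diff tendsto_const LIMSEQ_Suc[OF LIMSEQ_inverse_real_of_nat])
  then show ?thesis by (simp add: rad_def[abs_def] divide_inverse add.commute)
qed

lemma rad_at_left: "filterlim rad (at_left 1) sequentially"
  unfolding filterlim_at using rad_tendsto rad(2) by (auto simp: less_imp_neq)

abbreviation radial_limit :: "(complex \<Rightarrow> complex) \<Rightarrow> (real \<Rightarrow> complex) \<Rightarrow> bool" where
  "radial_limit f X \<equiv>
     (AE \<theta> in circle_measure. (\<lambda>n. f (of_real (rad n) * cis \<theta>)) \<longlonglongrightarrow> X \<theta>)"

text \<open>The boundary function \<open>\<theta> \<mapsto> f (cis \<theta>)\<close> is only determined almost everywhere and may fail to be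
measurable, so integrals are taken of the limit along the radii \<open>rad n\<close> instead.\<close>
lemma radial_limit_measurable:
  assumes f: "f holomorphic_on ball 0 1" and "radial_boundary f"
  obtains X where "X \<in> borel_measurable circle_measure" "AE \<theta> in circle_measure. X \<theta> = f (cis \<theta>)"
    "radial_limit f X"
proof -
  define X where "X \<theta> = lim (\<lambda>n. f (of_real (rad n) * cis \<theta>))" for \<theta>
  have m: "X \<in> borel_measurable circle_measure" unfolding X_def[abs_def]
    by (intro borel_measurable_lim_metric measurable_circle_continuous continuous_on_circle f rad)
  have ae: "AE \<theta> in circle_measure. (\<lambda>n. f (of_real (rad n) * cis \<theta>)) \<longlonglongrightarrow> f (cis \<theta>)"
    using assms(2) unfolding radial_boundary_def
    by eventually_elim (rule filterlim_compose[OF _ rad_at_left])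
  then have "AE \<theta> in circle_measure. X \<theta> = f (cis \<theta>)"
    by eventually_elim (simp add: X_def limI)
  moreover from ae this have "radial_limit f X"
    by eventually_elim simp
  ultimately show ?thesis using that m by blast
qed

text \<open>The Poisson formula on the circles of radius \<open>rad n\<close> passes to the limit by the mean square bound that
defines the Hardy class. Hence \<open>f\<close> is the Poisson integral of its boundary values, and the kernel is a
probability density.\<close>
lemma hardy_H2_bounded:
  assumes f: "hardy_H2 f" and B: "AE \<theta> in circle_measure. cmod (f (cis \<theta>)) \<le> B" and z: "cmod z < 1"
  shows "cmod (f z) \<le> B"
proof -
  have hol: "f holomorphic_on ball 0 1" using f by (simp add: hardy_H2_def)
  obtain X where Xm: "X \<in> borel_measurable circle_measure" and Xf: "AE \<theta> in circle_measure. X \<theta> = f (cis \<theta>)"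
    and X: "radial_limit f X"
    by (rule radial_limit_measurable[OF hol]) (use f in \<open>auto simp: hardy_H2_def\<close>)
  obtain M where M': "\<And>x. x \<in> (\<lambda>r. LINT \<theta>|circle_measure. (cmod (f (of_real r * cis \<theta>)))\<^sup>2) ` {0..<1} \<Longrightarrow> x \<le> M"
    using f unfolding hardy_H2_def bdd_above_def by blast
  have M: "(LINT \<theta>|circle_measure. (cmod (f (of_real r * cis \<theta>)))\<^sup>2) \<le> M" if "0 \<le> r" "r < 1" for r
    by (rule M'[OF imageI]) (use that in simp)
  let ?P = "poisson_kernel z" and ?Q = "1 / (1 - cmod z)\<^sup>2"
  let ?fr = "\<lambda>n \<theta>. f (of_real (rad n) * cis \<theta>)"
  have Q0: "0 \<le> ?Q" by simp
  have frc: "continuous_on UNIV (?fr n)" for n by (rule continuous_on_circle[OF hol]) (use rad[of n] in auto)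
  have Pm: "(\<lambda>\<theta>. complex_of_real (?P \<theta>)) \<in> borel_measurable circle_measure"
    by (intro measurable_circle_continuous continuous_intros continuous_poisson_kernel z)
  have i2: "integrable circle_measure (\<lambda>\<theta>. (cmod (?fr n \<theta>))\<^sup>2)" for n
  proof -
    obtain Bn where "\<And>\<theta>. cmod (?fr n \<theta>) \<le> Bn" using bounded_on_circle[OF hol rad(3)[of n] rad(2)[of n]] by blast
    then show ?thesis
      by (intro integrable_circle_continuous[where B = "Bn\<^sup>2"] continuous_intros frc) (auto intro: power_mono)
  qed
  have le: "(cmod (?fr n \<theta> * of_real (?P \<theta>)))\<^sup>2 \<le> ?Q\<^sup>2 * (cmod (?fr n \<theta>))\<^sup>2" for n \<theta>
    using poisson_kernel_le[OF z, of \<theta>] poisson_kernel_nonneg[OF z, of \<theta>]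
    by (simp add: norm_mult power_mult_distrib mult.commute[of _ "(cmod _)\<^sup>2"] mult_left_mono power_mono del: power_one_over power_divide)
  have ip: "integrable circle_measure (\<lambda>\<theta>. (cmod (?fr n \<theta> * of_real (?P \<theta>)))\<^sup>2)" for n
  proof (rule Bochner_Integration.integrable_bound)
    show "integrable circle_measure (\<lambda>\<theta>. ?Q\<^sup>2 * (cmod (?fr n \<theta>))\<^sup>2)" by (rule integrable_mult_right[OF i2])
    show "(\<lambda>\<theta>. (cmod (?fr n \<theta> * of_real (?P \<theta>)))\<^sup>2) \<in> borel_measurable circle_measure"
      by (intro measurable_circle_continuous continuous_intros frc continuous_poisson_kernel z)
    show "AE \<theta> in circle_measure. norm ((cmod (?fr n \<theta> * of_real (?P \<theta>)))\<^sup>2) \<le> norm (?Q\<^sup>2 * (cmod (?fr n \<theta>))\<^sup>2)"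
      using order_trans[OF le abs_ge_self] by (intro AE_I2) (simp only: real_norm_def abs_power2)
  qed
  have "(\<lambda>n. LINT \<theta>|circle_measure. ?fr n \<theta> * of_real (?P \<theta>)) \<longlonglongrightarrow> (LINT \<theta>|circle_measure. X \<theta> * of_real (?P \<theta>))"
  proof (rule bounded_L2_tendsto_integral[OF finite_measure_circle _ _ _ ip, where B = "?Q\<^sup>2 * M"])
    show "(\<lambda>\<theta>. ?fr n \<theta> * of_real (?P \<theta>)) \<in> borel_measurable circle_measure" for n
      by (intro measurable_circle_continuous continuous_intros frc continuous_poisson_kernel z)
    show "(\<lambda>\<theta>. X \<theta> * of_real (?P \<theta>)) \<in> borel_measurable circle_measure" using Xm Pm by (rule borel_measurable_times)
    show "AE \<theta> in circle_measure. (\<lambda>n. ?fr n \<theta> * of_real (?P \<theta>)) \<longlonglongrightarrow> X \<theta> * of_real (?P \<theta>)"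
      using X by eventually_elim (intro tendsto_intros)
    show "(LINT \<theta>|circle_measure. (cmod (?fr n \<theta> * of_real (?P \<theta>)))\<^sup>2) \<le> ?Q\<^sup>2 * M" for n
    proof -
      have "(LINT \<theta>|circle_measure. (cmod (?fr n \<theta> * of_real (?P \<theta>)))\<^sup>2) \<le> (LINT \<theta>|circle_measure. ?Q\<^sup>2 * (cmod (?fr n \<theta>))\<^sup>2)"
        by (rule integral_mono[OF ip integrable_mult_right[OF i2] le])
      also have "\<dots> = ?Q\<^sup>2 * (LINT \<theta>|circle_measure. (cmod (?fr n \<theta>))\<^sup>2)" by (rule integral_mult_right_zero)
      also have "\<dots> \<le> ?Q\<^sup>2 * M" using M[of "rad n"] rad[of n] by (intro mult_left_mono) auto
      finally show ?thesis .
    qed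
  qed
  moreover have "(LINT \<theta>|circle_measure. ?fr n \<theta> * of_real (?P \<theta>)) = f (of_real (rad n) * z)" for n
    by (rule poisson_formula[OF hol rad(1,2) z])
  moreover have "(\<lambda>n. f (of_real (rad n) * z)) \<longlonglongrightarrow> f (of_real 1 * z)"
  proof (rule isCont_tendsto_compose[of _ f])
    show "isCont f (of_real 1 * z)"
      using holomorphic_on_imp_continuous_on[OF hol] z by (simp add: continuous_on_eq_continuous_at)
    show "(\<lambda>n. of_real (rad n) * z) \<longlonglongrightarrow> of_real 1 * z" by (intro tendsto_intros rad_tendsto)
  qed
  ultimately have eq: "f z = (LINT \<theta>|circle_measure. X \<theta> * of_real (?P \<theta>))"
    using LIMSEQ_unique by simp
  have XB: "AE \<theta> in circle_measure. cmod (X \<theta> * of_real (?P \<theta>)) \<le> B * ?P \<theta>"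
    using Xf B by eventually_elim (use poisson_kernel_nonneg[OF z] in \<open>simp add: norm_mult mult_right_mono\<close>)
  have "cmod (f z) \<le> (LINT \<theta>|circle_measure. cmod (X \<theta> * of_real (?P \<theta>)))"
    unfolding eq by (rule integral_norm_bound)
  also have "\<dots> \<le> (LINT \<theta>|circle_measure. B * ?P \<theta>)"
  proof (rule integral_mono_AE[OF _ integrable_mult_right[OF integrable_poisson_kernel[OF z]] XB])
    show "integrable circle_measure (\<lambda>\<theta>. cmod (X \<theta> * of_real (?P \<theta>)))"
    proof (rule Bochner_Integration.integrable_bound[OF integrable_mult_right[OF integrable_poisson_kernel[OF z], of B]])
      show "(\<lambda>\<theta>. cmod (X \<theta> * of_real (?P \<theta>))) \<in> borel_measurable circle_measure" using Xm Pm by simp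
      show "AE \<theta> in circle_measure. norm (cmod (X \<theta> * of_real (?P \<theta>))) \<le> norm (B * ?P \<theta>)"
        using XB by eventually_elim (metis abs_ge_self abs_norm_cancel order_trans real_norm_def)
    qed
  qed
  also have "\<dots> = B" using integral_poisson_kernel[OF z] by simp
  finally show ?thesis .
qed

lemma Re_herglotz_kernel:
  "Re ((cis \<theta> + z) / (cis \<theta> - z)) = poisson_kernel z \<theta>"
proof -
  have "(cos \<theta> + Re z) * (cos \<theta> - Re z) + (sin \<theta> + Im z) * (sin \<theta> - Im z) =
     (sin \<theta>)\<^sup>2 + (cos \<theta>)\<^sup>2 - ((Re z)\<^sup>2 + (Im z)\<^sup>2)" by algebra
  then show ?thesis unfolding poisson_kernel_def by (simp add: Re_divide cmod_power2 sin_cos_squared_add)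
qed

text \<open>The logarithm of \<open>cmod f\<close> is the Poisson integral of its boundary values, by the representation
of outer functions, so a lower bound on the circle carries over to the disc.\<close>
lemma outer_function_bounded_below:
  assumes f: "outer_function f" and \<delta>: "0 < \<delta>" and B: "AE \<theta> in circle_measure. \<delta> \<le> cmod (f (cis \<theta>))"
    and z: "cmod z < 1"
  shows "\<delta> \<le> cmod (f z)"
proof -
  let ?L = "\<lambda>\<theta>. ln (cmod (f (cis \<theta>)))"
  let ?H = "\<lambda>\<theta>. (cis \<theta> + z) / (cis \<theta> - z)"
  have L: "integrable circle_measure ?L" using f by (simp add: outer_function_def)
  obtain c where c: "cmod c = 1" "f z = c * exp (LINT \<theta>|circle_measure. ?H \<theta> * of_real (?L \<theta>))"
    using f z unfolding outer_function_def by auto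
  have Hc: "continuous_on UNIV ?H" using cis_minus_nonzero[OF z] by (intro continuous_intros) auto
  have HB: "cmod (?H \<theta>) \<le> 2 / (1 - cmod z)" for \<theta>
  proof -
    have "cmod (cis \<theta> + z) \<le> 2" using norm_triangle_ineq[of "cis \<theta>" z] z by simp
    moreover have "1 - cmod z \<le> cmod (cis \<theta> - z)" using norm_triangle_ineq2[of "cis \<theta>" z] by simp
    ultimately show ?thesis unfolding norm_divide using z by (intro frac_le) auto
  qed
  have HL: "integrable circle_measure (\<lambda>\<theta>. of_real (?L \<theta>) * ?H \<theta>)"
    by (rule integrable_circle_bounded_mult[OF _ measurable_circle_continuous[OF Hc]]) (use L HB in auto)
  then have HL: "integrable circle_measure (\<lambda>\<theta>. ?H \<theta> * of_real (?L \<theta>))" by (simp only: mult.commute)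
  have ReHL: "Re (?H \<theta> * of_real (?L \<theta>)) = poisson_kernel z \<theta> * ?L \<theta>" for \<theta>
    unfolding Re_herglotz_kernel[symmetric] by (subst times_complex.sel) simp
  have "ln \<delta> = (LINT \<theta>|circle_measure. poisson_kernel z \<theta> * ln \<delta>)"
    using integral_poisson_kernel[OF z] by simp
  also have "\<dots> \<le> (LINT \<theta>|circle_measure. poisson_kernel z \<theta> * ?L \<theta>)"
  proof (rule integral_mono_AE)
    show "integrable circle_measure (\<lambda>\<theta>. poisson_kernel z \<theta> * ln \<delta>)"
      using integrable_poisson_kernel[OF z] by simp
    show "integrable circle_measure (\<lambda>\<theta>. poisson_kernel z \<theta> * ?L \<theta>)"
      using integrable_Re[OF HL] by (simp only: ReHL)
    show "AE \<theta> in circle_measure. poisson_kernel z \<theta> * ln \<delta> \<le> poisson_kernel z \<theta> * ?L \<theta>"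
      using B by eventually_elim (use \<delta> poisson_kernel_nonneg[OF z] in \<open>auto intro!: mult_left_mono simp: ln_mono\<close>)
  qed
  also have "\<dots> = Re (LINT \<theta>|circle_measure. ?H \<theta> * of_real (?L \<theta>))"
    using integral_Re[OF HL] by (simp only: ReHL)
  finally have "exp (ln \<delta>) \<le> cmod (f z)" unfolding c(2) using c(1) by (simp add: norm_mult)
  then show ?thesis using \<delta> by simp
qed

section \<open>Fourier coefficients of bounded boundary functions\<close>

lemma disc_series_coeff_le:
  assumes c: "disc_series c f" and B: "\<And>z. cmod z < 1 \<Longrightarrow> cmod (f z) \<le> B"
  shows "cmod (c n) \<le> B"
proof -
  have "cmod (c n * of_real (rad m) ^ n) \<le> B" for m
  proof -
    let ?h = "\<lambda>\<theta>. cis (- (real_of_int (int n) * \<theta>)) * f (of_real (rad m) * cis \<theta>)"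
    have i: "integrable circle_measure ?h"
      using disc_series_radial(1)[OF c rad(3) rad(2), of _ m, OF integrable_circle_cis[of "- real n"]] by simp
    have le: "cmod (?h \<theta>) \<le> B" for \<theta>
      using B norm_rcis_less[OF rad(3) rad(2), of m \<theta>] by (simp add: norm_mult)
    have "c n * of_real (rad m) ^ n = (LINT \<theta>|circle_measure. ?h \<theta>)"
      by (subst disc_series_fourier[OF c rad(3) rad(2)]) simp
    then have "cmod (c n * of_real (rad m) ^ n) \<le> (LINT \<theta>|circle_measure. cmod (?h \<theta>))"
      by (metis integral_norm_bound)
    also have "\<dots> \<le> (LINT \<theta>|circle_measure. B)"
      using i le by (intro integral_mono integrable_norm circle.integrable_const) auto
    also have "\<dots> = B" by (rule integral_circle_const)
    finally show ?thesis .
  qed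
  moreover have "(\<lambda>m. cmod (c n * of_real (rad m) ^ n)) \<longlonglongrightarrow> cmod (c n * of_real 1 ^ n)"
    by (intro tendsto_intros rad_tendsto)
  ultimately show ?thesis by (intro LIMSEQ_le_const2[where X = "\<lambda>m. cmod (c n * of_real (rad m) ^ n)"]) auto
qed

lemma bounded_radial_tendsto:
  assumes f: "f holomorphic_on ball 0 1" and B: "\<And>z. cmod z < 1 \<Longrightarrow> cmod (f z) \<le> B"
    and Xm: "X \<in> borel_measurable circle_measure"
    and X: "radial_limit f X"
    and \<phi>: "integrable circle_measure \<phi>"
  shows "(\<lambda>n. LINT \<theta>|circle_measure. \<phi> \<theta> * f (of_real (rad n) * cis \<theta>)) \<longlonglongrightarrow>
         (LINT \<theta>|circle_measure. \<phi> \<theta> * X \<theta>)"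
proof (rule integral_dominated_convergence[where w = "\<lambda>\<theta>. cmod (\<phi> \<theta>) * B"])
  have [measurable]: "\<phi> \<in> borel_measurable circle_measure" using \<phi> by auto
  show "(\<lambda>\<theta>. \<phi> \<theta> * X \<theta>) \<in> borel_measurable circle_measure" using Xm by measurable
  show "(\<lambda>\<theta>. \<phi> \<theta> * f (of_real (rad n) * cis \<theta>)) \<in> borel_measurable circle_measure" for n
    using measurable_circle_continuous[OF continuous_on_circle[OF f rad(3) rad(2), of n]] by measurable
  show "integrable circle_measure (\<lambda>\<theta>. cmod (\<phi> \<theta>) * B)" using \<phi> by auto
  show "AE \<theta> in circle_measure. (\<lambda>n. \<phi> \<theta> * f (of_real (rad n) * cis \<theta>)) \<longlonglongrightarrow> \<phi> \<theta> * X \<theta>"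
    using X by eventually_elim (intro tendsto_intros)
  show "AE \<theta> in circle_measure. cmod (\<phi> \<theta> * f (of_real (rad n) * cis \<theta>)) \<le> cmod (\<phi> \<theta>) * B" for n
    using B norm_rcis_less[OF rad(3) rad(2), of n] by (intro AE_I2) (simp add: norm_mult mult_left_mono)
qed

text \<open>Parseval's identity between the Taylor coefficients of \<open>f\<close> and the Fourier coefficients of \<open>\<phi>\<close>. It holds
on smaller circles by termwise integration; the passage to the boundary uses dominated
convergence for the integral and Tannery's theorem for the series.\<close>
lemma disc_series_boundary_integral:
  assumes c: "disc_series c f" and B: "\<And>z. cmod z < 1 \<Longrightarrow> cmod (f z) \<le> B"
    and Xm: "X \<in> borel_measurable circle_measure"
    and X: "radial_limit f X"
    and \<phi>: "integrable circle_measure \<phi>"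
    and s: "summable (\<lambda>n. cmod (LINT \<theta>|circle_measure. \<phi> \<theta> * cis (real n * \<theta>)))"
  shows "(\<lambda>n. c n * (LINT \<theta>|circle_measure. \<phi> \<theta> * cis (real n * \<theta>))) sums (LINT \<theta>|circle_measure. \<phi> \<theta> * X \<theta>)"
proof -
  let ?\<phi> = "\<lambda>n. LINT \<theta>|circle_measure. \<phi> \<theta> * cis (real n * \<theta>)"
  let ?a = "\<lambda>n m. (c n * of_real (rad m) ^ n) * ?\<phi> n"
  have cB: "cmod (c n) \<le> B" for n by (rule disc_series_coeff_le[OF c B])
  have le: "cmod (?a n m) \<le> B * cmod (?\<phi> n)" for n m
  proof -
    have "cmod (c n) * rad m ^ n \<le> B * 1"
      using cB[of n] rad[of m] order_trans[OF norm_ge_zero cB[of n]] by (intro mult_mono power_le_one) auto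
    then show ?thesis using rad[of m] by (simp add: norm_mult norm_power mult_right_mono)
  qed
  have lim: "(\<lambda>m. ?a n m) \<longlonglongrightarrow> (c n * of_real 1 ^ n) * ?\<phi> n" for n
    by (intro tendsto_intros rad_tendsto)
  have sB: "summable (\<lambda>n. B * cmod (?\<phi> n))" by (rule summable_mult[OF s])
  have ev: "eventually (\<lambda>(n, m). norm (?a n m) \<le> B * cmod (?\<phi> n)) (at_top \<times>\<^sub>F sequentially)"
    by (rule always_eventually) (use le in blast)
  have t: "summable (\<lambda>n. norm ((c n * of_real 1 ^ n) * ?\<phi> n)) \<and>
     (\<lambda>m. \<Sum>n. ?a n m) \<longlonglongrightarrow> (\<Sum>n. (c n * of_real 1 ^ n) * ?\<phi> n)"
    using tannerys_theorem[OF lim ev sB sequentially_bot] by blast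
  have "(\<Sum>n. ?a n m) = (LINT \<theta>|circle_measure. \<phi> \<theta> * f (of_real (rad m) * cis \<theta>))" for m
    using disc_series_radial(2)[OF c rad(3) rad(2) \<phi>] by (simp add: sums_iff)
  then have "(\<lambda>m. \<Sum>n. ?a n m) \<longlonglongrightarrow> (LINT \<theta>|circle_measure. \<phi> \<theta> * X \<theta>)"
    using bounded_radial_tendsto[OF disc_series_holomorphic[OF c] B Xm X \<phi>] by (simp only:)
  then have "(\<Sum>n. (c n * of_real 1 ^ n) * ?\<phi> n) = (LINT \<theta>|circle_measure. \<phi> \<theta> * X \<theta>)"
    by (rule LIMSEQ_unique[OF conjunct2[OF t]])
  moreover have "summable (\<lambda>n. (c n * of_real 1 ^ n) * ?\<phi> n)" by (rule summable_norm_cancel[OF conjunct1[OF t]])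
  ultimately show ?thesis by (simp add: sums_iff)
qed

lemma disc_series_boundary_fourier:
  assumes c: "disc_series c f" and B: "\<And>z. cmod z < 1 \<Longrightarrow> cmod (f z) \<le> B"
    and Xm: "X \<in> borel_measurable circle_measure"
    and X: "radial_limit f X"
  shows "(LINT \<theta>|circle_measure. cis (- (real_of_int k * \<theta>)) * X \<theta>) = (if 0 \<le> k then c (nat k) else 0)"
proof -
  have "(\<lambda>n. LINT \<theta>|circle_measure. cis (- (real_of_int k * \<theta>)) * f (of_real (rad n) * cis \<theta>)) \<longlonglongrightarrow>
    (LINT \<theta>|circle_measure. cis (- (real_of_int k * \<theta>)) * X \<theta>)"
    using bounded_radial_tendsto[OF disc_series_holomorphic[OF c] B Xm X integrable_circle_cis[of "- real_of_int k"]] by simp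
  moreover have "(\<lambda>n. LINT \<theta>|circle_measure. cis (- (real_of_int k * \<theta>)) * f (of_real (rad n) * cis \<theta>)) \<longlonglongrightarrow>
    (if 0 \<le> k then c (nat k) else 0)"
  proof (cases "0 \<le> k")
    case True
    have "(\<lambda>n. c (nat k) * of_real (rad n) ^ nat k) \<longlonglongrightarrow> c (nat k) * of_real 1 ^ nat k"
      by (intro tendsto_intros rad_tendsto)
    with True show ?thesis by (simp add: disc_series_fourier[OF c rad(3) rad(2)])
  next
    case False
    then show ?thesis by (simp add: disc_series_fourier[OF c rad(3) rad(2)])
  qed
  ultimately show ?thesis by (rule LIMSEQ_unique)
qed

text \<open>On a circle of radius \<open>r < 1\<close> the Taylor polynomial \<open>q\<close> is the orthogonal projection of \<open>f\<close>, so its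
mean square is at most that of \<open>f\<close>; then \<open>r\<close> tends to 1.\<close>
lemma disc_series_bessel:
  assumes c: "disc_series c f" and B: "\<And>z. cmod z < 1 \<Longrightarrow> cmod (f z) \<le> B"
  shows "(\<Sum>n<N. (cmod (c n))\<^sup>2) \<le> B\<^sup>2"
proof -
  have hol: "f holomorphic_on ball 0 1" by (rule disc_series_holomorphic[OF c])
  define c' where "c' n = (if n < N then c n else 0)" for n
  define q where "q z = (\<Sum>n<N. c n * z ^ n)" for z
  have c': "disc_series c' q"
    unfolding disc_series_def
  proof
    fix z :: complex
    have "(\<lambda>n. c' n * z ^ n) sums (\<Sum>n<N. c' n * z ^ n)"
      by (rule sums_finite) (auto simp: c'_def)
    then show "(\<lambda>n. c' n * z ^ n) sums q z" by (simp add: q_def c'_def)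
  qed
  have bound: "(\<Sum>n<N. (cmod (c n))\<^sup>2 * (r\<^sup>2) ^ n) \<le> B\<^sup>2" if r: "0 \<le> r" "r < 1" for r
  proof -
    define S where "S = (\<Sum>n<N. (cmod (c n))\<^sup>2 * (r\<^sup>2) ^ n)"
    let ?f = "\<lambda>\<theta>. f (of_real r * cis \<theta>)" and ?q = "\<lambda>\<theta>. q (of_real r * cis \<theta>)"
    have cont: "continuous_on UNIV ?f" "continuous_on UNIV ?q"
      using continuous_on_circle[OF hol r] continuous_on_circle[OF disc_series_holomorphic[OF c'] r] by auto
    obtain Q where Q: "\<And>\<theta>. cmod (?q \<theta>) \<le> Q" using bounded_on_circle[OF disc_series_holomorphic[OF c'] r] by blast
    have fB: "cmod (?f \<theta>) \<le> B" for \<theta> using B norm_rcis_less[OF r, of \<theta>] by simp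
    have cq: "cnj (?q \<theta>) = (\<Sum>n<N. cnj (c n) * of_real r ^ n * cis (- (real_of_int (int n) * \<theta>)))" for \<theta>
    proof -
      have "cnj (cis \<theta>) ^ n = cis (- (real n * \<theta>))" for n
        unfolding cis_cnj by (subst Complex.DeMoivre) simp
      then show ?thesis by (simp add: q_def power_mult_distrib mult.assoc)
    qed
    have gen: "(LINT \<theta>|circle_measure. cnj (?q \<theta>) * F (of_real r * cis \<theta>)) = of_real S"
      if d: "disc_series d F" and eq: "\<And>n. n < N \<Longrightarrow> d n = c n" for d F
    proof -
      have i: "integrable circle_measure (\<lambda>\<theta>. cis (- (real_of_int k * \<theta>)) * F (of_real r * cis \<theta>))" for k
        using disc_series_radial(1)[OF d r integrable_circle_cis[of "- real_of_int k"]] by simp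
      have "(LINT \<theta>|circle_measure. cnj (?q \<theta>) * F (of_real r * cis \<theta>)) =
        (LINT \<theta>|circle_measure. (\<Sum>n<N. (cnj (c n) * of_real r ^ n) * (cis (- (real_of_int (int n) * \<theta>)) * F (of_real r * cis \<theta>))))"
        by (simp only: cq sum_distrib_right mult.assoc)
      also have "\<dots> = (\<Sum>n<N. (cnj (c n) * of_real r ^ n) * (LINT \<theta>|circle_measure. cis (- (real_of_int (int n) * \<theta>)) * F (of_real r * cis \<theta>)))"
        using i by (subst Bochner_Integration.integral_sum) (auto simp del: of_int_of_nat_eq)
      also have "\<dots> = (\<Sum>n<N. (cnj (c n) * of_real r ^ n) * (c n * of_real r ^ n))"
        by (intro sum.cong refl, subst disc_series_fourier[OF d r]) (simp add: eq)
      also have "\<dots> = of_real S"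
        unfolding S_def of_real_sum
        unfolding of_real_mult complex_norm_square
        by (intro sum.cong refl) (simp add: power_mult_distrib power2_eq_square mult_ac)
      finally show ?thesis .
    qed
    have Sf: "(LINT \<theta>|circle_measure. cnj (?q \<theta>) * ?f \<theta>) = of_real S" by (rule gen[OF c]) simp
    have Sq: "(LINT \<theta>|circle_measure. cnj (?q \<theta>) * ?q \<theta>) = of_real S" by (rule gen[OF c']) (simp add: c'_def)
    have Q0: "0 \<le> Q" and B0: "0 \<le> B" using order_trans[OF norm_ge_zero Q] order_trans[OF norm_ge_zero fB] by auto
    have iqf: "integrable circle_measure (\<lambda>\<theta>. cnj (?q \<theta>) * ?f \<theta>)"
      by (rule integrable_circle_continuous[where B = "Q * B"])
        (use Q fB Q0 in \<open>auto intro!: continuous_intros cont mult_mono simp: norm_mult\<close>)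
    have iqq: "integrable circle_measure (\<lambda>\<theta>. cnj (?q \<theta>) * ?q \<theta>)"
      by (rule integrable_circle_continuous[where B = "Q * Q"])
        (use Q Q0 in \<open>auto intro!: continuous_intros cont mult_mono simp: norm_mult\<close>)
    have iff: "integrable circle_measure (\<lambda>\<theta>. (cmod (?f \<theta>))\<^sup>2)"
      by (rule integrable_circle_continuous[where B = "B\<^sup>2"])
        (use fB in \<open>auto intro!: continuous_intros cont power_mono\<close>)
    have pt: "2 * Re (cnj b * a) - Re (cnj b * b) \<le> (cmod a)\<^sup>2" for a b
    proof -
      \<comment> \<open>This is \<open>0 \<le> (cmod (a - b))\<^sup>2\<close>.\<close>
      have "0 \<le> (Re a - Re b)\<^sup>2 + (Im a - Im b)\<^sup>2" by simp
      then show ?thesis by (simp add: cmod_power2 power2_diff) (simp add: power2_eq_square algebra_simps)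
    qed
    have "S = 2 * Re (LINT \<theta>|circle_measure. cnj (?q \<theta>) * ?f \<theta>) - Re (LINT \<theta>|circle_measure. cnj (?q \<theta>) * ?q \<theta>)"
      unfolding Sf Sq by simp
    also have "\<dots> = (LINT \<theta>|circle_measure. 2 * Re (cnj (?q \<theta>) * ?f \<theta>) - Re (cnj (?q \<theta>) * ?q \<theta>))"
      using integrable_Re[OF iqf] integrable_Re[OF iqq]
      by (subst Bochner_Integration.integral_diff) (auto simp: integral_Re[OF iqf] integral_Re[OF iqq] simp del: times_complex.sel)
    also have "\<dots> \<le> (LINT \<theta>|circle_measure. (cmod (?f \<theta>))\<^sup>2)"
      using integrable_Re[OF iqf] integrable_Re[OF iqq]
      by (intro integral_mono iff pt Bochner_Integration.integrable_diff integrable_mult_right)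
    also have "\<dots> \<le> (LINT \<theta>|circle_measure. B\<^sup>2)"
      by (rule integral_mono[OF iff circle.integrable_const]) (use fB in \<open>auto intro: power_mono\<close>)
    also have "\<dots> = B\<^sup>2" by (rule integral_circle_const)
    finally show ?thesis by (simp add: S_def)
  qed
  have "(\<lambda>m. \<Sum>n<N. (cmod (c n))\<^sup>2 * ((rad m)\<^sup>2) ^ n) \<longlonglongrightarrow> (\<Sum>n<N. (cmod (c n))\<^sup>2 * (1\<^sup>2) ^ n)"
    by (intro tendsto_intros rad_tendsto)
  then show ?thesis
    using LIMSEQ_le_const2[of _ "\<Sum>n<N. (cmod (c n))\<^sup>2 * (1\<^sup>2) ^ n" "B\<^sup>2"] bound rad by fastforce
qed

section \<open>The Frobenius norm and the adjoint\<close>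

text \<open>The norm on matrices is the Frobenius norm. It comes from an inner product, is equivalent to the
operator norm, and is used for all estimates.\<close>
lemma norm_vector_smult: "norm (c *s (x :: complex^'n)) = cmod c * norm x"
  by (simp add: norm_vec_def norm_mult L2_set_right_distrib[symmetric])

lemma norm_matrix_mult_le: "norm (A ** B) \<le> norm A * norm (B :: complex^'k^'n)" for A :: "complex^'n^'m"
proof -
  have row: "norm ((A ** B) $ i) \<le> norm (A $ i) * norm B" for i
  proof -
    have "(A ** B) $ i = (\<Sum>k\<in>UNIV. (A $ i $ k) *s (B $ k))"
      by (simp add: vec_eq_iff matrix_matrix_mult_def)
    then have "norm ((A ** B) $ i) \<le> (\<Sum>k\<in>UNIV. \<bar>cmod (A $ i $ k)\<bar> * \<bar>norm (B $ k)\<bar>)"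
      by (auto intro!: sum_norm_le simp: norm_vector_smult)
    also have "\<dots> \<le> L2_set (\<lambda>k. cmod (A $ i $ k)) UNIV * L2_set (\<lambda>k. norm (B $ k)) UNIV"
      by (rule L2_set_mult_ineq)
    finally show ?thesis by (simp add: norm_vec_def)
  qed
  have "norm (A ** B) \<le> L2_set (\<lambda>i. norm (A $ i) * norm B) UNIV"
    unfolding norm_vec_def[of "A ** B"] by (intro L2_set_mono row) auto
  also have "\<dots> = norm A * norm B" by (simp add: norm_vec_def[of A] L2_set_left_distrib)
  finally show ?thesis .
qed

lemma norm_matrix_vector_le: "norm (A *v x) \<le> norm A * norm x" for A :: "complex^'n^'m"
proof -
  have row: "cmod ((A *v x) $ i) \<le> norm (A $ i) * norm x" for i
  proof -
    have "cmod ((A *v x) $ i) \<le> (\<Sum>k\<in>UNIV. \<bar>cmod (A $ i $ k)\<bar> * \<bar>cmod (x $ k)\<bar>)"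
      by (auto intro!: sum_norm_le simp: norm_mult matrix_vector_mult_def)
    also have "\<dots> \<le> L2_set (\<lambda>k. cmod (A $ i $ k)) UNIV * L2_set (\<lambda>k. cmod (x $ k)) UNIV"
      by (rule L2_set_mult_ineq)
    finally show ?thesis by (simp add: norm_vec_def)
  qed
  have "norm (A *v x) \<le> L2_set (\<lambda>i. norm (A $ i) * norm x) UNIV"
    unfolding norm_vec_def[of "A *v x"] by (intro L2_set_mono row) auto
  also have "\<dots> = norm A * norm x" by (simp add: norm_vec_def[of A] L2_set_left_distrib)
  finally show ?thesis .
qed

lemma bounded_bilinear_matrix_mult:
  "bounded_bilinear ((**) :: complex^'n^'m \<Rightarrow> complex^'k^'n \<Rightarrow> complex^'k^'m)"
proof
  show "\<exists>K. \<forall>A B. norm ((A :: complex^'n^'m) ** (B :: complex^'k^'n)) \<le> norm A * norm B * K"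
    by (intro exI[of _ 1] allI) (simp add: norm_matrix_mult_le)
qed (auto simp: vec_eq_iff matrix_matrix_mult_def algebra_simps sum.distrib scaleR_sum_right)

lemma bounded_bilinear_matrix_vector_mult:
  "bounded_bilinear ((*v) :: complex^'n^'m \<Rightarrow> complex^'n \<Rightarrow> complex^'m)"
proof
  show "\<exists>K. \<forall>A x. norm ((A :: complex^'n^'m) *v x) \<le> norm A * norm x * K"
    by (intro exI[of _ 1] allI) (simp add: norm_matrix_vector_le)
qed (auto simp: vec_eq_iff matrix_vector_mult_def algebra_simps sum.distrib scaleR_sum_right)

interpretation mm: bounded_bilinear "(**) :: complex^'n^'m \<Rightarrow> complex^'k^'n \<Rightarrow> complex^'k^'m"
  by (rule bounded_bilinear_matrix_mult)

interpretation mv: bounded_bilinear "(*v) :: complex^'n^'m \<Rightarrow> complex^'n \<Rightarrow> complex^'m"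
  by (rule bounded_bilinear_matrix_vector_mult)

lemma norm_component_le: "cmod (A $ i $ j) \<le> norm (A :: complex^'n^'m)"
  by (rule order_trans[OF Finite_Cartesian_Product.norm_nth_le Finite_Cartesian_Product.norm_nth_le])

lemma opnorm_le_norm: "opnorm A \<le> norm A"
  unfolding opnorm_def by (intro onorm_le norm_matrix_vector_le)

lemma opnorm_nonneg: "0 \<le> opnorm A"
  unfolding opnorm_def by (intro onorm_pos_le) simp

lemma norm_le_sum_entries: "norm A \<le> (\<Sum>i\<in>UNIV. \<Sum>j\<in>UNIV. cmod (A $ i $ j))" for A :: "complex^'n^'m"
proof -
  have "norm A \<le> (\<Sum>i\<in>UNIV. norm (A $ i))" unfolding norm_vec_def by (rule L2_set_le_sum) simp
  also have "\<dots> \<le> (\<Sum>i\<in>UNIV. \<Sum>j\<in>UNIV. cmod (A $ i $ j))"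
    unfolding norm_vec_def by (intro sum_mono L2_set_le_sum) simp
  finally show ?thesis .
qed

lemma norm_le_opnorm: "norm (A :: complex^'n^'m) \<le> real (CARD('m) * CARD('n)) * opnorm A"
proof -
  have ax: "A *v axis j 1 = column j A" for j
    by (simp add: vec_eq_iff matrix_vector_mult_def column_def axis_def if_distrib cong: if_cong)
  have c: "cmod (A $ i $ j) \<le> opnorm A" for i j
  proof -
    have "cmod (A $ i $ j) = cmod (column j A $ i)" by (simp add: column_def)
    also have "\<dots> \<le> norm (column j A)" by (rule Finite_Cartesian_Product.norm_nth_le)
    also have "\<dots> \<le> opnorm A" unfolding opnorm_def
      using onorm[OF matrix_vector_mul_bounded_linear, of A "axis j 1"] by (simp add: ax)
    finally show ?thesis .
  qed
  have "norm A \<le> (\<Sum>i\<in>UNIV. \<Sum>j\<in>UNIV. cmod (A $ i $ j))" by (rule norm_le_sum_entries)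
  also have "\<dots> \<le> (\<Sum>i\<in>(UNIV::'m set). \<Sum>j\<in>(UNIV::'n set). opnorm A)" by (intro sum_mono c)
  finally show ?thesis by simp
qed

lemma hconj_component [simp]: "hconj A $ i $ j = cnj (A $ j $ i)"
  by (simp add: hconj_def)

lemma hconj_hconj [simp]: "hconj (hconj A) = A"
  by (simp add: vec_eq_iff)

lemma hconj_mult: "hconj (A ** B) = hconj B ** hconj A"
  by (simp add: vec_eq_iff matrix_matrix_mult_def mult.commute)

lemma hconj_mat [simp]: "hconj (mat 1) = mat 1"
  by (auto simp: vec_eq_iff mat_def)

lemma norm_hconj [simp]: "norm (hconj A) = norm A"
proof -
  have "(\<Sum>i\<in>UNIV. \<Sum>j\<in>UNIV. (cmod (A $ j $ i))\<^sup>2) = (\<Sum>i\<in>UNIV. \<Sum>j\<in>UNIV. (cmod (A $ i $ j))\<^sup>2)"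
    by (rule sum.swap)
  then show ?thesis by (simp add: norm_vec_def L2_set_def sum_nonneg)
qed

lemma bounded_linear_hconj: "bounded_linear (hconj :: complex^'n^'m \<Rightarrow> _)"
  by (rule bounded_linear_intro[where K = 1]) (auto simp: vec_eq_iff)

lemma det_hconj: "det (hconj A) = cnj (det A)"
proof -
  have "hconj A = transpose (\<chi> i j. cnj (A $ i $ j))" by (simp add: vec_eq_iff transpose_def)
  then have "det (hconj A) = det (\<chi> i j. cnj (A $ i $ j))" by (simp add: det_transpose)
  also have "\<dots> = cnj (det A)" by (simp add: det_def)
  finally show ?thesis .
qed

lemma inner_hconj: "x \<bullet> (A *v y) = (hconj A *v x) \<bullet> y"
proof -
  have "x \<bullet> (A *v y) = (\<Sum>i\<in>UNIV. \<Sum>j\<in>UNIV. x $ i \<bullet> (A $ i $ j * y $ j))"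
    by (simp add: inner_vec_def matrix_vector_mult_def inner_sum_right)
  also have "\<dots> = (\<Sum>i\<in>UNIV. \<Sum>j\<in>UNIV. (cnj (A $ i $ j) * x $ i) \<bullet> y $ j)"
    by (simp add: inner_complex_def algebra_simps)
  also have "\<dots> = (\<Sum>j\<in>UNIV. \<Sum>i\<in>UNIV. (cnj (A $ i $ j) * x $ i) \<bullet> y $ j)" by (rule sum.swap)
  also have "\<dots> = (hconj A *v x) \<bullet> y"
    by (simp add: inner_vec_def matrix_vector_mult_def inner_sum_left)
  finally show ?thesis .
qed

lemma inner_eq_Re: "x \<bullet> y = Re (\<Sum>i\<in>UNIV. cnj (x $ i) * y $ i)" for x y :: "complex^'n"
  by (simp add: inner_vec_def inner_complex_def Re_sum)

section \<open>Lower bounds for positive matrices\<close>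

text \<open>The least eigenvalue of a positive matrix equals its least singular value. Concretely, the
form of \<open>W\<close> is nonnegative at \<open>x - \<kappa> *\<^sub>R y\<close> with \<open>W *v y = x\<close>, which expands to
\<open>x \<bullet> (W *v x) \<ge> 2 * \<kappa> * (norm x)\<^sup>2 - \<kappa>\<^sup>2 * (y \<bullet> x)\<close>, and \<open>norm y \<le> norm x / \<kappa>\<close>.\<close>
lemma pos_hermitian_coercive:
  fixes W :: "complex^'d^'d"
  assumes W: "pos_hermitian W" and \<kappa>: "0 < \<kappa>" and low: "\<And>x. \<kappa> * norm x \<le> norm (W *v x)"
  shows "\<kappa> * (norm x)\<^sup>2 \<le> x \<bullet> (W *v x)"
proof -
  have sa: "v \<bullet> (W *v y) = (W *v v) \<bullet> y" for v y
    using W inner_hconj[of v W y] by (simp add: pos_hermitian_def)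
  have pos: "0 \<le> v \<bullet> (W *v v)" for v
    using W by (cases "v = 0") (auto simp: pos_hermitian_def inner_eq_Re intro: less_imp_le)
  have "inj ((*v) W)"
  proof (rule injI)
    fix a b assume "W *v a = W *v b"
    then have "\<kappa> * norm (a - b) \<le> 0" using low[of "a - b"] by (simp add: matrix_vector_mult_diff_distrib)
    then show "a = b" using \<kappa> by (simp add: mult_le_0_iff)
  qed
  then obtain B where "B ** W = mat 1" using matrix_left_invertible_injective by blast
  then have WB: "W ** B = mat 1" by (rule matrix_left_right_inverse1)
  define y where "y = B *v x"
  have Wy: "W *v y = x" by (simp add: y_def matrix_vector_mul_assoc WB)
  have "\<kappa> * norm y \<le> norm x" using low[of y] Wy by simp
  then have "\<kappa> * (y \<bullet> x) \<le> norm x * norm x"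
    using norm_cauchy_schwarz[of y x] \<kappa>
    by (smt (verit, best) mult.assoc mult_left_mono mult_right_mono norm_ge_zero)
  then have yx: "\<kappa> * (\<kappa> * (y \<bullet> x)) \<le> \<kappa> * (x \<bullet> x)"
    using \<kappa> by (simp add: power2_norm_eq_inner[symmetric] power2_eq_square)
  have "0 \<le> (x - \<kappa> *\<^sub>R y) \<bullet> (W *v (x - \<kappa> *\<^sub>R y))" by (rule pos)
  also have "W *v (x - \<kappa> *\<^sub>R y) = W *v x - \<kappa> *\<^sub>R x"
    using Wy by (simp add: matrix_vector_mult_diff_distrib mv.scaleR_right)
  also have "(x - \<kappa> *\<^sub>R y) \<bullet> (W *v x - \<kappa> *\<^sub>R x) = x \<bullet> (W *v x) - 2 * \<kappa> * (x \<bullet> x) + \<kappa> * (\<kappa> * (y \<bullet> x))"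
    using sa[of y x] Wy by (simp add: inner_diff_left inner_diff_right algebra_simps)
  finally show ?thesis using yx by (simp add: power2_norm_eq_inner)
qed

lemma inner_matrix_columns: "A \<bullet> B = (\<Sum>j\<in>UNIV. column j A \<bullet> column j B)" for A B :: "complex^'n^'m"
  unfolding inner_vec_def column_def by (simp) (rule sum.swap)

lemma column_matrix_mult: "column j (A ** B) = A *v column j B"
  by (simp add: vec_eq_iff column_def matrix_matrix_mult_def matrix_vector_mult_def)

lemma pos_hermitian_coercive_matrix:
  fixes W :: "complex^'d^'d"
  assumes "pos_hermitian W" "0 < \<kappa>" "\<And>x. \<kappa> * norm x \<le> norm (W *v x)"
  shows "\<kappa> * (norm U)\<^sup>2 \<le> U \<bullet> (W ** (U :: complex^'d^'d))"
proof -
  have "\<kappa> * (norm U)\<^sup>2 = (\<Sum>j\<in>UNIV. \<kappa> * (norm (column j U))\<^sup>2)"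
    unfolding power2_norm_eq_inner inner_matrix_columns[of U U] by (simp add: sum_distrib_left)
  also have "\<dots> \<le> (\<Sum>j\<in>UNIV. column j U \<bullet> (W *v column j U))"
    by (intro sum_mono pos_hermitian_coercive assms)
  also have "\<dots> = U \<bullet> (W ** U)" unfolding inner_matrix_columns by (simp add: column_matrix_mult)
  finally show ?thesis .
qed

lemma tendsto_det:
  fixes A :: "_ \<Rightarrow> complex^'n^'n"
  assumes "\<And>i j. ((\<lambda>x. A x $ i $ j) \<longlongrightarrow> B $ i $ j) F"
  shows "((\<lambda>x. det (A x :: complex^'n^'n)) \<longlongrightarrow> det B) F"
  unfolding det_def by (intro tendsto_intros assms)

text \<open>A positive continuous function on the compact product of the two unit spheres has a positive minimum.\<close>
lemma uniform_injectivity: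
  fixes w :: "complex \<Rightarrow> complex^'d^'d"
  assumes w: "continuous_on (sphere 0 1) w" and det: "\<And>\<zeta>. \<zeta> \<in> sphere 0 1 \<Longrightarrow> det (w \<zeta>) \<noteq> 0"
  obtains \<kappa> where "0 < \<kappa>" "\<And>\<zeta> x. \<zeta> \<in> sphere 0 1 \<Longrightarrow> \<kappa> * norm x \<le> norm (w \<zeta> *v x)"
proof -
  let ?K = "sphere (0::complex) 1 \<times> sphere (0::complex^'d) 1"
  let ?f = "\<lambda>p. norm (w (fst p) *v snd p)"
  have e: "norm (axis undefined 1 :: complex^'d) = 1" by simp
  have c: "continuous_on ?K ?f"
    by (intro continuous_intros bounded_bilinear.continuous_on[OF bounded_bilinear_matrix_vector_mult]
        continuous_on_compose2[OF w]) auto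
  have "?K \<noteq> {}" using e by (auto simp: ex_in_conv[symmetric] intro: exI[of _ 1] exI[of _ "axis undefined 1 :: complex^'d"])
  then obtain p where p: "p \<in> ?K" "\<And>q. q \<in> ?K \<Longrightarrow> ?f p \<le> ?f q"
    using continuous_attains_inf[OF compact_Times[OF compact_sphere compact_sphere] _ c] by blast
  have "?f p \<noteq> 0"
  proof
    assume "?f p = 0"
    then have z: "w (fst p) *v snd p = 0" by simp
    have "invertible (w (fst p))" using det p(1) by (auto simp: invertible_det_nz)
    then obtain B where "B ** w (fst p) = mat 1" by (auto simp: invertible_def)
    then have "snd p = B *v (w (fst p) *v snd p)" by (simp add: matrix_vector_mul_assoc)
    with z have "snd p = 0" by simp
    with p(1) show False by auto
  qed
  then have pos: "0 < ?f p" by simp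
  show ?thesis
  proof (rule that[OF pos])
    fix \<zeta> :: complex and x :: "complex^'d" assume \<zeta>: "\<zeta> \<in> sphere 0 1"
    show "?f p * norm x \<le> norm (w \<zeta> *v x)"
    proof (cases "x = 0")
      case False
      then have "(\<zeta>, (1 / norm x) *\<^sub>R x) \<in> ?K" using \<zeta> by simp
      from p(2)[OF this] have "?f p \<le> norm (w \<zeta> *v x) / norm x"
        by (simp add: mv.scaleR_right)
      with False show ?thesis by (simp add: field_simps)
    qed simp
  qed
qed

section \<open>Finite block Toeplitz systems\<close>

text \<open>An injective linear map of a finite-dimensional space into itself is onto. The space consists of the
functions supported in \<open>I\<close>; its dimension varies with \<open>I\<close>, so it is treated as a subspace of a
function space and not as a type of its own.\<close>
lemma finite_system_solvable:
  fixes A :: "int \<Rightarrow> int \<Rightarrow> 'v::euclidean_space \<Rightarrow> 'v"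
  assumes I: "finite I" and lin: "\<And>s t. linear (A s t)"
    and inj: "\<And>u. \<forall>s\<in>I. (\<Sum>t\<in>I. A s t (u t)) = 0 \<Longrightarrow> \<forall>s\<in>I. u s = 0"
  obtains u where "\<And>s. s \<in> I \<Longrightarrow> (\<Sum>t\<in>I. A s t (u t)) = f s"
proof -
  define sc where "sc = (\<lambda>(c::real) (u::int \<Rightarrow> 'v) i. c *\<^sub>R u i)"
  interpret fs: vector_space sc
    by unfold_locales (auto simp: sc_def fun_eq_iff algebra_simps)
  define F where "F u = (\<lambda>s. if s \<in> I then \<Sum>t\<in>I. A s t (u t) else 0)" for u
  interpret F: Vector_Spaces.linear sc sc F
    by unfold_locales
      (auto simp: F_def sc_def fun_eq_iff linear_add[OF lin] linear_scale[OF lin] sum.distrib scaleR_sum_right)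
  define V where "V = {u :: int \<Rightarrow> 'v. \<forall>s. s \<notin> I \<longrightarrow> u s = 0}"
  have subV: "fs.subspace V" unfolding fs.subspace_def V_def by (auto simp: sc_def)
  define S where "S = (\<lambda>(k, b). (\<lambda>i. if i = k then b else (0::'v))) ` (I \<times> (Basis :: 'v set))"
  have finS: "finite S" using I by (simp add: S_def)
  have VS: "V \<subseteq> fs.span S"
  proof
    fix u assume u: "u \<in> V"
    have "u = (\<Sum>k\<in>I. \<Sum>b\<in>Basis. sc (u k \<bullet> b) (\<lambda>i. if i = k then b else 0))"
    proof
      fix i
      have app: "(\<Sum>x\<in>X. h x) i = (\<Sum>x\<in>X. h x i)" for X and h :: "_ \<Rightarrow> int \<Rightarrow> 'v"
        by (induction X rule: infinite_finite_induct) auto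
      have "(\<Sum>k\<in>I. \<Sum>b\<in>Basis. sc (u k \<bullet> b) (\<lambda>i. if i = k then b else 0)) i =
         (\<Sum>k\<in>I. \<Sum>b\<in>Basis. if i = k then (u k \<bullet> b) *\<^sub>R b else 0)"
        unfolding app sc_def by (intro sum.cong refl) auto
      also have "\<dots> = (\<Sum>k\<in>I. if i = k then u k else 0)"
        by (intro sum.cong refl) (auto simp: euclidean_representation)
      also have "\<dots> = u i" using u I by (auto simp: V_def)
      finally show "u i = (\<Sum>k\<in>I. \<Sum>b\<in>Basis. sc (u k \<bullet> b) (\<lambda>i. if i = k then b else 0)) i" by simp
    qed
    also have "\<dots> \<in> fs.span S"
      by (intro fs.span_sum fs.span_scale fs.span_base) (auto simp: S_def)
    finally show "u \<in> fs.span S" .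
  qed
  obtain B where B: "B \<subseteq> V" "fs.independent B" "V \<subseteq> fs.span B"
    by (rule fs.maximal_independent_subset)
  have finB: "finite B" using fs.independent_span_bound[OF finS B(2)] B(1) VS by blast
  have spanB: "fs.span B \<subseteq> V" by (rule fs.span_minimal[OF B(1) subV])
  have FV: "F u \<in> V" for u by (simp add: F_def V_def)
  have injV: "inj_on F (fs.span B)"
  proof (rule inj_onI)
    fix u v assume uv: "u \<in> fs.span B" "v \<in> fs.span B" "F u = F v"
    have z: "(\<Sum>t\<in>I. A s t (u t - v t)) = 0" if "s \<in> I" for s
      using fun_cong[OF uv(3), of s] that by (simp add: F_def linear_diff[OF lin] sum_subtractf)
    have "\<forall>s\<in>I. u s - v s = 0" by (rule inj) (use z in simp)
    moreover have "u s = 0" "v s = 0" if "s \<notin> I" for s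
      using uv(1,2) spanB that by (auto simp: V_def)
    ultimately show "u = v" by (intro ext) (metis eq_iff_diff_eq_0)
  qed
  have indF: "fs.independent (F ` B)" by (rule F.independent_injective_image[OF B(2) injV])
  have cardF: "card (F ` B) = card B"
    by (rule card_image[OF inj_on_subset[OF injV fs.span_superset]])
  have "y \<in> fs.span (F ` B)" if y: "y \<in> V" for y
  proof (rule ccontr)
    assume n: "y \<notin> fs.span (F ` B)"
    have "fs.independent (insert y (F ` B))" by (rule fs.independent_insertI[OF n indF])
    moreover have "insert y (F ` B) \<subseteq> fs.span B" using y FV B(3) by auto
    ultimately have "card (insert y (F ` B)) \<le> card B" using fs.independent_span_bound[OF finB] by blast
    moreover have "y \<notin> F ` B" using n fs.span_superset by blast
    ultimately show False using finB cardF by simp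
  qed
  moreover have "(\<lambda>s. if s \<in> I then f s else 0) \<in> V" by (simp add: V_def)
  ultimately have "(\<lambda>s. if s \<in> I then f s else 0) \<in> F ` fs.span B" by (simp only: F.span_image[symmetric])
  then obtain u where u: "(\<lambda>s. if s \<in> I then f s else 0) = F u" by blast
  show ?thesis
  proof (rule that[of u])
    fix s assume "s \<in> I"
    with fun_cong[OF u, of s] show "(\<Sum>t\<in>I. A s t (u t)) = f s" by (simp add: F_def)
  qed
qed

definition csmult :: "complex \<Rightarrow> complex^'n^'m \<Rightarrow> complex^'n^'m" where
  "csmult c A = (\<chi> i j. c * A $ i $ j)"

lemma inner_matrix_mult_expand:
  fixes A :: "complex^'n^'m" and G :: "complex^'k^'m"
  shows "A \<bullet> (G ** B) = (\<Sum>i\<in>UNIV. \<Sum>j\<in>UNIV. \<Sum>k\<in>UNIV. A $ i $ j \<bullet> (G $ i $ k * B $ k $ j))"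
  by (simp add: inner_vec_def matrix_matrix_mult_def inner_sum_right)

lemma inner_csmult:
  fixes A :: "complex^'n^'m" and V :: "complex^'k^'m"
  shows "csmult c A \<bullet> (V ** csmult d B) = A \<bullet> (csmult (cnj c * d) V ** B)"
proof -
  have "(c * a) \<bullet> (v * (d * b)) = a \<bullet> ((cnj c * d * v) * b)" for a b v :: complex
    by (simp add: inner_complex_def algebra_simps)
  then show ?thesis unfolding inner_matrix_mult_expand by (simp add: csmult_def)
qed

lemma integrable_fourier_integrand:
  assumes "L1_mat V"
  shows "integrable circle_measure (\<lambda>\<theta>. cis (- (real_of_int k * \<theta>)) * V (cis \<theta>) $ i $ j)"
proof -
  have "integrable circle_measure (\<lambda>\<theta>. V (cis \<theta>) $ i $ j * cis (- (real_of_int k * \<theta>)))"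
    by (rule integrable_circle_bounded_mult[where B = 1])
      (use assms in \<open>auto simp: L1_mat_def intro!: measurable_circle_continuous continuous_intros\<close>)
  then show ?thesis by (simp add: mult.commute)
qed

lemma inner_fourier_coeff:
  fixes V :: "complex \<Rightarrow> complex^'d^'d"
  assumes V: "L1_mat V"
  shows "integrable circle_measure (\<lambda>\<theta>. A \<bullet> (csmult (cis (- (real_of_int k * \<theta>))) (V (cis \<theta>)) ** B))"
    and "(LINT \<theta>|circle_measure. A \<bullet> (csmult (cis (- (real_of_int k * \<theta>))) (V (cis \<theta>)) ** B)) =
         A \<bullet> (fourier_coeff V k ** B)"
proof -
  let ?e = "\<lambda>\<theta>. cis (- (real_of_int k * \<theta>))"
  note i = integrable_fourier_integrand[OF V, of k]
  have i2: "integrable circle_measure (\<lambda>\<theta>. A $ i $ j \<bullet> (?e \<theta> * V (cis \<theta>) $ i $ l * B $ l $ j))" for i j l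
    using i by (intro integrable_inner_right integrable_mult_left) auto
  show "integrable circle_measure (\<lambda>\<theta>. A \<bullet> (csmult (?e \<theta>) (V (cis \<theta>)) ** B))"
    unfolding inner_matrix_mult_expand csmult_def by (simp add: i2)
  show "(LINT \<theta>|circle_measure. A \<bullet> (csmult (?e \<theta>) (V (cis \<theta>)) ** B)) = A \<bullet> (fourier_coeff V k ** B)"
    unfolding inner_matrix_mult_expand csmult_def fourier_coeff_def
    using i by (simp add: i2 Bochner_Integration.integral_sum integral_inner_right)
qed

text \<open>The quadratic form of a Toeplitz matrix is the average over the circle of the form of its symbol,
evaluated at the trigonometric polynomial with coefficients \<open>u\<close>.\<close>
lemma toeplitz_form_integral:
  fixes V :: "complex \<Rightarrow> complex^'d^'d" and u :: "int \<Rightarrow> complex^'d^'d" and I :: "int set"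
  assumes V: "L1_mat V"
  defines "U \<equiv> \<lambda>\<theta>. \<Sum>s\<in>I. csmult (cis (real_of_int s * \<theta>)) (u s)"
  shows "integrable circle_measure (\<lambda>\<theta>. U \<theta> \<bullet> (V (cis \<theta>) ** U \<theta>))"
    and "(LINT \<theta>|circle_measure. U \<theta> \<bullet> (V (cis \<theta>) ** U \<theta>)) =
         (\<Sum>s\<in>I. u s \<bullet> (\<Sum>t\<in>I. fourier_coeff V (s - t) ** u t))"
proof -
  have e: "U \<theta> \<bullet> (V (cis \<theta>) ** U \<theta>) =
    (\<Sum>s\<in>I. \<Sum>t\<in>I. u s \<bullet> (csmult (cis (- (real_of_int (s - t) * \<theta>))) (V (cis \<theta>)) ** u t))" for \<theta>
  proof -
    have "cnj (cis (real_of_int s * \<theta>)) * cis (real_of_int t * \<theta>) = cis (- (real_of_int (s - t) * \<theta>))" for s t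
      by (simp add: cis_cnj cis_mult algebra_simps)
    then show ?thesis
      by (simp add: U_def mm.sum_right inner_sum_left inner_sum_right inner_csmult) (rule sum.swap)
  qed
  show "integrable circle_measure (\<lambda>\<theta>. U \<theta> \<bullet> (V (cis \<theta>) ** U \<theta>))"
    unfolding e by (intro Bochner_Integration.integrable_sum inner_fourier_coeff(1)[OF V])
  show "(LINT \<theta>|circle_measure. U \<theta> \<bullet> (V (cis \<theta>) ** U \<theta>)) =
         (\<Sum>s\<in>I. u s \<bullet> (\<Sum>t\<in>I. fourier_coeff V (s - t) ** u t))"
    unfolding e inner_sum_right
    by (subst Bochner_Integration.integral_sum,
        intro Bochner_Integration.integrable_sum inner_fourier_coeff(1)[OF V],
        rule sum.cong[OF refl], subst Bochner_Integration.integral_sum,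
        rule inner_fourier_coeff(1)[OF V], rule sum.cong[OF refl inner_fourier_coeff(2)[OF V]])
qed

lemma L1_mat_one: "L1_mat (\<lambda>_. mat 1)"
  by (simp add: L1_mat_def)

lemma fourier_coeff_one: "fourier_coeff (\<lambda>_. mat 1) k = (if k = 0 then mat 1 else 0)"
  using integral_circle_cis[of "- k"] by (auto simp: fourier_coeff_def vec_eq_iff)

abbreviation symbol_bound :: "(complex \<Rightarrow> complex^'d^'d) \<Rightarrow> real \<Rightarrow> bool" where
  "symbol_bound w \<kappa> \<equiv>
     (AE \<theta> in circle_measure. \<forall>U :: complex^'d^'d. \<kappa> * (norm U)\<^sup>2 \<le> U \<bullet> (w (cis \<theta>) ** U))"

text \<open>The form of \<open>w\<close> is compared pointwise with \<open>\<kappa>\<close> times that of the constant symbol \<open>mat 1\<close>, whose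
Toeplitz matrix is the identity.\<close>
lemma toeplitz_coercive:
  fixes w :: "complex \<Rightarrow> complex^'d^'d" and u :: "int \<Rightarrow> complex^'d^'d"
  assumes w: "L1_mat w" and I: "finite I"
    and low: "symbol_bound w \<kappa>"
  shows "\<kappa> * (\<Sum>s\<in>I. (norm (u s))\<^sup>2) \<le> (\<Sum>s\<in>I. u s \<bullet> (\<Sum>t\<in>I. fourier_coeff w (s - t) ** u t))"
proof -
  define U where "U \<theta> = (\<Sum>s\<in>I. csmult (cis (real_of_int s * \<theta>)) (u s))" for \<theta>
  note form = toeplitz_form_integral[of _ u I, folded U_def]
  have "(\<Sum>s\<in>I. u s \<bullet> (\<Sum>t\<in>I. fourier_coeff (\<lambda>_. mat 1) (s - t) ** u t)) = (\<Sum>s\<in>I. (norm (u s))\<^sup>2)"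
  proof (rule sum.cong[OF refl])
    fix s assume s: "s \<in> I"
    have "(\<Sum>t\<in>I. fourier_coeff (\<lambda>_. mat 1) (s - t) ** u t) = (\<Sum>t\<in>I. if s = t then u t else 0)"
      by (rule sum.cong) (auto simp: fourier_coeff_one mm.zero_left)
    also have "\<dots> = u s" using s I by simp
    finally show "u s \<bullet> (\<Sum>t\<in>I. fourier_coeff (\<lambda>_. mat 1) (s - t) ** u t) = (norm (u s))\<^sup>2"
      by (simp add: power2_norm_eq_inner)
  qed
  then have "\<kappa> * (\<Sum>s\<in>I. (norm (u s))\<^sup>2) = (LINT \<theta>|circle_measure. \<kappa> * (norm (U \<theta>))\<^sup>2)"
    using form(2)[OF L1_mat_one] by (simp add: power2_norm_eq_inner)
  also have "\<dots> \<le> (LINT \<theta>|circle_measure. U \<theta> \<bullet> (w (cis \<theta>) ** U \<theta>))"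
  proof (rule integral_mono_AE)
    show "integrable circle_measure (\<lambda>\<theta>. \<kappa> * (norm (U \<theta>))\<^sup>2)"
      using form(1)[OF L1_mat_one] by (simp add: power2_norm_eq_inner)
    show "AE \<theta> in circle_measure. \<kappa> * (norm (U \<theta>))\<^sup>2 \<le> U \<theta> \<bullet> (w (cis \<theta>) ** U \<theta>)"
      using low by eventually_elim blast
  qed (rule form(1)[OF w])
  also have "\<dots> = (\<Sum>s\<in>I. u s \<bullet> (\<Sum>t\<in>I. fourier_coeff w (s - t) ** u t))" by (rule form(2)[OF w])
  finally show ?thesis .
qed

lemma toeplitz_l2_lower_bound:
  fixes w :: "complex \<Rightarrow> complex^'d^'d" and u :: "int \<Rightarrow> complex^'d^'d"
  assumes "L1_mat w" "finite I"
    and "symbol_bound w \<kappa>"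
  shows "\<kappa> * L2_set (\<lambda>s. norm (u s)) I \<le> L2_set (\<lambda>s. norm (\<Sum>t\<in>I. fourier_coeff w (s - t) ** u t)) I"
proof -
  let ?u = "L2_set (\<lambda>s. norm (u s)) I"
  let ?T = "\<lambda>s. \<Sum>t\<in>I. fourier_coeff w (s - t) ** u t"
  have "\<kappa> * ?u * ?u = \<kappa> * (\<Sum>s\<in>I. (norm (u s))\<^sup>2)"
    by (simp add: L2_set_def sum_nonneg mult.assoc)
  also have "\<dots> \<le> (\<Sum>s\<in>I. u s \<bullet> ?T s)" by (rule toeplitz_coercive[OF assms])
  also have "\<dots> \<le> (\<Sum>s\<in>I. \<bar>norm (u s)\<bar> * \<bar>norm (?T s)\<bar>)"
    by (intro sum_mono) (simp add: norm_cauchy_schwarz)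
  also have "\<dots> \<le> ?u * L2_set (\<lambda>s. norm (?T s)) I" by (rule L2_set_mult_ineq)
  finally have "?u * (\<kappa> * ?u) \<le> ?u * L2_set (\<lambda>s. norm (?T s)) I" by (simp add: mult_ac)
  then show ?thesis by (cases "?u = 0") (auto simp: mult_le_cancel_left less_le)
qed

lemma toeplitz_l1_stability:
  fixes w :: "complex \<Rightarrow> complex^'d^'d"
  assumes w: "L1_mat w" and s: "(\<lambda>k. norm (fourier_coeff w k)) summable_on UNIV" and \<kappa>: "0 < \<kappa>"
    and low: "symbol_bound w \<kappa>"
  obtains C where "0 \<le> C" "\<And>I (u :: int \<Rightarrow> complex^'d^'d). finite I \<Longrightarrow>
     (\<Sum>s\<in>I. norm (u s)) \<le> C * (\<Sum>s\<in>I. norm (\<Sum>t\<in>I. fourier_coeff w (s - t) ** u t))"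
proof (rule l1_stability[OF norm_ge_zero s \<kappa>, where 'v = "complex^'d^'d"])
  fix C
  assume C0: "0 \<le> C" and C: "\<And>(A :: int \<Rightarrow> int \<Rightarrow> complex^'d^'d \<Rightarrow> complex^'d^'d) I u.
      \<lbrakk>finite I; \<And>s t. linear (A s t); \<And>s t x. norm (A s t x) \<le> norm (fourier_coeff w (s - t)) * norm x;
       \<And>v. \<kappa> * L2_set (\<lambda>s. norm (v s)) I \<le> L2_set (\<lambda>s. norm (\<Sum>t\<in>I. A s t (v t))) I\<rbrakk>
      \<Longrightarrow> (\<Sum>s\<in>I. norm (u s)) \<le> C * (\<Sum>s\<in>I. norm (\<Sum>t\<in>I. A s t (u t)))"
  show ?thesis
  proof (rule that[OF C0])
    fix I :: "int set" and u :: "int \<Rightarrow> complex^'d^'d" assume I: "finite I"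
    show "(\<Sum>s\<in>I. norm (u s)) \<le> C * (\<Sum>s\<in>I. norm (\<Sum>t\<in>I. fourier_coeff w (s - t) ** u t))"
      by (rule C[OF I, where A = "\<lambda>s t x. fourier_coeff w (s - t) ** x"])
        (auto intro: norm_matrix_mult_le toeplitz_l2_lower_bound[OF w I low] bounded_linear.linear[OF mm.bounded_linear_right])
  qed
qed

lemma toeplitz_solvable:
  fixes w :: "complex \<Rightarrow> complex^'d^'d" and f :: "int \<Rightarrow> complex^'d^'d"
  assumes w: "L1_mat w" and I: "finite I" and \<kappa>: "0 < \<kappa>"
    and low: "symbol_bound w \<kappa>"
  obtains u where "\<And>s. s \<in> I \<Longrightarrow> (\<Sum>t\<in>I. fourier_coeff w (s - t) ** u t) = f s"
proof (rule finite_system_solvable[OF I, of "\<lambda>s t x. fourier_coeff w (s - t) ** x" f])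
  show "linear (\<lambda>x :: complex^'d^'d. fourier_coeff w (s - t) ** x)" for s t
    by (rule bounded_linear.linear[OF mm.bounded_linear_right])
  fix u :: "int \<Rightarrow> complex^'d^'d"
  assume z: "\<forall>s\<in>I. (\<Sum>t\<in>I. fourier_coeff w (s - t) ** u t) = 0"
  have "\<kappa> * L2_set (\<lambda>s. norm (u s)) I \<le> L2_set (\<lambda>s. norm (\<Sum>t\<in>I. fourier_coeff w (s - t) ** u t)) I"
    by (rule toeplitz_l2_lower_bound[OF w I low])
  also have "\<dots> = 0" using z by (intro L2_set_0') auto
  finally have "L2_set (\<lambda>s. norm (u s)) I = 0"
    using \<kappa> by (metis L2_set_nonneg antisym mult_le_cancel_left_pos mult_zero_right)
  then show "\<forall>s\<in>I. u s = 0" using I by (simp add: L2_set_eq_0_iff)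
qed (rule that)

section \<open>Inverse matrices and products of power series\<close>

lemma matrix_inv_inverse:
  assumes "det (A :: complex^'n^'n) \<noteq> 0"
  shows "A ** matrix_inv A = mat 1" "matrix_inv A ** A = mat 1"
proof -
  have "\<exists>B. A ** B = mat 1 \<and> B ** A = mat 1"
    using assms by (simp add: invertible_det_nz[symmetric] invertible_def)
  then have "A ** matrix_inv A = mat 1 \<and> matrix_inv A ** A = mat 1"
    unfolding matrix_inv_def by (rule someI_ex)
  then show "A ** matrix_inv A = mat 1" "matrix_inv A ** A = mat 1" by auto
qed

lemma matrix_inv_hconj:
  assumes "det (A :: complex^'n^'n) \<noteq> 0"
  shows "matrix_inv (hconj A) = hconj (matrix_inv A)"
proof -
  have d: "det (hconj A) \<noteq> 0" using assms by (simp add: det_hconj)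
  have "hconj (matrix_inv A) ** hconj A = mat 1"
    by (simp add: hconj_mult[symmetric] matrix_inv_inverse(1)[OF assms])
  then have "hconj (matrix_inv A) ** (hconj A ** matrix_inv (hconj A)) = matrix_inv (hconj A)"
    by (simp add: matrix_mul_assoc)
  then show ?thesis by (simp add: matrix_inv_inverse(1)[OF d])
qed

lemma matrix_inv_cramer:
  assumes "det (A :: complex^'n^'n) \<noteq> 0"
  shows "matrix_inv A $ i $ j = det (\<chi> p q. if q = i then axis j 1 $ p else A $ p $ q) / det A"
proof -
  have "A *v column j (matrix_inv A) = column j (mat 1)"
    by (simp add: column_matrix_mult[symmetric] matrix_inv_inverse(1)[OF assms])
  also have "column j (mat 1 :: complex^'n^'n) = axis j 1"
    by (auto simp: vec_eq_iff column_def mat_def axis_def)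
  finally have "column j (matrix_inv A) = (\<chi> k. det (\<chi> p q. if q = k then axis j 1 $ p else A $ p $ q) / det A)"
    by (simp only: cramer[OF assms])
  then have "column j (matrix_inv A) $ i = det (\<chi> p q. if q = i then axis j 1 $ p else A $ p $ q) / det A"
    by simp
  then show ?thesis by (simp add: column_def)
qed

text \<open>Leibniz' formula; only the existence of a bound in terms of \<open>B\<close> matters.\<close>
lemma norm_det_le:
  fixes A :: "complex^'n^'n"
  assumes "\<And>i j. cmod (A $ i $ j) \<le> B"
  shows "cmod (det A) \<le> real (card {p. p permutes (UNIV :: 'n set)}) * B ^ CARD('n)"
proof -
  have "cmod (det A) \<le> (\<Sum>p\<in>{p. p permutes (UNIV :: 'n set)}. B ^ CARD('n))"
    unfolding det_def
  proof (rule sum_norm_le)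
    fix p assume "p \<in> {p. p permutes (UNIV :: 'n set)}"
    have "cmod (\<Prod>i\<in>UNIV. A $ i $ p i) \<le> (\<Prod>i\<in>(UNIV :: 'n set). B)"
      unfolding prod_norm[symmetric] by (intro prod_mono) (use assms in auto)
    moreover have "cmod (of_int (sign p)) = 1" by (auto simp: sign_def)
    ultimately show "cmod (of_int (sign p) * (\<Prod>i\<in>UNIV. A $ i $ p i)) \<le> B ^ CARD('n)"
      by (simp add: norm_mult)
  qed
  then show ?thesis by simp
qed

lemma sums_matrix:
  fixes f :: "nat \<Rightarrow> complex^'n^'m"
  assumes "\<And>i j. (\<lambda>k. f k $ i $ j) sums (S $ i $ j)"
  shows "f sums S"
  unfolding sums_def
  by (intro vec_tendstoI) (use assms in \<open>simp add: sums_def\<close>)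

lemma disc_series_unique:
  assumes "disc_series c f" "disc_series d f" shows "c n = d n"
proof -
  have "c n * of_real (1/2) ^ n = d n * of_real (1/2) ^ n"
    using disc_series_fourier[OF assms(1), of "1/2" "int n"] disc_series_fourier[OF assms(2), of "1/2" "int n"]
    by simp
  then show ?thesis by simp
qed

lemma disc_series_cauchy_product:
  assumes c: "disc_series c f" and d: "disc_series d F"
  shows "disc_series (\<lambda>m. \<Sum>k\<le>m. c k * d (m - k)) (\<lambda>z. f z * F z)"
  unfolding disc_series_def
proof
  fix z :: complex assume "z \<in> ball 0 1"
  then have z: "cmod z < 1" by simp
  then obtain r where r: "cmod z < r" "r < 1" using dense by blast
  then have r0: "0 < r" using norm_ge_zero[of z] by linarith
  have abs: "summable (\<lambda>n. cmod (e n * z ^ n))" if "disc_series e \<phi>" for e \<phi>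
    by (rule powser_insidea[of e "of_real r"]) (use disc_seriesD[OF that, of "of_real r"] r r0 in \<open>auto simp: sums_iff\<close>)
  have "(\<lambda>m. \<Sum>k\<le>m. (c k * z ^ k) * (d (m - k) * z ^ (m - k))) sums ((\<Sum>k. c k * z ^ k) * (\<Sum>k. d k * z ^ k))"
    by (rule Cauchy_product_sums[OF abs[OF c] abs[OF d]])
  moreover have "(\<Sum>k\<le>m. (c k * z ^ k) * (d (m - k) * z ^ (m - k))) = (\<Sum>k\<le>m. c k * d (m - k)) * z ^ m" for m
    unfolding sum_distrib_right
  proof (rule sum.cong[OF refl])
    fix k assume "k \<in> {..m}"
    then have "z ^ m = z ^ k * z ^ (m - k)" by (simp add: power_add[symmetric])
    then show "(c k * z ^ k) * (d (m - k) * z ^ (m - k)) = c k * d (m - k) * z ^ m" by (simp add: mult_ac)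
  qed
  ultimately show "(\<lambda>m. (\<Sum>k\<le>m. c k * d (m - k)) * z ^ m) sums (f z * F z)"
    using disc_seriesD[OF c z] disc_seriesD[OF d z] by (simp add: sums_iff)
qed

lemma disc_series_sum:
  assumes "\<And>l. l \<in> L \<Longrightarrow> disc_series (c l) (f l)"
  shows "disc_series (\<lambda>n. \<Sum>l\<in>L. c l n) (\<lambda>z. \<Sum>l\<in>L. f l z)"
  using assms unfolding disc_series_def sum_distrib_right by (auto intro!: sums_sum)

lemma Re_cnj_mult_self: "Re (cnj x * x) = (cmod x)\<^sup>2"
  by (simp add: cmod_power2) (simp add: power2_eq_square)

section \<open>The outer factor and its inverse\<close>

locale outer_factorization =
  fixes w h :: "complex \<Rightarrow> complex^'d^'d" and a :: "nat \<Rightarrow> complex^'d^'d"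
  assumes w_L1: "L1_mat w"
    and w_pos: "AE \<theta> in circle_measure. pos_hermitian (w (cis \<theta>))"
    and w_wiener: "(\<lambda>k::int. opnorm (fourier_coeff w k)) summable_on UNIV"
    and w_cont: "continuous_on (sphere 0 1) w"
    and w_det: "(INF \<zeta>\<in>sphere 0 1. Re (det (w \<zeta>))) > 0"
    and h_outer: "outer_H2_mat h"
    and h_factor: "AE \<theta> in circle_measure. w (cis \<theta>) = hconj (h (cis \<theta>)) ** h (cis \<theta>)"
    and a_coeffs: "atilde_coeffs h a"
begin

abbreviation \<gamma> :: "int \<Rightarrow> complex^'d^'d" where "\<gamma> \<equiv> fourier_coeff w"

lemma gamma_summable: "(\<lambda>k. norm (\<gamma> k)) summable_on UNIV"
  by (rule summable_on_comparison_test[OF summable_on_cmult_right[OF w_wiener] norm_le_opnorm]) simp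

lemma det_w_lower:
  "\<exists>m>0. \<forall>\<zeta>\<in>sphere 0 1. m \<le> Re (det (w \<zeta>))"
proof (intro exI conjI ballI)
  have c: "continuous_on (sphere 0 1) (\<lambda>\<zeta>. Re (det (w \<zeta>)))"
    unfolding continuous_on_def
  proof (intro ballI tendsto_Re tendsto_det)
    fix \<zeta> :: complex and i j :: 'd assume "\<zeta> \<in> sphere 0 1"
    then have "(w \<longlongrightarrow> w \<zeta>) (at \<zeta> within sphere 0 1)" using w_cont by (simp add: continuous_on_def)
    then show "((\<lambda>x. w x $ i $ j) \<longlongrightarrow> w \<zeta> $ i $ j) (at \<zeta> within sphere 0 1)" by (intro tendsto_vec_nth)
  qed
  have "bdd_below ((\<lambda>\<zeta>. Re (det (w \<zeta>))) ` sphere 0 1)"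
    using compact_continuous_image[OF c compact_sphere] by (intro bounded_imp_bdd_below compact_imp_bounded)
  then show "(INF \<zeta>\<in>sphere 0 1. Re (det (w \<zeta>))) \<le> Re (det (w \<zeta>))" if "\<zeta> \<in> sphere 0 1" for \<zeta>
    using that by (rule cINF_lower)
  show "0 < (INF \<zeta>\<in>sphere 0 1. Re (det (w \<zeta>)))" by (rule w_det)
qed

lemma cis_sphere: "cis \<theta> \<in> sphere 0 1" by simp

lemma w_coercive:
  obtains \<kappa> where "0 < \<kappa>" "symbol_bound w \<kappa>"
proof -
  obtain m where m: "0 < m" "\<And>\<zeta>. \<zeta> \<in> sphere 0 1 \<Longrightarrow> m \<le> Re (det (w \<zeta>))" using det_w_lower by blast
  have "det (w \<zeta>) \<noteq> 0" if "\<zeta> \<in> sphere 0 1" for \<zeta> using m(1) m(2)[OF that] by auto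
  then obtain \<kappa> where \<kappa>: "0 < \<kappa>" "\<And>\<zeta> x. \<zeta> \<in> sphere 0 1 \<Longrightarrow> \<kappa> * norm x \<le> norm (w \<zeta> *v x)"
    using uniform_injectivity[OF w_cont] by blast
  have "symbol_bound w \<kappa>"
    using w_pos
  proof eventually_elim
    case (elim \<theta>)
    then show ?case using pos_hermitian_coercive_matrix[OF elim \<kappa>(1) \<kappa>(2)[OF cis_sphere]] by blast
  qed
  with \<kappa>(1) show ?thesis by (rule that)
qed

lemma h_entry: "hardy_H2 (\<lambda>z. h z $ i $ j)" and h_det_outer: "outer_function (\<lambda>z. det (h z))"
  using h_outer by (auto simp: outer_H2_mat_def)

lemma h_holomorphic: "(\<lambda>z. h z $ i $ j) holomorphic_on ball 0 1"
  using h_entry by (simp add: hardy_H2_def)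

text \<open>The diagonal entries of \<open>w = hconj h ** h\<close> are the squared column norms of \<open>h\<close>, so \<open>h\<close> is bounded on
the circle because \<open>w\<close> is; as a Hardy function it has the same bound in the disc.\<close>
lemma h_bounded:
  "\<exists>B\<ge>1. \<forall>z i j. cmod z < 1 \<longrightarrow> cmod (h z $ i $ j) \<le> B"
proof -
  have "bounded (w ` sphere 0 1)"
    by (intro compact_imp_bounded compact_continuous_image w_cont compact_sphere)
  then obtain M where M: "\<And>\<zeta>. \<zeta> \<in> sphere 0 1 \<Longrightarrow> norm (w \<zeta>) \<le> M"
    unfolding bounded_iff by blast
  have "AE \<theta> in circle_measure. cmod (h (cis \<theta>) $ i $ j) \<le> sqrt M" for i j
    using h_factor
  proof eventually_elim
    case (elim \<theta>)
    have "(cmod (h (cis \<theta>) $ i $ j))\<^sup>2 \<le> (\<Sum>k\<in>UNIV. (cmod (h (cis \<theta>) $ k $ j))\<^sup>2)"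
      by (rule member_le_sum) auto
    also have "\<dots> = Re (w (cis \<theta>) $ j $ j)"
      by (simp add: elim matrix_matrix_mult_def Re_sum Re_cnj_mult_self del: times_complex.sel)
    also have "\<dots> \<le> cmod (w (cis \<theta>) $ j $ j)" by (rule complex_Re_le_cmod)
    also have "\<dots> \<le> norm (w (cis \<theta>))" by (rule norm_component_le)
    also have "\<dots> \<le> M" by (rule M[OF cis_sphere])
    finally show ?case by (rule real_le_rsqrt)
  qed
  then have "cmod (h z $ i $ j) \<le> max 1 (sqrt M)" if "cmod z < 1" for z i j
    using hardy_H2_bounded[OF h_entry _ that] by (meson max.coboundedI2)
  then show ?thesis by (intro exI[of _ "max 1 (sqrt M)"]) auto
qed

lemma det_h_lower_boundary:
  obtains \<delta> where "0 < \<delta>" "AE \<theta> in circle_measure. \<delta> \<le> cmod (det (h (cis \<theta>)))"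
proof -
  obtain m where m: "0 < m" "\<And>\<zeta>. \<zeta> \<in> sphere 0 1 \<Longrightarrow> m \<le> Re (det (w \<zeta>))" using det_w_lower by blast
  have "AE \<theta> in circle_measure. sqrt m \<le> cmod (det (h (cis \<theta>)))"
    using h_factor
  proof eventually_elim
    case (elim \<theta>)
    have "det (w (cis \<theta>)) = cnj (det (h (cis \<theta>))) * det (h (cis \<theta>))"
      by (simp add: elim det_mul det_hconj)
    then have "Re (det (w (cis \<theta>))) = (cmod (det (h (cis \<theta>))))\<^sup>2"
      by (simp only: Re_cnj_mult_self)
    then have "m \<le> (cmod (det (h (cis \<theta>))))\<^sup>2" using m(2)[OF cis_sphere[of \<theta>]] by simp
    then show ?case by (simp add: real_le_lsqrt)
  qed
  then show ?thesis using m(1) that[of "sqrt m"] by simp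
qed

text \<open>This is where outerness enters: \<open>det h\<close> has modulus \<open>sqrt (det w)\<close> on the circle, and an
analytic function with these boundary values of the modulus could otherwise vanish inside.\<close>
lemma det_h_lower:
  "\<exists>\<delta>>0. \<forall>z. cmod z < 1 \<longrightarrow> \<delta> \<le> cmod (det (h z))"
proof -
  obtain \<delta> where \<delta>: "0 < \<delta>" "AE \<theta> in circle_measure. \<delta> \<le> cmod (det (h (cis \<theta>)))"
    by (rule det_h_lower_boundary)
  show ?thesis using outer_function_bounded_below[OF h_det_outer \<delta>] \<delta>(1) by blast
qed

lemma det_h_nonzero: "cmod z < 1 \<Longrightarrow> det (h z) \<noteq> 0"
  using det_h_lower by fastforce

text \<open>The Taylor coefficients of \<open>neg_inv\<close>: the passage from \<open>h\<close> to \<open>htilde h\<close> conjugates both the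
argument and the value, and so conjugates the coefficients.\<close>
definition neg_inv_coeff :: "nat \<Rightarrow> complex^'d^'d" where "neg_inv_coeff k = hconj (a k)"

definition neg_inv :: "complex \<Rightarrow> complex^'d^'d" where "neg_inv z = - matrix_inv (h z)"

definition h_coeff :: "nat \<Rightarrow> complex^'d^'d" where
  "h_coeff k = (\<chi> i j. (deriv ^^ k) (\<lambda>z. h z $ i $ j) 0 / fact k)"

lemma h_series: "disc_series (\<lambda>k. h_coeff k $ i $ j) (\<lambda>z. h z $ i $ j)"
  using holomorphic_power_series[OF h_holomorphic] by (simp add: disc_series_def h_coeff_def)

lemma neg_inv_series: "disc_series (\<lambda>k. neg_inv_coeff k $ i $ j) (\<lambda>z. neg_inv z $ i $ j)"
  unfolding disc_series_def
proof
  fix z :: complex assume z: "z \<in> ball 0 1"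
  then have "cnj z \<in> ball 0 1" by simp
  then have "(\<lambda>k. cnj z ^ k * a k $ j $ i) sums ((- matrix_inv (htilde h (cnj z))) $ j $ i)"
    using a_coeffs unfolding atilde_coeffs_def by blast
  also have "(- matrix_inv (htilde h (cnj z))) $ j $ i = cnj (neg_inv z $ i $ j)"
    using z by (simp add: htilde_def matrix_inv_hconj[OF det_h_nonzero] neg_inv_def)
  finally have "(\<lambda>k. cnj (cnj z ^ k * a k $ j $ i)) sums cnj (cnj (neg_inv z $ i $ j))"
    by (simp only: sums_cnj)
  then show "(\<lambda>k. neg_inv_coeff k $ i $ j * z ^ k) sums neg_inv z $ i $ j" by (simp add: neg_inv_coeff_def mult.commute)
qed

lemma neg_inv_holomorphic: "(\<lambda>z. neg_inv z $ i $ j) holomorphic_on ball 0 1"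
  by (rule disc_series_holomorphic[OF neg_inv_series])

text \<open>Cramer's rule: polynomials in the bounded entries of \<open>h\<close>, divided by \<open>det h\<close>.\<close>
lemma neg_inv_bounded:
  "\<exists>B. \<forall>z i j. cmod z < 1 \<longrightarrow> cmod (neg_inv z $ i $ j) \<le> B"
proof -
  obtain B where B: "1 \<le> B" "\<And>z i j. cmod z < 1 \<Longrightarrow> cmod (h z $ i $ j) \<le> B" using h_bounded by blast
  obtain \<delta> where \<delta>: "0 < \<delta>" "\<And>z. cmod z < 1 \<Longrightarrow> \<delta> \<le> cmod (det (h z))" using det_h_lower by blast
  show ?thesis
  proof (intro exI allI impI)
    fix z i j assume z: "cmod z < 1"
    let ?A = "(\<chi> p q. if q = i then axis j 1 $ p else h z $ p $ q) :: complex^'d^'d"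
    have "cmod (det ?A) \<le> real (card {p. p permutes (UNIV :: 'd set)}) * B ^ CARD('d)"
      by (rule norm_det_le) (use B(1) B(2)[OF z] in \<open>auto simp: axis_def\<close>)
    then show "cmod (neg_inv z $ i $ j) \<le> real (card {p. p permutes (UNIV :: 'd set)}) * B ^ CARD('d) / \<delta>"
      using \<delta>(1) \<delta>(2) z B(1)
      by (simp add: neg_inv_def matrix_inv_cramer[OF det_h_nonzero[OF z]] norm_divide frac_le)
  qed
qed

lemma h_radial: "AE \<theta> in circle_measure. \<forall>i j. ((\<lambda>r. h (of_real r * cis \<theta>) $ i $ j) \<longlongrightarrow> h (cis \<theta>) $ i $ j) (at_left 1)"
  using h_entry by (simp add: AE_all_countable hardy_H2_def radial_boundary_def)

lemma neg_inv_radial: "radial_boundary (\<lambda>z. neg_inv z $ i $ j)"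
proof -
  obtain \<delta> where \<delta>: "0 < \<delta>" "AE \<theta> in circle_measure. \<delta> \<le> cmod (det (h (cis \<theta>)))"
    by (rule det_h_lower_boundary)
  show ?thesis unfolding radial_boundary_def using \<delta>(2) h_radial
  proof eventually_elim
    case (elim \<theta>)
    have nz: "det (h (cis \<theta>)) \<noteq> 0" using elim(1) \<delta>(1) by auto
    let ?A = "\<lambda>z. (\<chi> p q. if q = i then axis j 1 $ p else h z $ p $ q) :: complex^'d^'d"
    have "((\<lambda>r. - (det (?A (of_real r * cis \<theta>)) / det (h (of_real r * cis \<theta>)))) \<longlongrightarrow>
       - (det (?A (cis \<theta>)) / det (h (cis \<theta>)))) (at_left 1)"
      by (intro tendsto_intros tendsto_det nz) (use elim(2) in \<open>auto intro!: vec_tendstoI\<close>)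
    moreover have "- (det (?A (cis \<theta>)) / det (h (cis \<theta>))) = neg_inv (cis \<theta>) $ i $ j"
      by (simp add: neg_inv_def matrix_inv_cramer[OF nz])
    moreover have "eventually (\<lambda>r. - (det (?A (of_real r * cis \<theta>)) / det (h (of_real r * cis \<theta>))) = neg_inv (of_real r * cis \<theta>) $ i $ j) (at_left 1)"
    proof -
      have "eventually (\<lambda>r::real. r \<in> {0<..<1}) (at_left 1)" by (rule eventually_at_left_real) simp
      then show ?thesis
      proof eventually_elim
        case (elim r)
        then have "cmod (of_real r * cis \<theta>) < 1" by (simp add: norm_mult)
        then show ?case by (simp add: neg_inv_def matrix_inv_cramer[OF det_h_nonzero])
      qed
    qed
    ultimately show "((\<lambda>r. neg_inv (of_real r * cis \<theta>) $ i $ j) \<longlongrightarrow> neg_inv (cis \<theta>) $ i $ j) (at_left 1)"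
      by (simp add: tendsto_cong)
  qed
qed

text \<open>The identity \<open>w ** neg_inv = - hconj h\<close> on the circle, read off in Fourier coefficients. The left side
is the convolution of the coefficients of \<open>w\<close> and \<open>neg_inv\<close>. On the right, conjugation turns the nonnegative
frequencies of \<open>h\<close> into nonpositive ones, so nothing is left for \<open>s > 0\<close>.\<close>
lemma toeplitz_neg_inv_component:
  "(\<lambda>t. (\<gamma> (s - int t) ** neg_inv_coeff t) $ i $ j) sums (if s \<le> 0 then - cnj (h_coeff (nat (- s)) $ j $ i) else 0)"
proof -
  obtain Bh where "1 \<le> Bh" and Bh: "\<And>z i j. cmod z < 1 \<Longrightarrow> cmod (h z $ i $ j) \<le> Bh" using h_bounded by blast
  obtain BG where BG: "\<And>z i j. cmod z < 1 \<Longrightarrow> cmod (neg_inv z $ i $ j) \<le> BG" using neg_inv_bounded by blast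
  obtain H where Hm: "H \<in> borel_measurable circle_measure"
    and Hh: "AE \<theta> in circle_measure. H \<theta> = h (cis \<theta>) $ j $ i"
    and H: "radial_limit (\<lambda>z. h z $ j $ i) H"
    by (rule radial_limit_measurable[OF h_holomorphic[of j i]]) (use h_entry in \<open>auto simp: hardy_H2_def\<close>)
  let ?P = "\<lambda>k X. X \<in> borel_measurable circle_measure \<and> (AE \<theta> in circle_measure. X \<theta> = neg_inv (cis \<theta>) $ k $ j) \<and>
     radial_limit (\<lambda>z. neg_inv z $ k $ j) X"
  have "\<forall>k. \<exists>X. ?P k X"
  proof
    fix k show "\<exists>X. ?P k X"
      by (rule radial_limit_measurable[OF neg_inv_holomorphic neg_inv_radial, of k j]) (intro exI conjI)
  qed
  from choice[OF this] obtain X where X': "\<forall>k. ?P k (X k)" by (rule exE)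
  then have Xm: "\<And>k. X k \<in> borel_measurable circle_measure"
    and XG: "\<And>k. AE \<theta> in circle_measure. X k \<theta> = neg_inv (cis \<theta>) $ k $ j"
    and X: "\<And>k. radial_limit (\<lambda>z. neg_inv z $ k $ j) (X k)"
    by simp_all
  let ?e = "\<lambda>\<theta>. cis (- (real_of_int s * \<theta>))"
  let ?\<phi> = "\<lambda>k \<theta>. ?e \<theta> * w (cis \<theta>) $ i $ k"
  have \<phi>: "integrable circle_measure (?\<phi> k)" for k by (rule integrable_fourier_integrand[OF w_L1])
  have \<phi>c: "(LINT \<theta>|circle_measure. ?\<phi> k \<theta> * cis (real n * \<theta>)) = \<gamma> (s - int n) $ i $ k" for k n
  proof -
    have "?\<phi> k \<theta> * cis (real n * \<theta>) = cis (- (real_of_int (s - int n) * \<theta>)) * w (cis \<theta>) $ i $ k" for \<theta>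
      using cis_mult[of "- (real_of_int s * \<theta>)" "real n * \<theta>"] by (simp add: mult_ac algebra_simps)
    then show ?thesis by (simp only: fourier_coeff_def vec_lambda_beta)
  qed
  have \<gamma>s: "summable (\<lambda>n. cmod (\<gamma> (s - int n) $ i $ k))" for k
  proof -
    have "(\<lambda>x. norm (\<gamma> x)) summable_on ((\<lambda>n::nat. s - int n) ` UNIV)"
      by (rule summable_on_subset_banach[OF gamma_summable]) simp
    then have "(\<lambda>n::nat. norm (\<gamma> (s - int n))) summable_on UNIV"
      by (subst (asm) summable_on_reindex) (auto simp: inj_on_def o_def)
    then have "summable (\<lambda>n::nat. norm (\<gamma> (s - int n)))" by (rule summable_on_imp_summable)
    then show ?thesis by (rule summable_comparison_test'[where N = 0]) (simp add: norm_component_le)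
  qed
  have "(\<lambda>n. \<Sum>k\<in>UNIV. neg_inv_coeff n $ k $ j * \<gamma> (s - int n) $ i $ k) sums (\<Sum>k\<in>UNIV. LINT \<theta>|circle_measure. ?\<phi> k \<theta> * X k \<theta>)"
    using disc_series_boundary_integral[OF neg_inv_series BG Xm X \<phi>, unfolded \<phi>c, OF _ \<gamma>s] by (intro sums_sum) auto
  moreover have "(\<Sum>k\<in>UNIV. neg_inv_coeff n $ k $ j * \<gamma> (s - int n) $ i $ k) = (\<gamma> (s - int n) ** neg_inv_coeff n) $ i $ j" for n
    by (simp add: matrix_matrix_mult_def mult.commute)
  moreover have "(\<Sum>k\<in>UNIV. LINT \<theta>|circle_measure. ?\<phi> k \<theta> * X k \<theta>) = (if s \<le> 0 then - cnj (h_coeff (nat (- s)) $ j $ i) else 0)"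
  proof -
    have \<phi>X: "integrable circle_measure (\<lambda>\<theta>. ?\<phi> k \<theta> * X k \<theta>)" for k
    proof (rule integrable_circle_bounded_mult[OF \<phi> Xm])
      show "AE \<theta> in circle_measure. cmod (X k \<theta>) \<le> BG" using X[of k]
      proof eventually_elim
        case (elim \<theta>)
        show ?case
        proof (rule LIMSEQ_le_const2[OF tendsto_norm[OF elim]])
          show "\<exists>N. \<forall>n\<ge>N. cmod (neg_inv (of_real (rad n) * cis \<theta>) $ k $ j) \<le> BG"
            using BG norm_rcis_less[OF rad(3) rad(2), of _ \<theta>] by auto
        qed
      qed
    qed
    have "(\<Sum>k\<in>UNIV. LINT \<theta>|circle_measure. ?\<phi> k \<theta> * X k \<theta>) = (LINT \<theta>|circle_measure. (\<Sum>k\<in>UNIV. ?\<phi> k \<theta> * X k \<theta>))"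
      by (rule Bochner_Integration.integral_sum[OF \<phi>X, symmetric])
    also have "\<dots> = (LINT \<theta>|circle_measure. - cnj (cis (- (real_of_int (- s) * \<theta>)) * H \<theta>))"
    proof (rule integral_cong_AE)
      show "(\<lambda>\<theta>. \<Sum>k\<in>UNIV. ?\<phi> k \<theta> * X k \<theta>) \<in> borel_measurable circle_measure"
        using \<phi>X by (intro borel_measurable_sum) auto
      have em: "(\<lambda>\<theta>. cis (- (real_of_int (- s) * \<theta>))) \<in> borel_measurable circle_measure"
        by (intro measurable_circle_continuous continuous_intros)
      show "(\<lambda>\<theta>. - cnj (cis (- (real_of_int (- s) * \<theta>)) * H \<theta>)) \<in> borel_measurable circle_measure"
        using borel_measurable_times[OF em Hm] by (intro borel_measurable_uminus measurable_compose[OF _ borel_measurable_continuous_onI[of cnj]]) (auto intro: continuous_intros)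
      obtain \<delta> where \<delta>: "0 < \<delta>" "AE \<theta> in circle_measure. \<delta> \<le> cmod (det (h (cis \<theta>)))"
        by (rule det_h_lower_boundary)
      have "AE \<theta> in circle_measure. \<forall>k. X k \<theta> = neg_inv (cis \<theta>) $ k $ j"
        using XG by (simp add: AE_all_countable)
      with \<delta>(2) Hh h_factor
      show "AE \<theta> in circle_measure. (\<Sum>k\<in>UNIV. ?\<phi> k \<theta> * X k \<theta>) = - cnj (cis (- (real_of_int (- s) * \<theta>)) * H \<theta>)"
      proof eventually_elim
        case (elim \<theta>)
        have nz: "det (h (cis \<theta>)) \<noteq> 0" using elim(1) \<delta>(1) by auto
        have "w (cis \<theta>) ** neg_inv (cis \<theta>) = - (hconj (h (cis \<theta>)) ** (h (cis \<theta>) ** matrix_inv (h (cis \<theta>))))"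
          by (simp add: elim(3) neg_inv_def mm.minus_right matrix_mul_assoc)
        also have "\<dots> = - hconj (h (cis \<theta>))" by (simp add: matrix_inv_inverse(1)[OF nz])
        finally have wG: "(w (cis \<theta>) ** neg_inv (cis \<theta>)) $ i $ j = - cnj (h (cis \<theta>) $ j $ i)" by simp
        have "(\<Sum>k\<in>UNIV. ?\<phi> k \<theta> * X k \<theta>) = ?e \<theta> * (w (cis \<theta>) ** neg_inv (cis \<theta>)) $ i $ j"
          by (simp add: elim(4) matrix_matrix_mult_def sum_distrib_left mult.assoc)
        also have "\<dots> = - cnj (cis (- (real_of_int (- s) * \<theta>)) * H \<theta>)"
          unfolding wG by (simp add: elim(2) cis_cnj)
        finally show ?case .
      qed
    qed
    also have "\<dots> = - cnj (LINT \<theta>|circle_measure. cis (- (real_of_int (- s) * \<theta>)) * H \<theta>)"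
      by (simp only: Bochner_Integration.integral_minus Bochner_Integration.integral_cnj)
    also have "\<dots> = (if s \<le> 0 then - cnj (h_coeff (nat (- s)) $ j $ i) else 0)"
      using disc_series_boundary_fourier[OF h_series Bh Hm H, of "- s"] by simp
    finally show ?thesis .
  qed
  ultimately show ?thesis by simp
qed

lemma toeplitz_neg_inv: "(\<lambda>t. \<gamma> (s - int t) ** neg_inv_coeff t) sums (if s \<le> 0 then - hconj (h_coeff (nat (- s))) else 0)"
proof (rule sums_matrix)
  fix i j
  show "(\<lambda>t. (\<gamma> (s - int t) ** neg_inv_coeff t) $ i $ j) sums ((if s \<le> 0 then - hconj (h_coeff (nat (- s))) else 0) $ i $ j)"
    using toeplitz_neg_inv_component[of s i j] by (cases "s \<le> 0") simp_all
qed

text \<open>The coefficients of the power series of \<open>neg_inv z ** h z = - mat 1\<close>.\<close>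
lemma neg_inv_h_convolution: "(\<Sum>k\<le>m. neg_inv_coeff k ** h_coeff (m - k)) = (if m = 0 then - mat 1 else 0)"
proof -
  have "(\<Sum>l\<in>UNIV. \<Sum>k\<le>m. neg_inv_coeff k $ i $ l * h_coeff (m - k) $ l $ j) = (if m = 0 then (- mat 1 :: complex^'d^'d) $ i $ j else 0)" for i j
  proof -
    have d1: "disc_series (\<lambda>m. \<Sum>l\<in>UNIV. \<Sum>k\<le>m. neg_inv_coeff k $ i $ l * h_coeff (m - k) $ l $ j) (\<lambda>z. \<Sum>l\<in>UNIV. neg_inv z $ i $ l * h z $ l $ j)"
      by (intro disc_series_sum disc_series_cauchy_product neg_inv_series h_series)
    have d2: "disc_series (\<lambda>m. if m = 0 then (- mat 1 :: complex^'d^'d) $ i $ j else 0) (\<lambda>z. \<Sum>l\<in>UNIV. neg_inv z $ i $ l * h z $ l $ j)"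
      unfolding disc_series_def
    proof
      fix z :: complex assume "z \<in> ball 0 1"
      then have "matrix_inv (h z) ** h z = mat 1" by (intro matrix_inv_inverse det_h_nonzero) simp
      then have "neg_inv z ** h z = - mat 1" by (simp add: neg_inv_def mm.minus_left)
      then have "(\<Sum>l\<in>UNIV. neg_inv z $ i $ l * h z $ l $ j) = (- mat 1 :: complex^'d^'d) $ i $ j"
        by (simp add: vec_eq_iff matrix_matrix_mult_def)
      moreover have "(\<lambda>n. (if n = 0 then (- mat 1 :: complex^'d^'d) $ i $ j else 0) * z ^ n) sums
          ((- mat 1 :: complex^'d^'d) $ i $ j)"
        using sums_single[of 0 "\<lambda>n. (- mat 1 :: complex^'d^'d) $ i $ j * z ^ n"]
        by (simp add: if_distrib[of "\<lambda>x. x * _"] cong: if_cong)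
      ultimately show "(\<lambda>n. (if n = 0 then (- mat 1 :: complex^'d^'d) $ i $ j else 0) * z ^ n) sums
          (\<Sum>l\<in>UNIV. neg_inv z $ i $ l * h z $ l $ j)" by simp
    qed
    show ?thesis by (rule disc_series_unique[OF d1 d2])
  qed
  moreover have "(\<Sum>k\<le>m. neg_inv_coeff k ** h_coeff (m - k)) $ i $ j = (\<Sum>l\<in>UNIV. \<Sum>k\<le>m. neg_inv_coeff k $ i $ l * h_coeff (m - k) $ l $ j)" for i j
    by (simp add: matrix_matrix_mult_def) (rule sum.swap)
  ultimately show ?thesis by (simp add: vec_eq_iff)
qed

lemma h_coeff_bounded: "\<exists>B. \<forall>k. norm (h_coeff k) \<le> B"
proof -
  obtain B where B: "1 \<le> B" "\<And>z i j. cmod z < 1 \<Longrightarrow> cmod (h z $ i $ j) \<le> B" using h_bounded by blast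
  have "norm (h_coeff k) \<le> (\<Sum>i\<in>(UNIV :: 'd set). \<Sum>j\<in>(UNIV :: 'd set). B)" for k
    by (intro order_trans[OF norm_le_sum_entries] sum_mono disc_series_coeff_le[OF h_series B(2)])
  then show ?thesis by blast
qed

lemma neg_inv_coeff_square_summable: "summable (\<lambda>n. (norm (neg_inv_coeff n))\<^sup>2)"
proof -
  obtain B where B: "\<And>z i j. cmod z < 1 \<Longrightarrow> cmod (neg_inv z $ i $ j) \<le> B" using neg_inv_bounded by blast
  have sq: "(norm (neg_inv_coeff n))\<^sup>2 = (\<Sum>i\<in>UNIV. \<Sum>j\<in>UNIV. (cmod (neg_inv_coeff n $ i $ j))\<^sup>2)" for n
    by (simp add: norm_vec_def L2_set_def sum_nonneg)
  have "(\<Sum>n<N. (norm (neg_inv_coeff n))\<^sup>2) \<le> (\<Sum>i\<in>(UNIV :: 'd set). \<Sum>j\<in>(UNIV :: 'd set). B\<^sup>2)" for N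
  proof -
    have "(\<Sum>n<N. (norm (neg_inv_coeff n))\<^sup>2) = (\<Sum>i\<in>UNIV. \<Sum>n<N. \<Sum>j\<in>UNIV. (cmod (neg_inv_coeff n $ i $ j))\<^sup>2)"
      unfolding sq by (rule sum.swap)
    also have "\<dots> = (\<Sum>i\<in>UNIV. \<Sum>j\<in>UNIV. \<Sum>n<N. (cmod (neg_inv_coeff n $ i $ j))\<^sup>2)"
      by (intro sum.cong refl sum.swap)
    also have "\<dots> \<le> (\<Sum>i\<in>(UNIV :: 'd set). \<Sum>j\<in>(UNIV :: 'd set). B\<^sup>2)"
      by (intro sum_mono disc_series_bessel[OF neg_inv_series B])
    finally show ?thesis .
  qed
  then show ?thesis by (intro summableI_nonneg_bounded) auto
qed

section \<open>Absolute summability of the coefficients of the inverse factor\<close>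

text \<open>Cutting the infinite Toeplitz product after \<open>n\<close> terms leaves a convolution with a tail of a square summable
sequence; Young's inequality is applied to finite parts of the tail, and the bound passes to the limit.\<close>
lemma neg_inv_section_residual:
  fixes S :: "int \<Rightarrow> complex^'d^'d"
  assumes S: "\<And>s. s \<in> I \<Longrightarrow> (\<lambda>t. \<gamma> (s - int t) ** neg_inv_coeff t) sums S s" and I: "finite I"
  shows "L2_set (\<lambda>s. norm (S s - (\<Sum>t\<le>n. \<gamma> (s - int t) ** neg_inv_coeff t))) I \<le>
     (\<Sum>\<^sub>\<infinity>k. norm (\<gamma> k)) * sqrt (\<Sum>k. (norm (neg_inv_coeff (k + Suc n)))\<^sup>2)" (is "?L \<le> ?b * ?E")
proof -
  have sq: "summable (\<lambda>k. (norm (neg_inv_coeff (k + Suc n)))\<^sup>2)" using neg_inv_coeff_square_summable by (subst summable_iff_shift)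
  have b0: "0 \<le> ?b" by (intro infsum_nonneg) simp
  let ?R = "\<lambda>M s. (\<Sum>t<M. \<gamma> (s - int t) ** neg_inv_coeff t) - (\<Sum>t\<le>n. \<gamma> (s - int t) ** neg_inv_coeff t)"
  have bound: "L2_set (\<lambda>s. norm (?R M s)) I \<le> ?b * ?E" if M: "n < M" for M
  proof -
    have R: "?R M s = (\<Sum>t\<in>{n<..<M}. \<gamma> (s - int t) ** neg_inv_coeff t)" for s
    proof -
      have U: "{..<M} = {..n} \<union> {n<..<M}" using M by auto
      have "(\<Sum>t<M. \<gamma> (s - int t) ** neg_inv_coeff t) =
          (\<Sum>t\<le>n. \<gamma> (s - int t) ** neg_inv_coeff t) + (\<Sum>t\<in>{n<..<M}. \<gamma> (s - int t) ** neg_inv_coeff t)"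
        unfolding U by (rule sum.union_disjoint) auto
      then show ?thesis by simp
    qed
    have "L2_set (\<lambda>s. norm (?R M s)) I \<le> L2_set (\<lambda>s. \<Sum>t\<in>int ` {n<..<M}. norm (\<gamma> (s - t)) * norm (neg_inv_coeff (nat t))) I"
    proof (rule L2_set_mono)
      fix s assume "s \<in> I"
      have "norm (?R M s) \<le> (\<Sum>t\<in>{n<..<M}. norm (\<gamma> (s - int t)) * norm (neg_inv_coeff t))"
        unfolding R by (intro sum_norm_le norm_matrix_mult_le)
      then show "norm (?R M s) \<le> (\<Sum>t\<in>int ` {n<..<M}. norm (\<gamma> (s - t)) * norm (neg_inv_coeff (nat t)))"
        by (simp add: sum.reindex)
    qed simp
    also have "\<dots> \<le> ?b * L2_set (\<lambda>t. norm (neg_inv_coeff (nat t))) (int ` {n<..<M})"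
      by (rule L2_set_convolution_le[OF I _ _ _ gamma_summable]) auto
    also have "L2_set (\<lambda>t. norm (neg_inv_coeff (nat t))) (int ` {n<..<M}) \<le> ?E"
    proof -
      have "(\<Sum>t\<in>int ` {n<..<M}. (norm (neg_inv_coeff (nat t)))\<^sup>2) = (\<Sum>t\<in>{n<..<M}. (norm (neg_inv_coeff t))\<^sup>2)"
        by (simp add: sum.reindex)
      also have "\<dots> = (\<Sum>k\<in>(\<lambda>t. t - Suc n) ` {n<..<M}. (norm (neg_inv_coeff (k + Suc n)))\<^sup>2)"
        by (subst sum.reindex) (auto simp: inj_on_def)
      also have "\<dots> \<le> (\<Sum>k. (norm (neg_inv_coeff (k + Suc n)))\<^sup>2)"
        by (rule sum_le_suminf[OF sq]) auto
      finally show ?thesis by (simp add: L2_set_def)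
    qed
    finally show ?thesis using b0 by (simp add: mult_left_mono)
  qed
  have "(\<lambda>M. L2_set (\<lambda>s. norm (?R M s)) I) \<longlonglongrightarrow> ?L"
    unfolding L2_set_def
    by (intro tendsto_real_sqrt tendsto_sum tendsto_power tendsto_norm tendsto_diff tendsto_const)
      (use S in \<open>simp add: sums_def\<close>)
  then show ?thesis using bound by (intro LIMSEQ_le_const2) (auto intro: exI[of _ "Suc n"])
qed

text \<open>The Toeplitz matrix sends the coefficients of \<open>neg_inv\<close> to a sequence \<open>S\<close> with \<open>S s = 0\<close> for \<open>s > 0\<close>.
The solutions \<open>U\<close> of the finite systems with right-hand side
\<open>S\<close> have sum norms at most \<open>C * norm (S 0)\<close>, uniformly in \<open>n\<close>, and they approach the coefficients in
mean square as \<open>n\<close> grows. Hence every partial sum of the norms of the coefficients obeys the same bound.\<close>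
lemma neg_inv_coeff_summable: "summable (\<lambda>n. norm (neg_inv_coeff n))"
proof -
  obtain \<kappa> where \<kappa>: "0 < \<kappa>" and low: "symbol_bound w \<kappa>"
    by (rule w_coercive)
  obtain C where C0: "0 \<le> C" and C: "\<And>I (u :: int \<Rightarrow> complex^'d^'d). finite I \<Longrightarrow>
     (\<Sum>s\<in>I. norm (u s)) \<le> C * (\<Sum>s\<in>I. norm (\<Sum>t\<in>I. \<gamma> (s - t) ** u t))"
    using toeplitz_l1_stability[OF w_L1 gamma_summable \<kappa> low] by blast
  define S :: "int \<Rightarrow> complex^'d^'d" where "S s = (if s = 0 then - hconj (h_coeff 0) else 0)" for s
  let ?b = "\<Sum>\<^sub>\<infinity>k. norm (\<gamma> k)"
  define E where "E n = sqrt (\<Sum>k. (norm (neg_inv_coeff (k + Suc n)))\<^sup>2)" for n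
  have E0: "E \<longlonglongrightarrow> 0"
  proof -
    have "(\<lambda>n. \<Sum>k. (norm (neg_inv_coeff (k + n)))\<^sup>2) \<longlonglongrightarrow> 0"
      by (rule suminf_exist_split2[OF neg_inv_coeff_square_summable])
    then have "(\<lambda>n. sqrt (\<Sum>k. (norm (neg_inv_coeff (k + Suc n)))\<^sup>2)) \<longlonglongrightarrow> sqrt 0"
      by (intro tendsto_real_sqrt LIMSEQ_Suc)
    then show ?thesis by (simp add: E_def[abs_def])
  qed
  have part: "(\<Sum>s<N. norm (neg_inv_coeff s)) \<le> C * norm (S 0) + real N * (?b * E n / \<kappa>)" if N: "N \<le> n" for N n
  proof -
    define I where "I = int ` {..n}"
    have I: "finite I" by (simp add: I_def)
    obtain U where U: "\<And>s. s \<in> I \<Longrightarrow> (\<Sum>t\<in>I. \<gamma> (s - t) ** U t) = S s"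
      by (rule toeplitz_solvable[OF w_L1 I \<kappa> low, of S]) blast
    \<comment> \<open>The mean square error of the finite solution tends to 0 with the tail \<open>E n\<close>.\<close>
    define V where "V t = U t - neg_inv_coeff (nat t)" for t
    have "(\<Sum>s\<in>I. norm (U s)) \<le> C * (\<Sum>s\<in>I. norm (\<Sum>t\<in>I. \<gamma> (s - t) ** U t))" by (rule C[OF I])
    also have "(\<Sum>s\<in>I. norm (\<Sum>t\<in>I. \<gamma> (s - t) ** U t)) = (\<Sum>s\<in>I. if s = 0 then norm (S 0) else 0)"
      by (rule sum.cong) (auto simp: U S_def)
    also have "\<dots> = norm (S 0)" using I by (auto simp: I_def)
    finally have Ub: "(\<Sum>s\<in>I. norm (U s)) \<le> C * norm (S 0)" .
    have TV: "(\<Sum>t\<in>I. \<gamma> (s - t) ** V t) = S s - (\<Sum>t\<le>n. \<gamma> (s - int t) ** neg_inv_coeff t)" if "s \<in> I" for s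
    proof -
      have "(\<Sum>t\<in>I. \<gamma> (s - t) ** V t) = (\<Sum>t\<in>I. \<gamma> (s - t) ** U t) - (\<Sum>t\<in>I. \<gamma> (s - t) ** neg_inv_coeff (nat t))"
        by (simp add: V_def mm.diff_right sum_subtractf)
      then show ?thesis using U[OF that] by (simp add: I_def sum.reindex)
    qed
    have Ssums: "(\<lambda>t. \<gamma> (s - int t) ** neg_inv_coeff t) sums S s" if "s \<in> I" for s
      using toeplitz_neg_inv[of s] that by (auto simp: I_def S_def split: if_splits)
    have "\<kappa> * L2_set (\<lambda>s. norm (V s)) I \<le> L2_set (\<lambda>s. norm (\<Sum>t\<in>I. \<gamma> (s - t) ** V t)) I"
      by (rule toeplitz_l2_lower_bound[OF w_L1 I low])
    also have "\<dots> = L2_set (\<lambda>s. norm (S s - (\<Sum>t\<le>n. \<gamma> (s - int t) ** neg_inv_coeff t))) I"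
      by (rule L2_set_cong) (simp_all add: TV)
    also have "\<dots> \<le> ?b * E n" unfolding E_def by (rule neg_inv_section_residual[OF Ssums I])
    finally have Vb: "L2_set (\<lambda>s. norm (V s)) I \<le> ?b * E n / \<kappa>" using \<kappa> by (simp add: field_simps)
    have gle: "norm (neg_inv_coeff s) \<le> norm (U (int s)) + ?b * E n / \<kappa>" if "s < N" for s
    proof -
      have "norm (V (int s)) \<le> L2_set (\<lambda>s. norm (V s)) I"
        using that N by (intro member_le_L2_set I) (auto simp: I_def)
      moreover have "norm (neg_inv_coeff s) \<le> norm (U (int s)) + norm (V (int s))"
        using norm_triangle_ineq4[of "U (int s)" "V (int s)"] by (simp add: V_def)
      ultimately show ?thesis using Vb by linarith
    qed
    have "(\<Sum>s<N. norm (neg_inv_coeff s)) \<le> (\<Sum>s<N. norm (U (int s)) + ?b * E n / \<kappa>)"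
      by (intro sum_mono gle) simp
    also have "\<dots> = (\<Sum>s\<in>int ` {..<N}. norm (U s)) + real N * (?b * E n / \<kappa>)"
      by (simp add: sum.distrib sum.reindex)
    also have "(\<Sum>s\<in>int ` {..<N}. norm (U s)) \<le> (\<Sum>s\<in>I. norm (U s))"
      using N by (intro sum_mono2 I) (auto simp: I_def)
    finally show ?thesis using Ub by linarith
  qed
  have "(\<Sum>s<N. norm (neg_inv_coeff s)) \<le> C * norm (S 0)" for N
  proof (rule LIMSEQ_le_const)
    have "(\<lambda>n. C * norm (S 0) + real N * (?b * E n / \<kappa>)) \<longlonglongrightarrow> C * norm (S 0) + real N * (?b * 0 / \<kappa>)"
      by (intro tendsto_intros E0) (use \<kappa> in auto)
    then show "(\<lambda>n. C * norm (S 0) + real N * (?b * E n / \<kappa>)) \<longlonglongrightarrow> C * norm (S 0)" by simp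
    show "\<exists>M. \<forall>n\<ge>M. (\<Sum>s<N. norm (neg_inv_coeff s)) \<le> C * norm (S 0) + real N * (?b * E n / \<kappa>)"
      using part by blast
  qed
  then show ?thesis by (intro summableI_nonneg_bounded) auto
qed

end

section \<open>Triangular double sums\<close>

lemma bij_betw_triangle:
  "bij_betw prod.swap (SIGMA t:{1..}. {1..t}) (SIGMA l:{1::nat..}. {l..})"
  by (rule bij_betwI[where g = prod.swap]) auto

lemma infsum_triangle_swap:
  fixes f :: "nat \<Rightarrow> nat \<Rightarrow> 'a::banach"
  assumes s: "(\<lambda>(l, t). f l t) summable_on (SIGMA l:{1..}. {l..})"
  shows "(\<Sum>\<^sub>\<infinity>l\<in>{1..}. \<Sum>\<^sub>\<infinity>t\<in>{l..}. f l t) = (\<Sum>\<^sub>\<infinity>t\<in>{1..}. \<Sum>l=1..t. f l t)"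
    and "(\<lambda>l. \<Sum>\<^sub>\<infinity>t\<in>{l..}. f l t) summable_on {1..}"
    and "(\<lambda>t. \<Sum>l=1..t. f l t) summable_on {1..}"
proof -
  have s': "(\<lambda>(t, l). f l t) summable_on (SIGMA t:{1..}. {1..t})"
    using summable_on_reindex_bij_betw[OF bij_betw_triangle, of "\<lambda>(l, t). f l t"] s
    by (simp add: case_prod_unfold)
  have "(\<Sum>\<^sub>\<infinity>l\<in>{1..}. \<Sum>\<^sub>\<infinity>t\<in>{l..}. f l t) = infsum (\<lambda>(l, t). f l t) (SIGMA l:{1..}. {l..})"
    by (rule infsum_Sigma'_banach[OF s])
  also have "\<dots> = infsum (\<lambda>(t, l). f l t) (SIGMA t:{1..}. {1..t})"
    using infsum_reindex_bij_betw[OF bij_betw_triangle, of "\<lambda>(l, t). f l t"] by (simp add: case_prod_unfold)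
  also have "\<dots> = (\<Sum>\<^sub>\<infinity>t\<in>{1..}. \<Sum>\<^sub>\<infinity>l\<in>{1..t}. f l t)"
    by (rule infsum_Sigma'_banach[OF s', symmetric])
  finally show "(\<Sum>\<^sub>\<infinity>l\<in>{1..}. \<Sum>\<^sub>\<infinity>t\<in>{l..}. f l t) = (\<Sum>\<^sub>\<infinity>t\<in>{1..}. \<Sum>l=1..t. f l t)" by simp
  show "(\<lambda>l. \<Sum>\<^sub>\<infinity>t\<in>{l..}. f l t) summable_on {1..}" by (rule summable_on_Sigma_banach[OF s])
  show "(\<lambda>t. \<Sum>l=1..t. f l t) summable_on {1..}" using summable_on_Sigma_banach[OF s'] by simp
qed

text \<open>For fixed \<open>l\<close> the inner sum is \<open>v l\<close> times the total of \<open>p\<close>.\<close>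
lemma summable_triangle_rows:
  fixes p v :: "nat \<Rightarrow> real"
  assumes p: "p summable_on UNIV" "\<And>k. 0 \<le> p k" and v: "v summable_on {1..}" "\<And>k. 0 \<le> v k"
  shows "(\<lambda>(l, t). p (t - l) * v l) summable_on (SIGMA l:{1..}. {l..})"
proof (rule summable_on_SigmaI)
  fix l :: nat assume "l \<in> {1..}"
  have "bij_betw (\<lambda>t. t - l) {l..} UNIV"
    by (rule bij_betwI[where g = "\<lambda>k. k + l"]) auto
  then have "((\<lambda>t. p (t - l)) has_sum infsum p UNIV) {l..}"
    using has_sum_reindex_bij_betw[of "\<lambda>t. t - l" "{l..}" UNIV p "infsum p UNIV"] p(1) by simp
  then show "((\<lambda>t. case (l, t) of (l, t) \<Rightarrow> p (t - l) * v l) has_sum infsum p UNIV * v l) {l..}"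
    by (simp add: has_sum_cmult_left)
qed (use p v in \<open>auto intro: summable_on_cmult_right\<close>)

text \<open>For fixed \<open>t\<close> the inner sum is finite and at most \<open>v t\<close> times the total of \<open>p\<close>.\<close>
lemma summable_triangle_columns:
  fixes p v :: "nat \<Rightarrow> real"
  assumes p: "p summable_on UNIV" "\<And>k. 0 \<le> p k" and v: "v summable_on {1..}" "\<And>k. 0 \<le> v k"
  shows "(\<lambda>(l, t). p (t - l) * v t) summable_on (SIGMA l:{1..}. {l..})"
proof -
  have "(\<lambda>(t, l). p (t - l) * v t) summable_on (SIGMA t:{1..}. {1..t})"
  proof (rule summable_on_SigmaI)
    fix t :: nat
    show "((\<lambda>l. case (t, l) of (t, l) \<Rightarrow> p (t - l) * v t) has_sum (\<Sum>l=1..t. p (t - l)) * v t) {1..t}"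
      by (simp add: has_sum_finiteI sum_distrib_right)
  next
    show "(\<lambda>t. (\<Sum>l=1..t. p (t - l)) * v t) summable_on {1..}"
    proof (rule summable_on_comparison_test[OF summable_on_cmult_right[OF v(1), of "infsum p UNIV"]])
      fix t :: nat
      have "(\<Sum>l=1..t. p (t - l)) = (\<Sum>k\<in>(\<lambda>l. t - l) ` {1..t}. p k)"
        by (subst sum.reindex) (auto simp: inj_on_def)
      also have "\<dots> \<le> infsum p UNIV" using p by (intro finite_sum_le_infsum) auto
      finally show "(\<Sum>l=1..t. p (t - l)) * v t \<le> infsum p UNIV * v t" using v(2) by (rule mult_right_mono)
    qed (use p v in \<open>auto intro!: mult_nonneg_nonneg sum_nonneg\<close>)
  qed (use p v in auto)
  then show ?thesis
    using summable_on_reindex_bij_betw[OF bij_betw_triangle, of "\<lambda>(l, t). p (t - l) * v t"]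
    by (simp add: case_prod_unfold)
qed

lemma norm_summable_comparison:
  fixes f :: "'a \<Rightarrow> 'b::banach"
  assumes "q summable_on A" "\<And>x. x \<in> A \<Longrightarrow> norm (f x) \<le> q x"
  shows "f summable_on A" "(\<lambda>x. norm (f x)) summable_on A"
proof -
  show "(\<lambda>x. norm (f x)) summable_on A"
    by (rule summable_on_comparison_test[OF assms(1)]) (use assms(2) in auto)
  then show "f summable_on A" by (rule abs_summable_summable)
qed

section \<open>The solution of the infinite system\<close>

locale outer_factorization_system = outer_factorization w h a
  for w h :: "complex \<Rightarrow> complex^'d^'d" and a :: "nat \<Rightarrow> complex^'d^'d" +
  fixes y :: "nat \<Rightarrow> complex^'d^'d"
  assumes y_summable: "(\<lambda>k. opnorm (y k)) summable_on {1..}"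
begin

lemma y_norm_summable: "(\<lambda>k. norm (y k)) summable_on {1..}"
  by (rule summable_on_comparison_test[OF summable_on_cmult_right[OF y_summable] norm_le_opnorm]) simp

lemma neg_inv_coeff_summable_on: "(\<lambda>k. norm (neg_inv_coeff k)) summable_on UNIV"
  using neg_inv_coeff_summable by (intro summable_nonneg_imp_summable_on) auto

text \<open>With \<open>L\<close> the lower triangular block Toeplitz matrix of \<open>neg_inv\<close>, the inverse of the infinite Toeplitz matrix
is the product of \<open>L\<close> and its adjoint; \<open>half_sol\<close> is the adjoint applied to \<open>y\<close>, and applying \<open>L\<close> to it gives the
solution.\<close>
definition half_sol :: "nat \<Rightarrow> complex^'d^'d" where
  "half_sol l = (\<Sum>\<^sub>\<infinity>t\<in>{l..}. hconj (neg_inv_coeff (t - l)) ** y t)"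

lemma half_sol_terms:
  "(\<lambda>(l, t). norm (hconj (neg_inv_coeff (t - l)) ** y t)) summable_on (SIGMA l:{1..}. {l..})"
  using summable_triangle_columns[OF neg_inv_coeff_summable_on _ y_norm_summable]
  by (rule summable_on_comparison_test) (auto intro: order_trans[OF norm_matrix_mult_le])

lemma half_sol_term_summable: "l \<ge> 1 \<Longrightarrow> (\<lambda>t. norm (hconj (neg_inv_coeff (t - l)) ** y t)) summable_on {l..}"
  using summable_on_SigmaD1[OF half_sol_terms, of l] by simp

lemma half_sol_has_sum: "l \<ge> 1 \<Longrightarrow> ((\<lambda>t. hconj (neg_inv_coeff (t - l)) ** y t) has_sum half_sol l) {l..}"
  unfolding half_sol_def by (rule has_sum_infsum[OF abs_summable_summable[OF half_sol_term_summable]])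

lemma half_sol_summable: "(\<lambda>l. norm (half_sol l)) summable_on {1..}"
proof (rule summable_on_comparison_test[OF infsum_triangle_swap(2)[OF half_sol_terms]])
  fix l :: nat assume "l \<in> {1..}"
  then show "norm (half_sol l) \<le> (\<Sum>\<^sub>\<infinity>t\<in>{l..}. norm (hconj (neg_inv_coeff (t - l)) ** y t))"
    unfolding half_sol_def by (intro norm_infsum_bound half_sol_term_summable) simp
qed simp

text \<open>Exchanging the finite sum over \<open>l\<close> with the series over \<open>t\<close> splits the formula into two triangular steps.\<close>
lemma Z_inf_eq:
  assumes s: "s \<ge> 1" shows "Z_inf a y s = (\<Sum>l=1..s. neg_inv_coeff (s - l) ** half_sol l)"
proof -
  let ?F = "\<lambda>l t. neg_inv_coeff (s - l) ** (hconj (neg_inv_coeff (t - l)) ** y t)"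
  have F: "hconj (a (s - l)) ** a (t - l) ** y t = ?F l t" for l t
    by (simp add: neg_inv_coeff_def matrix_mul_assoc)
  have Fs: "(?F l has_sum (neg_inv_coeff (s - l) ** half_sol l)) {l..}" if "l \<in> {1..s}" for l
    by (rule has_sum_bounded_linear[OF mm.bounded_linear_right half_sol_has_sum]) (use that in simp)
  have Fs': "((\<lambda>t. if l \<le> t then ?F l t else 0) has_sum (neg_inv_coeff (s - l) ** half_sol l)) {1..}" if "l \<in> {1..s}" for l
    using Fs[OF that] by (rule has_sum_cong_neutral[THEN iffD1, rotated -1]) (use that in auto)
  have "Z_inf a y s = (\<Sum>\<^sub>\<infinity>t\<in>{1..}. \<Sum>l\<in>{1..s}. if l \<le> t then ?F l t else 0)"
    unfolding Z_inf_def F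
  proof (rule infsum_cong)
    fix t :: nat
    have "(\<Sum>l\<in>{1..s}. if l \<le> t then ?F l t else 0) = (\<Sum>l\<in>{l \<in> {1..s}. l \<le> t}. ?F l t)"
      by (rule sum.inter_filter[symmetric]) simp
    also have "{l \<in> {1..s}. l \<le> t} = {1..min s t}" by auto
    finally show "(\<Sum>l=1..min s t. ?F l t) = (\<Sum>l\<in>{1..s}. if l \<le> t then ?F l t else 0)" by simp
  qed
  also have "\<dots> = (\<Sum>l\<in>{1..s}. \<Sum>\<^sub>\<infinity>t\<in>{1..}. if l \<le> t then ?F l t else 0)"
    using Fs' by (intro infsum_finite_sum) (auto intro: has_sum_imp_summable)
  also have "\<dots> = (\<Sum>l=1..s. neg_inv_coeff (s - l) ** half_sol l)"
    using Fs' by (intro sum.cong refl infsumI) auto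
  finally show ?thesis .
qed

definition sol :: "nat \<Rightarrow> complex^'d^'d" where "sol s = (\<Sum>l=1..s. neg_inv_coeff (s - l) ** half_sol l)"

lemma sol_terms: "(\<lambda>(l, t). norm (neg_inv_coeff (t - l)) * norm (half_sol l)) summable_on (SIGMA l:{1..}. {l..})"
  by (rule summable_triangle_rows[OF neg_inv_coeff_summable_on _ half_sol_summable]) auto

lemma sol_summable: "(\<lambda>s. norm (sol s)) summable_on {1..}"
proof (rule summable_on_comparison_test[OF infsum_triangle_swap(3)[OF sol_terms]])
  show "norm (sol s) \<le> (\<Sum>l=1..s. norm (neg_inv_coeff (s - l)) * norm (half_sol l))" for s
    unfolding sol_def by (intro sum_norm_le norm_matrix_mult_le)
qed simp

lemma gamma_le: "norm (\<gamma> k) \<le> (\<Sum>\<^sub>\<infinity>j. norm (\<gamma> j))"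
  using finite_sum_le_infsum[OF gamma_summable, of "{k}"] by simp

lemma toeplitz_sol_summable: "(\<lambda>t. \<gamma> (s - int t) ** sol t) summable_on {1..}"
proof (rule norm_summable_comparison(1)[OF summable_on_cmult_right[OF sol_summable]])
  show "norm (\<gamma> (s - int t) ** sol t) \<le> (\<Sum>\<^sub>\<infinity>j. norm (\<gamma> j)) * norm (sol t)" for t
    by (rule order_trans[OF norm_matrix_mult_le mult_right_mono[OF gamma_le]]) simp
qed

text \<open>The identity for \<open>l = 0\<close> is translated along the diagonal, by which the Toeplitz matrix is invariant.\<close>
lemma toeplitz_neg_inv_shift:
  "((\<lambda>t. \<gamma> (s - int t) ** neg_inv_coeff (t - l)) has_sum (if s \<le> int l then - hconj (h_coeff (nat (int l - s))) else 0)) {l..}"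
proof -
  have bij: "bij_betw (\<lambda>k. k + l) UNIV {l..}"
    by (rule bij_betwI[where g = "\<lambda>t. t - l"]) auto
  have "(\<lambda>k. \<gamma> ((s - int l) - int k) ** neg_inv_coeff k) summable_on UNIV"
  proof (rule norm_summable_comparison(1)[OF summable_on_cmult_right[OF neg_inv_coeff_summable_on]])
    show "norm (\<gamma> ((s - int l) - int k) ** neg_inv_coeff k) \<le> (\<Sum>\<^sub>\<infinity>j. norm (\<gamma> j)) * norm (neg_inv_coeff k)" for k
      by (rule order_trans[OF norm_matrix_mult_le mult_right_mono[OF gamma_le]]) simp
  qed
  then have "((\<lambda>k. \<gamma> ((s - int l) - int k) ** neg_inv_coeff k) has_sum (\<Sum>\<^sub>\<infinity>k. \<gamma> ((s - int l) - int k) ** neg_inv_coeff k)) UNIV"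
    by (rule has_sum_infsum)
  moreover from has_sum_imp_sums[OF this] have "(\<Sum>\<^sub>\<infinity>k. \<gamma> ((s - int l) - int k) ** neg_inv_coeff k) =
     (if s - int l \<le> 0 then - hconj (h_coeff (nat (- (s - int l)))) else 0)"
    using toeplitz_neg_inv[of "s - int l"] by (rule sums_unique2)
  ultimately have H: "((\<lambda>k. \<gamma> ((s - int l) - int k) ** neg_inv_coeff k) has_sum
      (if s - int l \<le> 0 then - hconj (h_coeff (nat (- (s - int l)))) else 0)) UNIV"
    by (simp only:)
  have e: "(s - int l) - int k = s - int (k + l)" "(s - int l \<le> 0) = (s \<le> int l)" "- (s - int l) = int l - s" for k
    by auto
  show ?thesis
    using has_sum_reindex_bij_betw[OF bij, of "\<lambda>t. \<gamma> (s - int t) ** neg_inv_coeff (t - l)"] H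
    by (simp only: e add_diff_cancel_right')
qed

lemma hconj_h_neg_inv_convolution:
  assumes "s \<le> t" "1 \<le> s"
  shows "(\<Sum>l=s..t. hconj (h_coeff (l - s)) ** hconj (neg_inv_coeff (t - l))) = (if t = s then - mat 1 else 0)"
proof -
  have "(\<Sum>l=s..t. hconj (h_coeff (l - s)) ** hconj (neg_inv_coeff (t - l))) = (\<Sum>l=s..t. hconj (neg_inv_coeff (t - l) ** h_coeff (l - s)))"
    by (simp add: hconj_mult)
  also have "\<dots> = hconj (\<Sum>l=s..t. neg_inv_coeff (t - l) ** h_coeff (l - s))"
    by (rule linear_sum[OF bounded_linear.linear[OF bounded_linear_hconj], symmetric])
  also have "(\<Sum>l=s..t. neg_inv_coeff (t - l) ** h_coeff (l - s)) = (\<Sum>k\<le>t - s. neg_inv_coeff k ** h_coeff ((t - s) - k))"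
    by (rule sum.reindex_bij_witness[of _ "\<lambda>k. t - k" "\<lambda>l. t - l"]) (use assms in \<open>auto intro!: arg_cong2[where f = "(**)"] arg_cong[where f = h_coeff]\<close>)
  also have "\<dots> = (if t = s then - mat 1 else 0)"
    unfolding neg_inv_h_convolution using assms by auto
  also have "hconj (if t = s then - mat 1 else 0) = (if t = s then - mat 1 else 0)"
    by (auto simp: vec_eq_iff mat_def)
  finally show ?thesis .
qed

text \<open>Let \<open>L\<close> be the lower triangular block Toeplitz matrix of \<open>neg_inv\<close>. The product of the Toeplitz matrix and
\<open>L\<close> is minus the adjoint of the matrix of \<open>h\<close> (\<open>K\<close> is its row \<open>s\<close>), because
\<open>w ** neg_inv = - hconj h\<close>; this in turn cancels the adjoint of \<open>L\<close> in \<open>half_sol\<close>, because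
\<open>neg_inv ** h = - mat 1\<close>. Both exchanges of summation rest on the absolute summability of the coefficients.\<close>
lemma toeplitz_sol:
  assumes s: "1 \<le> s"
  shows "((\<lambda>t. \<gamma> (int s - int t) ** sol t) has_sum y s) {1..}"
proof -
  obtain B where B: "\<And>k. norm (h_coeff k) \<le> B" using h_coeff_bounded by blast
  define K where "K l = (if s \<le> l then - hconj (h_coeff (l - s)) else 0)" for l
  have K: "((\<lambda>t. \<gamma> (int s - int t) ** neg_inv_coeff (t - l)) has_sum K l) {l..}" for l
    using toeplitz_neg_inv_shift[of "int s" l] by (simp add: K_def nat_diff_distrib' split: if_splits)
  have KB: "norm (K l) \<le> B" for l
    using B[of "l - s"] order_trans[OF norm_ge_zero B] by (auto simp: K_def)
  let ?f = "\<lambda>l t. \<gamma> (int s - int t) ** (neg_inv_coeff (t - l) ** half_sol l)"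
  let ?q = "\<lambda>l t. K l ** (hconj (neg_inv_coeff (t - l)) ** y t)"
  have f: "(\<lambda>(l, t). ?f l t) summable_on (SIGMA l:{1..}. {l..})"
  proof (rule norm_summable_comparison(1)[OF summable_on_cmult_right[OF sol_terms, of "\<Sum>\<^sub>\<infinity>j. norm (\<gamma> j)"]])
    fix p :: "nat \<times> nat"
    have "norm (?f l t) \<le> (\<Sum>\<^sub>\<infinity>j. norm (\<gamma> j)) * (norm (neg_inv_coeff (t - l)) * norm (half_sol l))" for l t
      by (rule order_trans[OF norm_matrix_mult_le]) (intro mult_mono gamma_le norm_matrix_mult_le infsum_nonneg; simp)
    then show "norm (case p of (l, t) \<Rightarrow> ?f l t) \<le> (\<Sum>\<^sub>\<infinity>j. norm (\<gamma> j)) * (case p of (l, t) \<Rightarrow> norm (neg_inv_coeff (t - l)) * norm (half_sol l))"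
      by (cases p) simp
  qed
  have q: "(\<lambda>(l, t). ?q l t) summable_on (SIGMA l:{1..}. {l..})"
  proof (rule norm_summable_comparison(1)[OF summable_on_cmult_right[OF half_sol_terms, of B]])
    fix p :: "nat \<times> nat"
    have "norm (?q l t) \<le> B * norm (hconj (neg_inv_coeff (t - l)) ** y t)" for l t
      by (rule order_trans[OF norm_matrix_mult_le mult_right_mono[OF KB]]) simp
    then show "norm (case p of (l, t) \<Rightarrow> ?q l t) \<le> B * (case p of (l, t) \<Rightarrow> norm (hconj (neg_inv_coeff (t - l)) ** y t))"
      by (cases p) simp
  qed
  have "(\<Sum>\<^sub>\<infinity>t\<in>{1..}. \<gamma> (int s - int t) ** sol t) = (\<Sum>\<^sub>\<infinity>t\<in>{1..}. \<Sum>l=1..t. ?f l t)"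
    by (simp add: sol_def mm.sum_right)
  also have "\<dots> = (\<Sum>\<^sub>\<infinity>l\<in>{1..}. \<Sum>\<^sub>\<infinity>t\<in>{l..}. ?f l t)"
    by (rule infsum_triangle_swap(1)[OF f, symmetric])
  also have "\<dots> = (\<Sum>\<^sub>\<infinity>l\<in>{1..}. K l ** half_sol l)"
  proof (rule infsum_cong)
    fix l :: nat
    have "((\<lambda>t. \<gamma> (int s - int t) ** neg_inv_coeff (t - l) ** half_sol l) has_sum (K l ** half_sol l)) {l..}"
      by (rule has_sum_bounded_linear[OF mm.bounded_linear_left K])
    then show "(\<Sum>\<^sub>\<infinity>t\<in>{l..}. ?f l t) = K l ** half_sol l" by (simp add: matrix_mul_assoc infsumI)
  qed
  also have "\<dots> = (\<Sum>\<^sub>\<infinity>l\<in>{1..}. \<Sum>\<^sub>\<infinity>t\<in>{l..}. ?q l t)"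
  proof (rule infsum_cong)
    fix l :: nat assume "l \<in> {1..}"
    then have "((\<lambda>t. hconj (neg_inv_coeff (t - l)) ** y t) has_sum half_sol l) {l..}"
      by (intro half_sol_has_sum) simp
    from has_sum_bounded_linear[OF mm.bounded_linear_right this, of "K l"]
    show "K l ** half_sol l = (\<Sum>\<^sub>\<infinity>t\<in>{l..}. ?q l t)" by (simp add: infsumI)
  qed
  also have "\<dots> = (\<Sum>\<^sub>\<infinity>t\<in>{1..}. \<Sum>l=1..t. ?q l t)" by (rule infsum_triangle_swap(1)[OF q])
  also have "\<dots> = (\<Sum>\<^sub>\<infinity>t\<in>{1..}. if t = s then y s else 0)"
  proof (rule infsum_cong)
    fix t :: nat
    show "(\<Sum>l=1..t. ?q l t) = (if t = s then y s else 0)"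
    proof (cases "s \<le> t")
      case True
      have "(\<Sum>l=1..t. ?q l t) = (\<Sum>l=s..t. ?q l t)"
        using s by (intro sum.mono_neutral_right) (auto simp: K_def mm.zero_left)
      also have "\<dots> = (\<Sum>l=s..t. - (hconj (h_coeff (l - s)) ** hconj (neg_inv_coeff (t - l)) ** y t))"
        by (rule sum.cong) (auto simp: K_def mm.minus_left matrix_mul_assoc)
      also have "\<dots> = - ((\<Sum>l=s..t. hconj (h_coeff (l - s)) ** hconj (neg_inv_coeff (t - l))) ** y t)"
        by (simp add: mm.sum_left sum_negf)
      also have "\<dots> = (if t = s then y s else 0)"
        unfolding hconj_h_neg_inv_convolution[OF True s] by (simp add: mm.minus_left mm.zero_left)
      finally show ?thesis .
    next
      case False
      then have "?q l t = 0" if "l \<in> {1..t}" for l using that by (simp add: K_def mm.zero_left)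
      with False show ?thesis by simp
    qed
  qed
  also have "\<dots> = y s"
    using infsum_cong_neutral[of "{s}" "{1..}" "\<lambda>t. if t = s then y s else 0" "\<lambda>t. if t = s then y s else 0"] s by auto
  finally show ?thesis using has_sum_infsum[OF toeplitz_sol_summable[of "int s"]] by simp
qed

section \<open>Convergence of the finite sections\<close>

lemma sol_tail_tendsto: "(\<lambda>n. \<Sum>\<^sub>\<infinity>t\<in>{n<..}. norm (sol t)) \<longlonglongrightarrow> 0"
proof -
  have bij: "bij_betw (\<lambda>k. k + Suc n) UNIV {n<..}" for n
    by (rule bij_betwI[where g = "\<lambda>t. t - Suc n"]) auto
  have s: "(\<lambda>k. norm (sol (k + Suc n))) summable_on UNIV" for n
  proof -
    have "(\<lambda>t. norm (sol t)) summable_on {n<..}" by (rule summable_on_subset_banach[OF sol_summable]) auto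
    then show ?thesis using summable_on_reindex_bij_betw[OF bij, of "\<lambda>t. norm (sol t)" n] by (simp only:)
  qed
  have eq: "(\<Sum>\<^sub>\<infinity>t\<in>{n<..}. norm (sol t)) = (\<Sum>k. norm (sol (k + Suc n)))" for n
    using infsum_reindex_bij_betw[OF bij, of "\<lambda>t. norm (sol t)" n] has_sum_imp_sums[OF has_sum_infsum[OF s[of n]]]
    by (simp add: sums_iff)
  have "summable (\<lambda>k. norm (sol (k + Suc 0)))" by (rule summable_on_imp_summable[OF s])
  from suminf_exist_split2[OF this] show ?thesis unfolding eq by (simp add: add.commute add.left_commute)
qed

text \<open>Subtracting the first \<open>n\<close> rows of the infinite system from the finite one, one sees that the difference
solves a finite Toeplitz system whose right-hand side is the tail of the infinite products.\<close>
lemma section_error: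
  assumes C0: "0 \<le> C" and C: "\<And>I (u :: int \<Rightarrow> complex^'d^'d). finite I \<Longrightarrow>
     (\<Sum>s\<in>I. norm (u s)) \<le> C * (\<Sum>s\<in>I. norm (\<Sum>t\<in>I. \<gamma> (s - t) ** u t))"
    and Z: "toeplitz_solution w y n Z"
  shows "(\<Sum>k=1..n. norm (Z k - sol k)) \<le> C * ((\<Sum>\<^sub>\<infinity>j. norm (\<gamma> j)) * (\<Sum>\<^sub>\<infinity>t\<in>{n<..}. norm (sol t)))"
proof -
  let ?b = "\<Sum>\<^sub>\<infinity>j. norm (\<gamma> j)"
  let ?I = "{1..n}"
  have xs: "(\<lambda>t. norm (sol t)) summable_on {n<..}"
    by (rule summable_on_subset_banach[OF sol_summable]) auto
  have res: "(\<Sum>t\<in>?I. \<gamma> (int s - int t) ** (Z t - sol t)) = (\<Sum>\<^sub>\<infinity>t\<in>{n<..}. \<gamma> (int s - int t) ** sol t)" if s: "s \<in> ?I" for s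
  proof -
    have "{1..} = ?I \<union> {n<..}" using s by auto
    then have "y s = infsum (\<lambda>t. \<gamma> (int s - int t) ** sol t) (?I \<union> {n<..})"
      using infsumI[OF toeplitz_sol[of s]] s by simp
    also have "\<dots> = infsum (\<lambda>t. \<gamma> (int s - int t) ** sol t) ?I + (\<Sum>\<^sub>\<infinity>t\<in>{n<..}. \<gamma> (int s - int t) ** sol t)"
    proof (rule infsum_Un_disjoint)
      show "(\<lambda>t. \<gamma> (int s - int t) ** sol t) summable_on {n<..}"
        by (rule summable_on_subset_banach[OF toeplitz_sol_summable]) auto
    qed auto
    finally have "y s = (\<Sum>t\<in>?I. \<gamma> (int s - int t) ** sol t) + (\<Sum>\<^sub>\<infinity>t\<in>{n<..}. \<gamma> (int s - int t) ** sol t)" by simp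
    moreover have "(\<Sum>t\<in>?I. \<gamma> (int s - int t) ** Z t) = y s"
      using Z s by (simp add: toeplitz_solution_def toeplitz_block_def)
    ultimately show ?thesis by (simp add: mm.diff_right sum_subtractf)
  qed
  have row: "(\<lambda>t. norm (\<gamma> (int s - int t)) * norm (sol t)) summable_on {n<..}" for s
    by (rule summable_on_comparison_test[OF summable_on_cmult_right[OF xs, of ?b]])
      (auto intro: mult_right_mono gamma_le)
  have resle: "norm (\<Sum>\<^sub>\<infinity>t\<in>{n<..}. \<gamma> (int s - int t) ** sol t) \<le> (\<Sum>\<^sub>\<infinity>t\<in>{n<..}. norm (\<gamma> (int s - int t)) * norm (sol t))" for s
  proof -
    have a: "(\<lambda>t. norm (\<gamma> (int s - int t) ** sol t)) summable_on {n<..}"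
      by (rule norm_summable_comparison(2)[OF row norm_matrix_mult_le])
    show ?thesis
      by (rule order_trans[OF norm_infsum_bound[OF a] infsum_mono[OF a row norm_matrix_mult_le]])
  qed
  have "(\<Sum>k=1..n. norm (Z k - sol k)) = (\<Sum>s\<in>int ` ?I. norm (Z (nat s) - sol (nat s)))"
    by (simp add: sum.reindex)
  also have "\<dots> \<le> C * (\<Sum>s\<in>int ` ?I. norm (\<Sum>t\<in>int ` ?I. \<gamma> (s - t) ** (Z (nat t) - sol (nat t))))"
    by (rule C) simp
  also have "(\<Sum>s\<in>int ` ?I. norm (\<Sum>t\<in>int ` ?I. \<gamma> (s - t) ** (Z (nat t) - sol (nat t)))) =
     (\<Sum>s\<in>?I. norm (\<Sum>t\<in>?I. \<gamma> (int s - int t) ** (Z t - sol t)))"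
    by (simp add: sum.reindex)
  also have "\<dots> \<le> (\<Sum>s\<in>?I. \<Sum>\<^sub>\<infinity>t\<in>{n<..}. norm (\<gamma> (int s - int t)) * norm (sol t))"
    by (intro sum_mono) (simp only: res resle)
  also have "\<dots> = (\<Sum>\<^sub>\<infinity>t\<in>{n<..}. \<Sum>s\<in>?I. norm (\<gamma> (int s - int t)) * norm (sol t))"
    by (rule infsum_finite_sum[symmetric]) (use row in auto)
  also have "\<dots> \<le> (\<Sum>\<^sub>\<infinity>t\<in>{n<..}. ?b * norm (sol t))"
  proof (rule infsum_mono)
    show "(\<lambda>t. \<Sum>s\<in>?I. norm (\<gamma> (int s - int t)) * norm (sol t)) summable_on {n<..}"
      by (intro summable_on_finite_sum row) simp
    show "(\<lambda>t. ?b * norm (sol t)) summable_on {n<..}" by (rule summable_on_cmult_right[OF xs])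
    fix t
    have "(\<Sum>s\<in>?I. norm (\<gamma> (int s - int t))) = (\<Sum>k\<in>(\<lambda>s. int s - int t) ` ?I. norm (\<gamma> k))"
      by (subst sum.reindex) (auto simp: inj_on_def)
    also have "\<dots> \<le> ?b" by (rule finite_sum_le_infsum[OF gamma_summable]) auto
    finally show "(\<Sum>s\<in>?I. norm (\<gamma> (int s - int t)) * norm (sol t)) \<le> ?b * norm (sol t)"
      by (simp only: sum_distrib_right[symmetric] mult_right_mono norm_ge_zero)
  qed
  also have "\<dots> = ?b * (\<Sum>\<^sub>\<infinity>t\<in>{n<..}. norm (sol t))"
    by (rule infsum_cmult_right) (use xs in auto)
  finally show ?thesis using C0 by (simp add: mult_left_mono)
qed

lemma sections_converge:
  assumes Z: "\<And>n. n \<ge> 1 \<Longrightarrow> toeplitz_solution w y n (Z n)"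
  shows "(\<lambda>n. \<Sum>k=1..n. opnorm (Z n k - sol k)) \<longlonglongrightarrow> 0"
proof -
  obtain \<kappa> where \<kappa>: "0 < \<kappa>" and low: "symbol_bound w \<kappa>"
    by (rule w_coercive)
  obtain C where C0: "0 \<le> C" and C: "\<And>I (u :: int \<Rightarrow> complex^'d^'d). finite I \<Longrightarrow>
     (\<Sum>s\<in>I. norm (u s)) \<le> C * (\<Sum>s\<in>I. norm (\<Sum>t\<in>I. \<gamma> (s - t) ** u t))"
    using toeplitz_l1_stability[OF w_L1 gamma_summable \<kappa> low] by blast
  let ?e = "\<lambda>n. C * ((\<Sum>\<^sub>\<infinity>j. norm (\<gamma> j)) * (\<Sum>\<^sub>\<infinity>t\<in>{n<..}. norm (sol t)))"
  have lim: "?e \<longlonglongrightarrow> 0" by (intro tendsto_mult_right_zero sol_tail_tendsto)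
  show ?thesis
  proof (rule tendsto_sandwich[OF _ _ tendsto_const lim])
    show "\<forall>\<^sub>F n in sequentially. 0 \<le> (\<Sum>k=1..n. opnorm (Z n k - sol k))"
      by (intro always_eventually allI sum_nonneg opnorm_nonneg)
    show "\<forall>\<^sub>F n in sequentially. (\<Sum>k=1..n. opnorm (Z n k - sol k)) \<le> ?e n"
      unfolding eventually_sequentially
    proof (intro exI[of _ 1] allI impI)
      fix n :: nat assume "1 \<le> n"
      have "(\<Sum>k=1..n. opnorm (Z n k - sol k)) \<le> (\<Sum>k=1..n. norm (Z n k - sol k))"
        by (intro sum_mono opnorm_le_norm)
      also have "\<dots> \<le> ?e n" by (rule section_error[OF C0 C Z[OF \<open>1 \<le> n\<close>]])
      finally show "(\<Sum>k=1..n. opnorm (Z n k - sol k)) \<le> ?e n" .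
    qed
  qed
qed

end

theorem theorem4p1:
  fixes w h :: "complex \<Rightarrow> complex^'d^'d"
    and y z a :: "nat \<Rightarrow> complex^'d^'d"
    and Z :: "nat \<Rightarrow> nat \<Rightarrow> complex^'d^'d"
  assumes "L1_mat w"
    and "AE \<theta> in circle_measure. pos_hermitian (w (cis \<theta>))"
    and "(\<lambda>k::int. opnorm (fourier_coeff w k)) summable_on UNIV"
    and "continuous_on (sphere 0 1) w"
    and "(INF \<zeta>\<in>sphere 0 1. Re (det (w \<zeta>))) > 0"
    and "(\<lambda>k. opnorm (y k)) summable_on {1..}"
    and "\<And>n. n \<ge> 1 \<Longrightarrow> toeplitz_solution w y n (Z n)"
    and "outer_H2_mat h"
    and "AE \<theta> in circle_measure. w (cis \<theta>) = hconj (h (cis \<theta>)) ** h (cis \<theta>)"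
    and "atilde_coeffs h a"
    and "\<And>s. s \<ge> 1 \<Longrightarrow> z s = Z_inf a y s"
  shows "toeplitz_solution_inf w y z \<and>
         (\<lambda>n. \<Sum>k=1..n. opnorm (Z n k - z k)) \<longlonglongrightarrow> 0"
proof -
  interpret outer_factorization_system w h a y
    by unfold_locales (fact assms)+
  have z_eq: "z s = sol s" if "s \<ge> 1" for s
    using assms(11)[OF that] Z_inf_eq[OF that] by (simp add: sol_def)
  have "toeplitz_solution_inf w y z"
    unfolding toeplitz_solution_inf_def toeplitz_block_def
  proof (intro allI impI)
    fix s :: nat assume "s \<ge> 1"
    then have "((\<lambda>t. fourier_coeff w (int s - int t) ** sol t) has_sum y s) {1..}" by (rule toeplitz_sol)
    then show "((\<lambda>t. fourier_coeff w (int s - int t) ** z t) has_sum y s) {1..}"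
      by (rule has_sum_cong[THEN iffD1, rotated]) (simp add: z_eq)
  qed
  moreover have "(\<lambda>n. \<Sum>k=1..n. opnorm (Z n k - z k)) \<longlonglongrightarrow> 0"
  proof -
    have "(\<Sum>k=1..n. opnorm (Z n k - z k)) = (\<Sum>k=1..n. opnorm (Z n k - sol k))" for n
      by (rule sum.cong) (auto simp: z_eq)
    then show ?thesis using sections_converge[OF assms(7)] by simp
  qed
  ultimately show ?thesis ..
qed

end
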